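(* Let $X=V(f)\subset\mathbb P^N$ be a cubic hypersurface with vanishing hessian, let $Z\subset(\mathbb P^N)^*$ be its polar image, $\mathcal P_X$ its Perazzo map, $W_X$ the closure of the image of $\mathcal P_X$ and $\mu=\dim W_X$. Let $w=[(T_{\Phi_X(p)}Z)^*]\in W_X\subset\mathbb G(\operatorname{codim}(Z)-1,N)$ be a general point, with $p\in\mathbb P^N$ general. Then $$\overline{\mathcal P_X^{-1}(w)}=\bigcap_{r\in(T_{\Phi_X(p)}Z)^*=\operatorname{Sing}Q_p}\operatorname{Sing}Q_r,$$ and this is a linear space $\mathbb P^{N-\mu}_w\subseteq\mathbb P^N$ of dimension $N-\mu$.
   Context: The ground field $\mathbb K$ is algebraically closed of characteristic zero; hypersurfaces $X=V(f)\subset\mathbb P^N$ are reduced. $X$ has vanishing hessian if $\det\left[\frac{\partial^2f}{\partial x_i\partial x_j}\right]\equiv0$. The polar map is $\Phi_X:\mathbb P^N\dashrightarrow(\mathbb P^N)^*$, $p\mapsto(\frac{\partial f}{\partial x_0}(p):\dots:\frac{\partial f}{\partial x_N}(p))$, and the polar image is $Z=\overline{\Phi_X(\mathbb P^N)}\subsetneq(\mathbb P^N)^*$. For a linear space $\Lambda\subset(\mathbb P^N)^*$, $\Lambda^*\subset\mathbb P^N$ is the linear space of points corresponding to hyperplanes of $(\mathbb P^N)^*$ containing $\Lambda$. $T_zZ$ is the projective tangent space to $Z$ at a smooth point $z$. The Perazzo map is the rational map $\mathcal P_X:\mathbb P^N\dashrightarrow\mathbb G(\operatorname{codim}(Z)-1,N)$,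 $p\mapsto(T_{\Phi_X(p)}Z)^*$, defined on $\Phi_X^{-1}(Z_{\rm reg})$, where $Z_{\rm reg}$ is the smooth locus of $Z$. For $p\in\mathbb P^N$, $Q_p$ is the polar quadric of $p$, i.e. the quadric whose associated symmetric matrix is the Hessian matrix of $f$ evaluated at $p$, and $\operatorname{Sing}Q_p$ is the projectivization of the kernel of this matrix (with $Q_p=\operatorname{Sing}Q_p=\mathbb P^N$ if the matrix is zero). For $p$ general, $\operatorname{Sing}Q_p=(T_{\Phi_X(p)}Z)^*$. *)

theory Defs
  imports "HOL-Analysis.Analysis" "HOL-Library.Poly_Mapping"
    "HOL-Computational_Algebra.Computational_Algebra"
begin

section \<open>Polynomials\<close>

text \<open>A polynomial in variables indexed by \<^typ>\<open>'v\<close> maps exponent vectors to coefficients.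
  The ring structure is that of \<^theory>\<open>HOL-Library.Poly_Mapping\<close>.\<close>

type_synonym ('v, 'a) mpoly = "('v \<Rightarrow>\<^sub>0 nat) \<Rightarrow>\<^sub>0 'a"

definition peval :: "('v \<Rightarrow> 'a) \<Rightarrow> ('v, 'a::comm_semiring_1) mpoly \<Rightarrow> 'a" where
  "peval v F = (\<Sum>m\<in>Poly_Mapping.keys F.
     Poly_Mapping.lookup F m * (\<Prod>i\<in>Poly_Mapping.keys m. v i ^ Poly_Mapping.lookup m i))"

text \<open>The zero polynomial is homogeneous of every degree.\<close>

definition homogeneous :: "nat \<Rightarrow> ('v, 'a::zero) mpoly \<Rightarrow> bool" where
  "homogeneous d F \<longleftrightarrow>
     (\<forall>m\<in>Poly_Mapping.keys F. (\<Sum>i\<in>Poly_Mapping.keys m. Poly_Mapping.lookup m i) = d)"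

text \<open>If \<open>i\<close> does not occur in \<open>m\<close>, the truncated difference below is harmless, since the
  coefficient is then zero.\<close>

definition pdiff :: "'v \<Rightarrow> ('v, 'a::comm_semiring_1) mpoly \<Rightarrow> ('v, 'a) mpoly" where
  "pdiff i F = (\<Sum>m\<in>Poly_Mapping.keys F.
     Poly_Mapping.single (m - Poly_Mapping.single i 1)
       (of_nat (Poly_Mapping.lookup m i) * Poly_Mapping.lookup F m))"

section \<open>Dimension and general points\<close>

definition irreducible_in :: "'x topology \<Rightarrow> 'x set \<Rightarrow> bool" where
  "irreducible_in T S \<longleftrightarrow> S \<subseteq> topspace T \<and> S \<noteq> {} \<and>
     (\<forall>A B. closedin T A \<longrightarrow> closedin T B \<longrightarrow> S \<subseteq> A \<union> B \<longrightarrow> S \<subseteq> A \<or> S \<subseteq> B)"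

text \<open>Krull dimension: the supremum of the lengths \<open>n\<close> of strictly increasing chains
  \<open>C 0 \<subset> C 1 \<subset> \<dots> \<subset> C n\<close> of irreducible closed subsets.\<close>

definition krull_dim :: "'x topology \<Rightarrow> enat" where
  "krull_dim T = Sup {enat n |n. \<exists>C.
     (\<forall>i\<le>n. closedin T (C i) \<and> irreducible_in T (C i)) \<and> (\<forall>i<n. C i \<subset> C (Suc i))}"

definition holds_generically :: "'x topology \<Rightarrow> ('x \<Rightarrow> bool) \<Rightarrow> bool" where
  "holds_generically T P \<longleftrightarrow>
     (\<exists>U. openin T U \<and> T closure_of U = topspace T \<and> (\<forall>x\<in>U. P x))"

section \<open>Projective spaces and Grassmannians\<close>

text \<open>With \<open>CARD('n) = N + 1\<close>, the points of \<open>\<P>\<^sup>N\<close> are the lines through the origin in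
  \<^typ>\<open>'a ^ 'n\<close>, and linear subspaces of \<open>\<P>\<^sup>N\<close> are given by vector subspaces. The dual space is
  represented in the same way, through the dual coordinates: the point spanned by \<open>y\<close> is the
  hyperplane \<open>\<Sum>i. y $ i * x $ i = 0\<close>.\<close>

definition proj_points :: "('a::field ^ 'n) set \<Rightarrow> ('a ^ 'n) set set" where
  "proj_points V = {L. vec.subspace L \<and> vec.dim L = 1 \<and> L \<subseteq> V}"

definition is_linear_space :: "nat \<Rightarrow> ('a::field ^ 'n) set set \<Rightarrow> bool" where
  "is_linear_space d S \<longleftrightarrow>
     (\<exists>V. vec.subspace V \<and> vec.dim V = d + 1 \<and> S = proj_points V)"

definition dual_space :: "('a::field ^ 'n) set \<Rightarrow> ('a ^ 'n) set" where
  "dual_space V = {x. \<forall>y\<in>V. (\<Sum>i\<in>UNIV. y $ i * x $ i) = 0}"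

text \<open>The vector dimension is used: \<open>grassmannian m\<close> is \<open>\<G>(m - 1, N)\<close>.\<close>

definition grassmannian :: "nat \<Rightarrow> ('a::field ^ 'n) set set" where
  "grassmannian m = {V. vec.subspace V \<and> vec.dim V = m}"

text \<open>The Zariski topology on a set \<open>X\<close> whose points \<open>x\<close> have homogeneous coordinate vectors
  \<open>c x\<close>. The sets \<open>D(F)\<close> with \<open>F\<close> homogeneous form a basis of it, so the closed sets are the
  common zero loci of families of homogeneous polynomials.\<close>

definition zariski :: "'x set \<Rightarrow> ('x \<Rightarrow> ('v \<Rightarrow> 'a::field) set) \<Rightarrow> 'x topology" where
  "zariski X c = topology_generated_by
     {{x \<in> X. \<forall>v\<in>c x. peval v F \<noteq> 0} |F d. homogeneous d F}"

definition zariski_proj :: "('a::field ^ 'n) set topology" where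
  "zariski_proj = zariski (proj_points UNIV) (\<lambda>L. {($) v |v. v \<in> L \<and> v \<noteq> 0})"

text \<open>Pluecker coordinates of a list of \<open>m\<close> vectors: the \<open>m \<times> m\<close> minors, indexed by all lists
  \<open>I\<close> of \<open>m\<close> column indices (repetitions give zero, reorderings give signs).\<close>

definition pluecker :: "('a::field ^ 'n) list \<Rightarrow> 'n list \<Rightarrow> 'a" where
  "pluecker vs I = (if length I = length vs
     then \<Sum>\<sigma> | \<sigma> permutes {..<length vs}.
            of_int (sign \<sigma>) * (\<Prod>k<length vs. (vs ! k) $ (I ! \<sigma> k))
     else 0)"

definition zariski_grassmannian :: "nat \<Rightarrow> ('a::field ^ 'n) set topology" where
  "zariski_grassmannian m = zariski (grassmannian m)
     (\<lambda>V. {pluecker vs |vs. length vs = m \<and> vec.span (set vs) = V})"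

section \<open>Tangent spaces\<close>

text \<open>Linear subspace of \<^typ>\<open>'a ^ 'n\<close> whose projectivization is the projective tangent space
  \<open>T\<^sub>zZ\<close>: it is cut out by the differentials at \<open>z\<close> of all forms vanishing on \<open>Z\<close>.\<close>

definition vanishes_on :: "('n, 'a::field) mpoly \<Rightarrow> ('a ^ 'n) set set \<Rightarrow> bool" where
  "vanishes_on F Z \<longleftrightarrow> (\<forall>z\<in>Z. \<forall>v\<in>z - {0}. peval (($) v) F = 0)"

definition tangent_space :: "('a::field ^ 'n) set set \<Rightarrow> ('a ^ 'n) set \<Rightarrow> ('a ^ 'n) set" where
  "tangent_space Z z = {u. \<forall>F d. homogeneous d F \<and> vanishes_on F Z \<longrightarrow>
     (\<forall>v\<in>z - {0}. (\<Sum>i\<in>UNIV. peval (($) v) (pdiff i F) * u $ i) = 0)}"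

definition proj_dim :: "('a::field ^ 'n) set set \<Rightarrow> enat" where
  "proj_dim Z = krull_dim (subtopology zariski_proj Z)"

text \<open>Used for irreducible \<open>Z\<close> only, so that all local dimensions equal \<open>proj_dim Z\<close>.\<close>

definition smooth_locus :: "('a::field ^ 'n) set set \<Rightarrow> ('a ^ 'n) set set" where
  "smooth_locus Z = {z \<in> Z. enat (vec.dim (tangent_space Z z)) = proj_dim Z + 1}"

section \<open>Polar map, Hessian and Perazzo map\<close>

definition vanishing_hessian :: "('n::finite, 'a::comm_ring_1) mpoly \<Rightarrow> bool" where
  "vanishing_hessian f \<longleftrightarrow> det ((\<chi> i j. pdiff i (pdiff j f)) :: ('n, 'a) mpoly ^ 'n ^ 'n) = 0"

definition hessian_at :: "('n, 'a::field) mpoly \<Rightarrow> 'a ^ 'n \<Rightarrow> 'a ^ 'n ^ 'n" where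
  "hessian_at f v = (\<chi> i j. peval (($) v) (pdiff i (pdiff j f)))"

text \<open>\<open>Sing Q\<^sub>p\<close>, the projectivized kernel of the Hessian matrix at \<open>p\<close>.\<close>

definition sing_polar_quadric ::
    "('n, 'a::field) mpoly \<Rightarrow> ('a ^ 'n) set \<Rightarrow> ('a ^ 'n) set set" where
  "sing_polar_quadric f p = proj_points {u. \<forall>v\<in>p - {0}. hessian_at f v *v u = 0}"

definition gradient_at :: "('n, 'a::field) mpoly \<Rightarrow> 'a ^ 'n \<Rightarrow> 'a ^ 'n" where
  "gradient_at f v = (\<chi> i. peval (($) v) (pdiff i f))"

text \<open>For \<open>f\<close> homogeneous the gradients at the nonzero vectors of a line are proportional. They
  span a line unless they vanish, and in that case the polar map is undefined.\<close>

definition polar_map :: "('n, 'a::field) mpoly \<Rightarrow> ('a ^ 'n) set \<Rightarrow> ('a ^ 'n) set" where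
  "polar_map f p = vec.span (gradient_at f ` (p - {0}))"

definition polar_domain :: "('n, 'a::field) mpoly \<Rightarrow> ('a ^ 'n) set set" where
  "polar_domain f = {p \<in> proj_points UNIV. polar_map f p \<in> proj_points UNIV}"

definition polar_image :: "('n, 'a::field) mpoly \<Rightarrow> ('a ^ 'n) set set" where
  "polar_image f = zariski_proj closure_of (polar_map f ` polar_domain f)"

definition perazzo_domain :: "('n, 'a::field) mpoly \<Rightarrow> ('a ^ 'n) set set" where
  "perazzo_domain f = {p \<in> polar_domain f. polar_map f p \<in> smooth_locus (polar_image f)}"

definition perazzo_map :: "('n, 'a::field) mpoly \<Rightarrow> ('a ^ 'n) set \<Rightarrow> ('a ^ 'n) set" where
  "perazzo_map f p = dual_space (tangent_space (polar_image f) (polar_map f p))"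

definition perazzo_fibre ::
    "('n, 'a::field) mpoly \<Rightarrow> ('a ^ 'n) set \<Rightarrow> ('a ^ 'n) set set" where
  "perazzo_fibre f w = {q \<in> perazzo_domain f. perazzo_map f q = w}"

definition codim_polar_image :: "('n::finite, 'a::field) mpoly \<Rightarrow> nat" where
  "codim_polar_image f = CARD('n) - 1 - the_enat (proj_dim (polar_image f))"

text \<open>\<open>W\<^sub>X\<close>, closed in \<open>\<G>(codim Z - 1, N)\<close>, and its dimension \<open>\<mu>\<close>.\<close>

definition perazzo_image :: "('n::finite, 'a::field) mpoly \<Rightarrow> ('a ^ 'n) set set" where
  "perazzo_image f =
     zariski_grassmannian (codim_polar_image f) closure_of (perazzo_map f ` perazzo_domain f)"

definition perazzo_dim :: "('n::finite, 'a::field) mpoly \<Rightarrow> enat" where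
  "perazzo_dim f =
     krull_dim (subtopology (zariski_grassmannian (codim_polar_image f)) (perazzo_image f))"

end

theory Submission
  imports Defs "Jordan_Normal_Form.Determinant"
begin

text \<open>Dimensions are computed by a Jacobian criterion. Forms \<open>g\<^sub>v\<close> of the same degree in
  characteristic \<open>0\<close> are algebraically independent iff their gradients are linearly independent at
  some point. Hence a closed set parametrized generically by a family \<open>g\<close> has Krull dimension
  \<open>\<rho> - 1\<close>, where \<open>\<rho>\<close> is the generic rank of the Jacobian of \<open>g\<close>: along a chain
  \<open>C\<^sub>0 \<subset> \<dots> \<subset> C\<^sub>n\<close> of irreducible closed sets, forms vanishing on \<open>C\<^sub>i\<close> but not on \<open>C\<^sub>i\<^sub>+\<^sub>1\<close>
  are algebraically independent, and restricting \<open>g\<close> to a flag of linear subspaces gives a chain of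
  maximal length.

  For the cubic, the gradients at \<open>\<Phi>(x)\<close> of the relations between the partial derivatives span the
  dual of the tangent space of \<open>Z\<close>. This span lies in the kernel of the Hessian \<open>H(x)\<close>, and by the
  Jacobian criterion it is the whole kernel for general \<open>x\<close>, so \<open>P\<^sub>X(x) = ker H(x)\<close>. Since \<open>H\<close> is
  linear in \<open>x\<close> and \<open>H(x)u = H(u)x\<close>, the points \<open>u\<close> with \<open>ker H(x) \<subseteq> ker H(u)\<close> form a linear space
  \<open>L(x)\<close>, the intersection of the singular loci, and its general points have the same kernel as \<open>x\<close>.
  Differentiating \<open>H(x)k(x) = 0\<close> shows that the derivatives of the Pluecker coordinates of \<open>ker H\<close>
  in the direction \<open>u\<close> are proportional to the coordinates themselves exactly when \<open>u \<in> L(x)\<close>.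
  This determines \<open>dim W\<^sub>X\<close>.\<close>

text \<open>Function fields and transcendence degrees are replaced by polynomial functions over an
  infinite field. A point is general when suitable forms do not vanish at it; several such
  conditions can be met together, because on the line joining two points a nonzero univariate
  polynomial has finitely many roots. The Jacobian criterion rests on a bound for the number of
  independent forms, obtained by counting monomials against grid points.

  Closed sets see only homogeneous forms, and substitution preserves homogeneity only for families
  of one degree; hence the powers of forms that equalise degrees.

  The number N - \<mu> arises as follows. Let \<rho> be the generic rank of the Jacobian of the
  Pluecker coordinates and K its kernel at p, so dim K = N + 1 - \<rho>. The directions in which the
  coordinate vector changes by a multiple of itself are spanned by K and p, and p is not in K by
  Euler's identity in positive degree. So L(p) has vector dimension N + 2 - \<rho>, projective
  dimension N + 1 - \<rho>, while \<mu> = \<rho> - 1.\<close>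

no_notation Matrix.vec_index (infixl "$" 100)
no_notation fps_nth (infixl "$" 75)

section \<open>Substitution and derivatives\<close>

definition pmon :: "('v \<Rightarrow> 'b::comm_semiring_1) \<Rightarrow> ('v \<Rightarrow>\<^sub>0 nat) \<Rightarrow> 'b" where
  "pmon V m = (\<Prod>i\<in>Poly_Mapping.keys m. V i ^ Poly_Mapping.lookup m i)"

definition mdeg :: "('v \<Rightarrow>\<^sub>0 nat) \<Rightarrow> nat" where
  "mdeg m = (\<Sum>i\<in>Poly_Mapping.keys m. Poly_Mapping.lookup m i)"

text \<open>The coefficient map \<open>C\<close> is a parameter so that one definition covers values
  in the field, substitution of polynomials (\<open>psubst\<close>) and restriction to a curve
  (\<open>line_poly\<close>).\<close>

definition aeval :: "('a::zero \<Rightarrow> 'b) \<Rightarrow> ('v \<Rightarrow> 'b::comm_semiring_1) \<Rightarrow> ('v, 'a) mpoly \<Rightarrow> 'b" where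
  "aeval C V F = (\<Sum>m\<in>Poly_Mapping.keys F. C (Poly_Mapping.lookup F m) * pmon V m)"

definition vars :: "('v, 'a::zero) mpoly \<Rightarrow> 'v set" where
  "vars F = (\<Union>m\<in>Poly_Mapping.keys F. Poly_Mapping.keys m)"

lemma peval_eq_aeval: "peval V F = aeval (\<lambda>c. c) V F"
  by (simp add: peval_def aeval_def pmon_def)

lemma homogeneous_iff_mdeg:
  "homogeneous d F \<longleftrightarrow> (\<forall>m\<in>Poly_Mapping.keys F. mdeg m = d)"
  by (simp add: homogeneous_def mdeg_def)

lemma finite_vars [simp]: "finite (vars F)"
  by (simp add: vars_def)

lemma pmon_superset:
  assumes "finite A" "Poly_Mapping.keys m \<subseteq> A"
  shows "pmon V m = (\<Prod>i\<in>A. V i ^ Poly_Mapping.lookup m i)"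
  unfolding pmon_def
  by (rule prod.mono_neutral_left) (use assms in \<open>auto simp: in_keys_iff\<close>)

lemma mdeg_superset:
  assumes "finite A" "Poly_Mapping.keys m \<subseteq> A"
  shows "mdeg m = (\<Sum>i\<in>A. Poly_Mapping.lookup m i)"
  unfolding mdeg_def
  by (rule sum.mono_neutral_left) (use assms in \<open>auto simp: in_keys_iff\<close>)

lemma keys_plus_nat:
  "Poly_Mapping.keys (m + m' :: 'v \<Rightarrow>\<^sub>0 nat) = Poly_Mapping.keys m \<union> Poly_Mapping.keys m'"
  by (auto simp: in_keys_iff lookup_add)

lemma pmon_add: "pmon V (m + m') = pmon V m * pmon V m'"
proof -
  let ?A = "Poly_Mapping.keys m \<union> Poly_Mapping.keys m'"
  have "finite ?A" by simp
  thus ?thesis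
    by (simp add: pmon_superset[of ?A] keys_plus_nat lookup_add power_add prod.distrib)
qed

lemma mdeg_add: "mdeg (m + m') = mdeg m + mdeg m'"
proof -
  let ?A = "Poly_Mapping.keys m \<union> Poly_Mapping.keys m'"
  have "finite ?A" by simp
  thus ?thesis
    by (simp add: mdeg_superset[of ?A] keys_plus_nat lookup_add sum.distrib)
qed

lemma pmon_zero [simp]: "pmon V 0 = 1"
  by (simp add: pmon_def)

lemma mdeg_zero [simp]: "mdeg 0 = 0"
  by (simp add: mdeg_def)

lemma pmon_single [simp]: "pmon V (Poly_Mapping.single i k) = V i ^ k"
  by (cases "k = 0") (auto simp: pmon_def)

lemma mdeg_single [simp]: "mdeg (Poly_Mapping.single i k) = k"
  by (cases "k = 0") (auto simp: mdeg_def)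

lemma mpoly_sum_monomials:
  "F = (\<Sum>m\<in>Poly_Mapping.keys F. Poly_Mapping.single m (Poly_Mapping.lookup F m))"
proof (rule poly_mapping_eqI)
  fix k
  show "Poly_Mapping.lookup F k = Poly_Mapping.lookup
    (\<Sum>m\<in>Poly_Mapping.keys F. Poly_Mapping.single m (Poly_Mapping.lookup F m)) k"
    by (simp add: lookup_sum lookup_single when_def not_in_keys_iff_lookup_eq_zero)
qed

locale coeff_hom =
  fixes C :: "'a::comm_semiring_1 \<Rightarrow> 'b::comm_semiring_1"
  assumes C_zero: "C 0 = 0" and C_one: "C 1 = 1"
    and C_add: "C (a + b) = C a + C b" and C_mult: "C (a * b) = C a * C b"
begin

lemma C_of_nat: "C (of_nat k) = of_nat k"
  by (induction k) (auto simp: C_zero C_one C_add)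

lemma aeval_superset:
  assumes "finite A" "Poly_Mapping.keys F \<subseteq> A"
  shows "aeval C V F = (\<Sum>m\<in>A. C (Poly_Mapping.lookup F m) * pmon V m)"
  unfolding aeval_def
  by (rule sum.mono_neutral_left) (use assms in \<open>auto simp: in_keys_iff C_zero\<close>)

lemma aeval_zero [simp]: "aeval C V 0 = 0"
  by (simp add: aeval_def)

lemma aeval_add [simp]: "aeval C V (F + G) = aeval C V F + aeval C V G"
proof -
  let ?A = "Poly_Mapping.keys F \<union> Poly_Mapping.keys G"
  have "finite ?A" "Poly_Mapping.keys (F + G) \<subseteq> ?A" using Poly_Mapping.keys_add[of F G] by auto
  thus ?thesis
    by (simp add: aeval_superset[of ?A] lookup_add algebra_simps sum.distrib C_add)
qed

lemma aeval_sum [simp]: "aeval C V (\<Sum>i\<in>A. F i) = (\<Sum>i\<in>A. aeval C V (F i))"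
  by (induction A rule: infinite_finite_induct) auto

lemma aeval_single [simp]: "aeval C V (Poly_Mapping.single m c) = C c * pmon V m"
  by (cases "c = 0") (auto simp: aeval_def C_zero)

lemma aeval_one [simp]: "aeval C V 1 = 1"
  using aeval_single[of V 0 1] by (simp del: aeval_single add: C_one)

lemma aeval_mult [simp]: "aeval C V (F * G) = aeval C V F * aeval C V G"
proof -
  let ?s = "\<lambda>F m. Poly_Mapping.single m (Poly_Mapping.lookup F m)"
  have "F * G = (\<Sum>m\<in>Poly_Mapping.keys F. ?s F m) * (\<Sum>m\<in>Poly_Mapping.keys G. ?s G m)"
    using mpoly_sum_monomials[of F] mpoly_sum_monomials[of G] by simp
  also have "aeval C V \<dots> = (\<Sum>m\<in>Poly_Mapping.keys F. aeval C V (?s F m)) *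
      (\<Sum>m\<in>Poly_Mapping.keys G. aeval C V (?s G m))"
    by (simp add: sum_product mult_single pmon_add mult_ac C_mult)
  also have "\<dots> = aeval C V F * aeval C V G"
    by (simp only: aeval_single) (simp add: aeval_def)
  finally show ?thesis .
qed

lemma aeval_power [simp]: "aeval C V (F ^ k) = aeval C V F ^ k"
  by (induction k) auto

lemma aeval_prod [simp]: "aeval C V (\<Prod>i\<in>A. F i) = (\<Prod>i\<in>A. aeval C V (F i))"
  by (induction A rule: infinite_finite_induct) auto

lemma aeval_mon [simp]: "aeval C V (pmon W m) = pmon (\<lambda>i. aeval C V (W i)) m"
  by (simp add: pmon_def)

end

lemma derivation_prod:
  fixes \<delta> :: "'b::comm_semiring_1 \<Rightarrow> 'b"
  assumes "\<And>x y. \<delta> (x * y) = x * \<delta> y + y * \<delta> x" "\<delta> 1 = 0" "finite A"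
  shows "\<delta> (\<Prod>i\<in>A. f i) = (\<Sum>i\<in>A. (\<Prod>j\<in>A - {i}. f j) * \<delta> (f i))"
  using assms(3)
proof (induction A rule: finite_induct)
  case empty
  show ?case by (simp add: assms)
next
  case (insert a A)
  have "(\<Sum>i\<in>A. (\<Prod>j\<in>insert a A - {i}. f j) * \<delta> (f i)) =
        (\<Sum>i\<in>A. f a * ((\<Prod>j\<in>A - {i}. f j) * \<delta> (f i)))"
  proof (rule sum.cong[OF refl])
    fix i assume "i \<in> A"
    hence "insert a A - {i} = insert a (A - {i})" using insert by auto
    thus "(\<Prod>j\<in>insert a A - {i}. f j) * \<delta> (f i) = f a * ((\<Prod>j\<in>A - {i}. f j) * \<delta> (f i))"
      using insert by (simp add: mult_ac)
  qed
  thus ?case using insert by (simp add: assms(1) sum_distrib_left algebra_simps)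
qed

lemma derivation_power:
  fixes \<delta> :: "'b::comm_semiring_1 \<Rightarrow> 'b"
  assumes "\<And>x y. \<delta> (x * y) = x * \<delta> y + y * \<delta> x" "\<delta> 1 = 0"
  shows "\<delta> (x ^ k) = of_nat k * x ^ (k - 1) * \<delta> x"
proof (induction k)
  case 0
  show ?case by (simp add: assms)
next
  case (Suc k)
  thus ?case
    by (cases k) (simp_all add: assms algebra_simps)
qed

lemma derivation_mon:
  fixes \<delta> :: "'b::comm_semiring_1 \<Rightarrow> 'b"
  assumes "\<And>x y. \<delta> (x * y) = x * \<delta> y + y * \<delta> x" "\<delta> 1 = 0"
    and A: "finite A" "Poly_Mapping.keys m \<subseteq> A"
  shows "\<delta> (pmon V m) = (\<Sum>i\<in>A. of_nat (Poly_Mapping.lookup m i) *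
    pmon V (m - Poly_Mapping.single i 1) * \<delta> (V i))"
proof -
  have "\<delta> (pmon V m) = (\<Sum>i\<in>A. (\<Prod>j\<in>A - {i}. V j ^ Poly_Mapping.lookup m j) *
      \<delta> (V i ^ Poly_Mapping.lookup m i))"
    using derivation_prod[OF assms(1,2) A(1)] by (simp add: pmon_superset[OF A])
  also have "\<dots> = (\<Sum>i\<in>A. of_nat (Poly_Mapping.lookup m i) *
    pmon V (m - Poly_Mapping.single i 1) * \<delta> (V i))"
  proof (rule sum.cong[OF refl])
    fix i assume i: "i \<in> A"
    let ?m' = "m - Poly_Mapping.single i (1::nat)"
    have k: "Poly_Mapping.keys ?m' \<subseteq> A"
      using A by (auto simp: in_keys_iff lookup_minus)
    have "pmon V ?m' = (\<Prod>j\<in>insert i (A - {i}). V j ^ Poly_Mapping.lookup ?m' j)"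
      unfolding pmon_superset[OF A(1) k] using i by (simp add: insert_absorb)
    also have "\<dots> = V i ^ (Poly_Mapping.lookup m i - 1) *
        (\<Prod>j\<in>A - {i}. V j ^ Poly_Mapping.lookup ?m' j)"
      using A by (subst prod.insert) (auto simp: lookup_minus)
    also have "(\<Prod>j\<in>A - {i}. V j ^ Poly_Mapping.lookup ?m' j) =
        (\<Prod>j\<in>A - {i}. V j ^ Poly_Mapping.lookup m j)"
      by (rule prod.cong) (auto simp: lookup_minus lookup_single)
    finally show "(\<Prod>j\<in>A - {i}. V j ^ Poly_Mapping.lookup m j) *
        \<delta> (V i ^ Poly_Mapping.lookup m i) =
        of_nat (Poly_Mapping.lookup m i) * pmon V ?m' * \<delta> (V i)"
      by (simp add: derivation_power[OF assms(1,2)] mult_ac)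
  qed
  finally show ?thesis .
qed

lemma (in coeff_hom) aeval_pdiff:
  "aeval C V (pdiff i F) = (\<Sum>m\<in>Poly_Mapping.keys F. C (Poly_Mapping.lookup F m) *
     (of_nat (Poly_Mapping.lookup m i) * pmon V (m - Poly_Mapping.single i 1)))"
  by (simp add: pdiff_def mult_ac C_mult C_of_nat)

text \<open>The chain rule, valid for every derivation that kills the coefficients: it is the
  Leibniz rule monomial by monomial. It is applied to \<open>pderiv\<close>.\<close>

lemma (in coeff_hom) derivation_aeval:
  assumes "\<And>x y. \<delta> (x * y) = x * \<delta> y + y * \<delta> x" "\<And>x y. \<delta> (x + y) = \<delta> x + \<delta> y"
    and "\<And>c. \<delta> (C c) = 0" and A: "finite A" "vars F \<subseteq> A"
  shows "\<delta> (aeval C V F) = (\<Sum>i\<in>A. aeval C V (pdiff i F) * \<delta> (V i))"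
proof -
  have z: "\<delta> 0 = 0" and o: "\<delta> 1 = 0" using assms(3)[of 0] assms(3)[of 1] by (auto simp: C_zero C_one)
  have s: "\<delta> (\<Sum>m\<in>B. h m) = (\<Sum>m\<in>B. \<delta> (h m))" for h :: "('c \<Rightarrow>\<^sub>0 nat) \<Rightarrow> 'b" and B
    by (induction B rule: infinite_finite_induct) (auto simp: z assms(2))
  have "\<delta> (aeval C V F) = (\<Sum>m\<in>Poly_Mapping.keys F. C (Poly_Mapping.lookup F m) * \<delta> (pmon V m))"
    unfolding aeval_def s by (simp add: assms(1,3))
  also have "\<dots> = (\<Sum>m\<in>Poly_Mapping.keys F. \<Sum>i\<in>A. C (Poly_Mapping.lookup F m) *
     (of_nat (Poly_Mapping.lookup m i) * pmon V (m - Poly_Mapping.single i 1) * \<delta> (V i)))"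
  proof (rule sum.cong[OF refl])
    fix m assume "m \<in> Poly_Mapping.keys F"
    hence "Poly_Mapping.keys m \<subseteq> A" using A by (auto simp: vars_def)
    from derivation_mon[OF assms(1) o A(1) this]
    show "C (Poly_Mapping.lookup F m) * \<delta> (pmon V m) = (\<Sum>i\<in>A. C (Poly_Mapping.lookup F m) *
     (of_nat (Poly_Mapping.lookup m i) * pmon V (m - Poly_Mapping.single i 1) * \<delta> (V i)))"
      by (simp add: sum_distrib_left)
  qed
  also have "\<dots> = (\<Sum>i\<in>A. aeval C V (pdiff i F) * \<delta> (V i))"
    unfolding aeval_pdiff sum_distrib_right by (subst sum.swap) (simp add: mult_ac)
  finally show ?thesis .
qed

text \<open>With coefficients in closed form, the symmetry of second derivatives and the bounds on
  degrees and variables become comparisons of coefficients.\<close>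

lemma lookup_pdiff:
  "Poly_Mapping.lookup (pdiff i F) m =
     of_nat (Poly_Mapping.lookup m i + 1) * Poly_Mapping.lookup F (m + Poly_Mapping.single i 1)"
proof -
  let ?e = "Poly_Mapping.single i (1::nat)"
  let ?t = "\<lambda>k. of_nat (Poly_Mapping.lookup k i) * Poly_Mapping.lookup F k"
  have "Poly_Mapping.lookup (pdiff i F) m = (\<Sum>k\<in>Poly_Mapping.keys F. ?t k when k - ?e = m)"
    by (simp add: pdiff_def lookup_sum lookup_single)
  also have "\<dots> = (\<Sum>k\<in>Poly_Mapping.keys F. ?t k when k = m + ?e)"
  proof (rule sum.cong[OF refl])
    fix k
    show "(?t k when k - ?e = m) = (?t k when k = m + ?e)"
    \<comment> \<open>If \<open>i\<close> does not occur in \<open>k\<close>, the truncated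
      difference may equal \<open>m\<close> by accident, but the factor \<open>lookup k i\<close> is
      then zero.\<close>
    proof (cases "Poly_Mapping.lookup k i = 0")
      case False
      hence "k - ?e + ?e = k"
        by (intro poly_mapping_eqI) (auto simp: lookup_add lookup_minus lookup_single when_def)
      hence "k - ?e = m \<longleftrightarrow> k = m + ?e" by auto
      thus ?thesis by simp
    qed simp
  qed
  also have "\<dots> = ?t (m + ?e)"
    by (auto simp: when_def in_keys_iff)
  finally show ?thesis by (simp add: lookup_add)
qed

lemma pdiff_commute: "pdiff i (pdiff j F) = pdiff j (pdiff i F)"
proof (rule poly_mapping_eqI)
  fix m
  show "Poly_Mapping.lookup (pdiff i (pdiff j F)) m = Poly_Mapping.lookup (pdiff j (pdiff i F)) m"
    by (cases "i = j") (simp_all add: lookup_pdiff lookup_add lookup_single when_def ac_simps)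
qed

lemma vars_pdiff: "vars (pdiff i F) \<subseteq> vars F"
proof
  fix v assume "v \<in> vars (pdiff i F)"
  then obtain m where m: "m \<in> Poly_Mapping.keys (pdiff i F)" "v \<in> Poly_Mapping.keys m"
    by (auto simp: vars_def)
  have "m + Poly_Mapping.single i 1 \<in> Poly_Mapping.keys F"
    using m(1) by (auto simp: in_keys_iff lookup_pdiff)
  moreover have "v \<in> Poly_Mapping.keys (m + Poly_Mapping.single i 1)"
    unfolding keys_plus_nat using m(2) by blast
  ultimately show "v \<in> vars F"
    unfolding vars_def by blast
qed

lemma homogeneous_pdiff:
  assumes "homogeneous d F"
  shows "homogeneous (d - 1) (pdiff i F)"
  unfolding homogeneous_iff_mdeg
proof
  fix m assume "m \<in> Poly_Mapping.keys (pdiff i F)"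
  hence "m + Poly_Mapping.single i 1 \<in> Poly_Mapping.keys F"
    by (auto simp: in_keys_iff lookup_pdiff)
  hence "mdeg (m + Poly_Mapping.single i 1) = d" using assms by (auto simp: homogeneous_iff_mdeg)
  thus "mdeg m = d - 1" by (simp add: mdeg_add)
qed

text \<open>Characteristic zero enters here: differentiation multiplies a coefficient by a positive
  exponent, which is a nonzero scalar.\<close>

lemma pdiff_eq_0_imp:
  fixes F :: "('v, 'a::{semiring_char_0, comm_semiring_1, semiring_no_zero_divisors}) mpoly"
  assumes "pdiff i F = 0"
  shows "i \<notin> vars F"
proof
  assume "i \<in> vars F"
  then obtain m where m: "m \<in> Poly_Mapping.keys F" "i \<in> Poly_Mapping.keys m"
    by (auto simp: vars_def)
  have "m - Poly_Mapping.single i 1 + Poly_Mapping.single i 1 = m"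
    using m(2) by (intro poly_mapping_eqI) (auto simp: lookup_add lookup_minus lookup_single when_def in_keys_iff)
  hence "Poly_Mapping.lookup (pdiff i F) (m - Poly_Mapping.single i 1) \<noteq> 0"
    using m by (simp add: lookup_pdiff in_keys_iff del: of_nat_Suc of_nat_add)
  thus False using assms by simp
qed

lemma pdiff_eq_0:
  assumes "i \<notin> vars F"
  shows "pdiff i F = 0"
proof (rule poly_mapping_eqI)
  fix m
  have "i \<in> Poly_Mapping.keys (m + Poly_Mapping.single i (1::nat))"
    unfolding keys_plus_nat by simp
  hence "m + Poly_Mapping.single i 1 \<notin> Poly_Mapping.keys F" using assms by (auto simp: vars_def)
  thus "Poly_Mapping.lookup (pdiff i F) m = Poly_Mapping.lookup 0 m"
    by (simp add: lookup_pdiff in_keys_iff)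
qed

section \<open>Homogeneity\<close>

lemma homogeneous_zero [simp]: "homogeneous d 0"
  by (simp add: homogeneous_def)

lemma homogeneous_single [simp]: "homogeneous d (Poly_Mapping.single m c) \<longleftrightarrow> c = 0 \<or> mdeg m = d"
  by (auto simp: homogeneous_iff_mdeg)

lemma homogeneous_one [simp]: "homogeneous 0 1"
  by (auto simp: homogeneous_iff_mdeg)

lemma homogeneous_add: "homogeneous d F \<Longrightarrow> homogeneous d G \<Longrightarrow> homogeneous d (F + G)"
  using Poly_Mapping.keys_add[of F G] by (auto simp: homogeneous_iff_mdeg)

lemma homogeneous_sum: "(\<And>i. i \<in> A \<Longrightarrow> homogeneous d (F i)) \<Longrightarrow> homogeneous d (\<Sum>i\<in>A. F i)"
  by (induction A rule: infinite_finite_induct) (auto intro: homogeneous_add)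

lemma homogeneous_mult:
  assumes "homogeneous d F" "homogeneous e G"
  shows "homogeneous (d + e) (F * G)"
  unfolding homogeneous_iff_mdeg
proof
  fix m assume "m \<in> Poly_Mapping.keys (F * G)"
  then obtain a b where "m = a + b" "a \<in> Poly_Mapping.keys F" "b \<in> Poly_Mapping.keys G"
    using Poly_Mapping.keys_mult[of F G] by auto
  thus "mdeg m = d + e" using assms by (simp add: homogeneous_iff_mdeg mdeg_add)
qed

lemma homogeneous_prod:
  "(\<And>i. i \<in> A \<Longrightarrow> homogeneous (d i) (F i)) \<Longrightarrow> homogeneous (\<Sum>i\<in>A. d i) (\<Prod>i\<in>A. F i)"
  by (induction A rule: infinite_finite_induct) (auto intro: homogeneous_mult)

lemma homogeneous_power: "homogeneous d F \<Longrightarrow> homogeneous (d * k) (F ^ k)"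
  by (induction k) (auto intro: homogeneous_mult)

definition psubst :: "('v \<Rightarrow> ('w, 'a::comm_semiring_1) mpoly) \<Rightarrow> ('v, 'a) mpoly \<Rightarrow> ('w, 'a) mpoly" where
  "psubst g F = aeval (Poly_Mapping.single 0) g F"

lemma homogeneous_const [simp]: "homogeneous 0 (Poly_Mapping.single 0 c)"
  by simp

lemma homogeneous_mon:
  assumes "\<And>v. v \<in> Poly_Mapping.keys m \<Longrightarrow> homogeneous D (g v)"
  shows "homogeneous (D * mdeg m) (pmon g m)"
  unfolding pmon_def mdeg_def sum_distrib_left
  by (intro homogeneous_prod homogeneous_power assms)

text \<open>Monomials of one degree give products of one degree only if all arguments share the
  degree \<open>D\<close>. This is why families are kept equidegree.\<close>

lemma homogeneous_psubst:
  assumes "homogeneous k F" "\<And>v. v \<in> vars F \<Longrightarrow> homogeneous D (g v)"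
  shows "homogeneous (D * k) (psubst g F)"
  unfolding psubst_def aeval_def
proof (rule homogeneous_sum)
  fix m assume m: "m \<in> Poly_Mapping.keys F"
  have "homogeneous (0 + D * mdeg m) (Poly_Mapping.single 0 (Poly_Mapping.lookup F m) * pmon g m)"
    using m by (intro homogeneous_mult homogeneous_mon assms) (auto simp: vars_def)
  thus "homogeneous (D * k) (Poly_Mapping.single 0 (Poly_Mapping.lookup F m) * pmon g m)"
    using m assms(1) by (simp add: homogeneous_iff_mdeg)
qed

interpretation ev: coeff_hom "\<lambda>c::'a::comm_semiring_1. c"
  by standard auto

interpretation const_poly: coeff_hom "\<lambda>c::'a::comm_ring_1. [:c:]"
  by standard auto

lemmas peval_simps [simp] = ev.aeval_zero[folded peval_eq_aeval] ev.aeval_add[folded peval_eq_aeval]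
  ev.aeval_sum[folded peval_eq_aeval] ev.aeval_single[folded peval_eq_aeval]
  ev.aeval_one[folded peval_eq_aeval] ev.aeval_mult[folded peval_eq_aeval]
  ev.aeval_power[folded peval_eq_aeval] ev.aeval_prod[folded peval_eq_aeval]
  ev.aeval_mon[folded peval_eq_aeval]

lemma peval_uminus [simp]: "peval V (- F) = - peval V (F :: ('v, 'a::comm_ring_1) mpoly)"
  using ev.aeval_add[of V F "- F"] by (simp add: peval_eq_aeval add_eq_0_iff)

lemma peval_of_int [simp]: "peval V (of_int k :: ('v, 'a::comm_ring_1) mpoly) = of_int k"
proof -
  have n: "peval V (of_nat k :: ('v, 'a) mpoly) = of_nat k" for k
    by (induction k) auto
  show ?thesis
  proof (cases k)
    case (neg m)
    have "(of_int k :: ('v, 'a) mpoly) = - of_nat (Suc m)" unfolding neg by simp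
    thus ?thesis by (simp only: peval_uminus n) (simp add: neg)
  qed (simp add: n)
qed

lemma peval_psubst [simp]: "peval V (psubst g F) = peval (\<lambda>v. peval V (g v)) F"
  by (simp add: psubst_def aeval_def[of "Poly_Mapping.single 0"])
    (simp add: peval_eq_aeval aeval_def)

lemma peval_scale:
  assumes "homogeneous d F"
  shows "peval (\<lambda>i. c * V i) F = c ^ d * peval V F"
proof -
  have "pmon (\<lambda>i. c * V i) m = c ^ mdeg m * pmon V m" for m
    by (simp add: pmon_def mdeg_def power_mult_distrib prod.distrib power_sum)
  thus ?thesis using assms
    by (simp add: peval_eq_aeval aeval_def homogeneous_iff_mdeg sum_distrib_left mult_ac)
qed

section \<open>Restriction to lines\<close>

lemmas cart_eq_iff = Finite_Cartesian_Product.vec_eq_iff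

abbreviation pv :: "'a::comm_semiring_1 ^ 'n \<Rightarrow> ('n, 'a) mpoly \<Rightarrow> 'a" where
  "pv x G \<equiv> peval (($) x) G"

definition dotp :: "'a::comm_semiring_1 ^ 'n \<Rightarrow> 'a ^ 'n \<Rightarrow> 'a" where
  "dotp y x = (\<Sum>i\<in>UNIV. y $ i * x $ i)"

definition X :: "'v \<Rightarrow> ('v, 'a::comm_semiring_1) mpoly" where
  "X i = Poly_Mapping.single (Poly_Mapping.single i 1) 1"

lemma peval_X [simp]: "peval V (X i) = V i"
  by (simp add: X_def)

lemma homogeneous_X [simp]: "homogeneous (Suc 0) (X i)"
  by (simp add: X_def)

text \<open>Restriction to a curve with polynomial coordinates, mostly a line. Univariate
  polynomials over an infinite field are determined by their values and come with
  \<open>pderiv\<close> and a bound on roots, so statements about values and gradients in several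
  variables are reduced to them.\<close>

definition line_poly :: "('v \<Rightarrow> 'a::comm_ring_1 poly) \<Rightarrow> ('v, 'a) mpoly \<Rightarrow> 'a poly" where
  "line_poly V F = aeval (\<lambda>c. [:c:]) V F"

lemma poly_pmon: "poly (pmon V m) t = pmon (\<lambda>v. poly (V v) t) m"
  by (simp add: pmon_def poly_prod)

lemma poly_line_poly [simp]: "poly (line_poly V F) t = peval (\<lambda>v. poly (V v) t) F"
  by (simp add: line_poly_def peval_eq_aeval aeval_def poly_sum poly_pmon)

lemma degree_line_poly:
  assumes "homogeneous k F" "\<And>v. v \<in> vars F \<Longrightarrow> degree (V v) \<le> D"
  shows "degree (line_poly V F) \<le> D * k"
  unfolding line_poly_def aeval_def
proof (rule degree_sum_le)
  fix m assume m: "m \<in> Poly_Mapping.keys F"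
  have "degree (pmon V m) \<le> (\<Sum>v\<in>Poly_Mapping.keys m. degree (V v ^ Poly_Mapping.lookup m v))"
    unfolding pmon_def by (rule degree_prod_sum_le[unfolded o_def]) simp
  also have "\<dots> \<le> (\<Sum>v\<in>Poly_Mapping.keys m. D * Poly_Mapping.lookup m v)"
  proof (rule sum_mono)
    fix v assume "v \<in> Poly_Mapping.keys m"
    hence "degree (V v) \<le> D" using assms(2) m by (auto simp: vars_def)
    thus "degree (V v ^ Poly_Mapping.lookup m v) \<le> D * Poly_Mapping.lookup m v"
      using degree_power_le[of "V v"] by (meson dual_order.trans mult_le_mono1)
  qed
  also have "\<dots> = D * k"
    using assms(1) m by (simp add: homogeneous_iff_mdeg mdeg_def flip: sum_distrib_left)
  finally show "degree ([:Poly_Mapping.lookup F m:] * pmon V m) \<le> D * k"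
    by (simp add: order_trans[OF degree_smult_le])
qed simp

lemma pderiv_line_poly:
  fixes F :: "('v, 'a::field_char_0) mpoly"
  assumes "finite A" "vars F \<subseteq> A"
  shows "pderiv (line_poly V F) = (\<Sum>v\<in>A. line_poly V (pdiff v F) * pderiv (V v))"
  unfolding line_poly_def
  by (rule const_poly.derivation_aeval) (use assms in \<open>auto simp: pderiv_mult pderiv_add pderiv_pCons\<close>)

lemma pderiv_line_at_0:
  fixes G :: "('n::finite, 'a::field_char_0) mpoly"
  shows "poly (pderiv (line_poly (\<lambda>i. [:p $ i, u $ i:]) G)) 0 = dotp (gradient_at G p) u"
  by (subst pderiv_line_poly[of UNIV]) (auto simp: poly_sum gradient_at_def pderiv_pCons mult.commute dotp_def)

lemma poly_eqI_char_0:
  fixes p q :: "'a::field_char_0 poly"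
  assumes "\<And>t. poly p t = poly q t"
  shows "p = q"
  using assms poly_eq_poly_eq_iff by blast

text \<open>On a line, the composite is \<open>F\<close> evaluated at the univariate polynomials
  \<open>line_poly ?L (g v)\<close>, so the univariate chain rule applies.\<close>

lemma gradient_chain_dotp:
  fixes g :: "'v \<Rightarrow> ('n::finite, 'a::field_char_0) mpoly"
  assumes "finite S" "vars F \<subseteq> S"
  shows "dotp (gradient_at (psubst g F) p) u =
    (\<Sum>v\<in>S. peval (\<lambda>v. pv p (g v)) (pdiff v F) * dotp (gradient_at (g v) p) u)"
proof -
  let ?L = "\<lambda>i. [:p $ i, u $ i:]"
  have "line_poly ?L (psubst g F) = line_poly (\<lambda>v. line_poly ?L (g v)) F"
    by (rule poly_eqI_char_0) simp
  hence "dotp (gradient_at (psubst g F) p) u = poly (pderiv (line_poly (\<lambda>v. line_poly ?L (g v)) F)) 0"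
    by (simp flip: pderiv_line_at_0)
  also have "\<dots> = (\<Sum>v\<in>S. peval (\<lambda>v. pv p (g v)) (pdiff v F) *
      poly (pderiv (line_poly ?L (g v))) 0)"
    by (subst pderiv_line_poly[OF assms]) (simp add: poly_sum)
  finally show ?thesis by (simp add: pderiv_line_at_0)
qed

lemma dotp_axis: "dotp y (axis i 1) = (y :: 'a::comm_semiring_1 ^ 'n::finite) $ i"
proof -
  have "dotp y (axis i 1) = (\<Sum>j\<in>UNIV. if j = i then y $ i else 0)"
    unfolding dotp_def by (rule sum.cong) (auto simp: axis_def)
  thus ?thesis by simp
qed

lemma dotp_sum_left: "dotp (\<Sum>v\<in>S. c v *s w v) u = (\<Sum>v\<in>S. c v * dotp (w v) u)"
  unfolding dotp_def by (simp add: sum_distrib_right sum_distrib_left mult.assoc) (rule sum.swap)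

lemma gradient_chain:
  fixes g :: "'v \<Rightarrow> ('n::finite, 'a::field_char_0) mpoly"
  assumes "finite S" "vars F \<subseteq> S"
  shows "gradient_at (psubst g F) p =
    (\<Sum>v\<in>S. peval (\<lambda>v. pv p (g v)) (pdiff v F) *s gradient_at (g v) p)"
proof -
  have "gradient_at (psubst g F) p $ i =
      (\<Sum>v\<in>S. peval (\<lambda>v. pv p (g v)) (pdiff v F) *s gradient_at (g v) p) $ i" for i
    using gradient_chain_dotp[OF assms, of g p "axis i 1"] by (simp add: dotp_axis)
  thus ?thesis unfolding cart_eq_iff by blast
qed

text \<open>A relation known only through its values can still be differentiated: it restricts to
  the zero polynomial on each line.\<close>

lemma gradient_vanishing:
  fixes G :: "('n::finite, 'a::field_char_0) mpoly"
  assumes "\<And>x. pv x G = 0"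
  shows "gradient_at G p = 0"
proof -
  have "dotp (gradient_at G p) u = 0" for u
  proof -
    have "line_poly (\<lambda>i. [:p $ i, u $ i:]) G = 0"
    proof (rule poly_eqI_char_0)
      fix t
      have "(\<lambda>i. p $ i + t * u $ i) = ($) (p + t *s u)" by auto
      thus "poly (line_poly (\<lambda>i. [:p $ i, u $ i:]) G) t = poly 0 t"
        using assms[of "p + t *s u"] by simp
    qed
    thus ?thesis using pderiv_line_at_0[of p u G] by simp
  qed
  from this[of "axis _ 1"] show ?thesis by (simp add: dotp_axis cart_eq_iff)
qed

text \<open>On the line \<open>p + t *s p\<close> homogeneity gives \<open>(1 + t) ^ d\<close> times
  the value at \<open>p\<close>; both sides are differentiated at \<open>t = 0\<close>.\<close>

lemma Euler_identity:
  fixes G :: "('n::finite, 'a::field_char_0) mpoly"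
  assumes "homogeneous d G"
  shows "dotp (gradient_at G p) p = of_nat d * pv p G"
proof -
  have "line_poly (\<lambda>i. [:p $ i, p $ i:]) G = Polynomial.smult (pv p G) ([:1, 1:] ^ d)"
  proof (rule poly_eqI_char_0)
    fix t
    have "(\<lambda>i. p $ i + t * p $ i) = (\<lambda>i. (1 + t) * p $ i)" by (auto simp: algebra_simps)
    thus "poly (line_poly (\<lambda>i. [:p $ i, p $ i:]) G) t = poly (Polynomial.smult (pv p G) ([:1, 1:] ^ d)) t"
      using peval_scale[OF assms, of "1 + t" "($) p"] by (simp add: mult_ac)
  qed
  moreover have "poly (pderiv (Polynomial.smult (pv p G) ([:1, 1:] ^ d))) 0 = of_nat d * pv p G"
    unfolding pderiv_smult pderiv_power by (simp add: pderiv_pCons)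
  ultimately show ?thesis using pderiv_line_at_0[of p p G] by simp
qed

lemma pv_scale: "homogeneous d G \<Longrightarrow> pv (c *s x) G = c ^ d * pv x G"
  using peval_scale[of d G c "($) x"] by (simp flip: vector_smult_component)

text \<open>Both restrictions to the line through \<open>x\<close> and \<open>y\<close> are nonzero
  polynomials, one by its value at \<open>t = 0\<close>, the other at \<open>t = 1\<close>, so their
  product has finitely many roots. That the common point lies on this line matters when
  \<open>x\<close> and \<open>y\<close> belong to a linear subspace.\<close>

lemma nonvanishing_pair_line:
  fixes F G :: "('n::finite, 'a::field_char_0) mpoly"
  assumes "pv x F \<noteq> 0" "pv y G \<noteq> 0"
  shows "\<exists>t. pv (x + t *s (y - x)) F \<noteq> 0 \<and> pv (x + t *s (y - x)) G \<noteq> 0"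
proof -
  define L where "L = (\<lambda>i. [:x $ i, y $ i - x $ i:])"
  have L: "poly (line_poly L H) t = pv (x + t *s (y - x)) H" for H t
  proof -
    have "(\<lambda>v. poly (L v) t) = ($) (x + t *s (y - x))"
      by (rule ext) (simp add: L_def algebra_simps)
    thus ?thesis by simp
  qed
  have "poly (line_poly L F) 0 \<noteq> 0" unfolding L using assms(1) by simp
  hence "line_poly L F \<noteq> 0" by (metis poly_0)
  moreover have "poly (line_poly L G) 1 \<noteq> 0" unfolding L using assms(2) by simp
  hence "line_poly L G \<noteq> 0" by (metis poly_0)
  ultimately have "finite {t. poly (line_poly L F * line_poly L G) t = 0}"
    by (intro poly_roots_finite) simp
  then obtain t where "poly (line_poly L F * line_poly L G) t \<noteq> 0"
    using infinite_UNIV_char_0 by (metis (mono_tags, lifting) ex_new_if_finite mem_Collect_eq)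
  thus ?thesis unfolding poly_mult L by auto
qed

lemma nonvanishing_common:
  fixes A :: "('n::finite, 'a::field_char_0) mpoly set"
  assumes "finite A" "\<And>F. F \<in> A \<Longrightarrow> \<exists>x. pv x F \<noteq> 0"
  shows "\<exists>x. \<forall>F\<in>A. pv x F \<noteq> 0"
  using assms
proof (induction A rule: finite_induct)
  case (insert F A)
  then obtain x y where "pv x F \<noteq> 0" "\<forall>G\<in>A. pv y G \<noteq> 0" by (metis insertCI)
  hence "pv x F \<noteq> 0" "pv y (\<Prod>G\<in>A. G) \<noteq> 0" using insert(1) by auto
  from nonvanishing_pair_line[OF this] show ?case using insert(1) by auto
qed simp

text \<open>Density of a nonempty principal open set: what is checked where \<open>G\<close> does
  not vanish holds everywhere. Generic statements become identities in this way.\<close>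

lemma vanishing_mult:
  fixes F G :: "('n::finite, 'a::field_char_0) mpoly"
  assumes "\<And>x. pv x F * pv x G = 0" "pv y G \<noteq> 0"
  shows "pv x F = 0"
proof (rule ccontr)
  assume "pv x F \<noteq> 0"
  from nonvanishing_pair_line[OF this assms(2)] show False using assms(1) by auto
qed

section \<open>Algebraic relations between forms\<close>

text \<open>Only homogeneous relations are tested, since these are the forms that the Zariski
  topology provides, and a relation means the vanishing of all values.\<close>

definition alg_indep :: "('v \<Rightarrow> ('n::finite, 'a::field) mpoly) \<Rightarrow> 'v set \<Rightarrow> bool" where
  "alg_indep g S \<longleftrightarrow> (\<forall>k F. homogeneous k F \<longrightarrow> vars F \<subseteq> S \<longrightarrow>
     (\<forall>x. peval (\<lambda>v. pv x (g v)) F = 0) \<longrightarrow> F = 0)"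

text \<open>Independence of a family, not of its image: a repeated vector makes the family dependent.\<close>

definition lin_indep :: "('v \<Rightarrow> 'a::field ^ 'n) \<Rightarrow> 'v set \<Rightarrow> bool" where
  "lin_indep w S \<longleftrightarrow> (\<forall>c. (\<Sum>v\<in>S. c v *s w v) = 0 \<longrightarrow> (\<forall>v\<in>S. c v = 0))"

text \<open>Induction frees one coordinate at a time: along it \<open>h\<close> is a polynomial of
  degree at most \<open>b\<close> with the \<open>b + 1\<close> roots \<open>0, ..., b\<close>,
  distinct in characteristic zero. The function \<open>z\<close> fixes the coordinates outside
  \<open>T\<close>.\<close>

lemma grid_vanishing:
  fixes h :: "('i \<Rightarrow> 'a::field_char_0) \<Rightarrow> 'a"
  assumes "finite T"
    and "\<And>i y. i \<in> T \<Longrightarrow> \<exists>q. degree q \<le> b \<and> (\<forall>t. poly q t = h (y(i := t)))"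
    and "\<And>y. (\<forall>i\<in>T. y i \<in> of_nat ` {..b}) \<Longrightarrow> (\<forall>i. i \<notin> T \<longrightarrow> y i = z i) \<Longrightarrow> h y = 0"
    and "\<forall>i. i \<notin> T \<longrightarrow> y i = z i"
  shows "h y = 0"
  using assms
proof (induction T arbitrary: y z rule: finite_induct)
  case empty
  show ?case by (rule empty(2)) (use empty in auto)
next
  case (insert a T)
  have *: "h (y(a := t)) = 0" if t: "t \<in> of_nat ` {..b}" for t
  proof (rule insert.IH)
    show "h y' = 0" if "\<forall>i\<in>T. y' i \<in> of_nat ` {..b}" "\<forall>i. i \<notin> T \<longrightarrow> y' i = (z(a := t)) i" for y'
      by (rule insert.prems(2)) (use that t in \<open>auto split: if_splits\<close>)
    show "\<forall>i. i \<notin> T \<longrightarrow> (y(a := t)) i = (z(a := t)) i" using insert.prems(3) by auto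
  qed (use insert.prems(1) in auto)
  obtain q where q: "degree q \<le> b" "\<forall>t. poly q t = h (y(a := t))"
    using insert.prems(1)[of a y] by blast
  have "q = 0"
  proof (rule ccontr)
    assume "q \<noteq> 0"
    have "card (of_nat ` {..b} :: 'a set) = b + 1"
      by (subst card_image) (auto simp: inj_on_def)
    moreover have "card (of_nat ` {..b} :: 'a set) \<le> card {t. poly q t = 0}"
      by (rule card_mono) (use poly_roots_finite[OF \<open>q \<noteq> 0\<close>] q * in auto)
    ultimately show False using card_poly_roots_bound[OF \<open>q \<noteq> 0\<close>] q(1) by simp
  qed
  thus ?case using q(2)[rule_format, of "y a"] by simp
qed

lemma underdetermined:
  fixes a :: "'m \<Rightarrow> 'e \<Rightarrow> 'a::field"
  assumes "finite E" "finite M" "card E < card M"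
  shows "\<exists>c. (\<exists>m\<in>M. c m \<noteq> 0) \<and> (\<forall>e\<in>E. (\<Sum>m\<in>M. c m * a m e) = 0)"
  using assms
proof (induction E arbitrary: M a rule: finite_induct)
  case empty
  then obtain m where "m \<in> M" by fastforce
  thus ?case by (intro exI[of _ "\<lambda>_. 1"]) auto
next
  case (insert e E)
  show ?case
  proof (cases "\<forall>m\<in>M. a m e = 0")
    case True
    have "card E < card M" using insert by simp
    from insert.IH[OF insert.prems(1) this, of a] show ?thesis using True by auto
  next
    case False
    then obtain n where n: "n \<in> M" "a n e \<noteq> 0" by auto
    \<comment> \<open>Equation \<open>e\<close> is eliminated with pivot \<open>a n e\<close>; the
      unknown of index \<open>n\<close> is recovered from it in \<open>c'\<close>.\<close>
    define a' where "a' = (\<lambda>m f. a m f - a m e / a n e * a n f)"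
    have "card E < card (M - {n})" using insert n by simp
    from insert.IH[OF _ this, of a'] obtain c where
      c: "\<exists>m\<in>M - {n}. c m \<noteq> 0" "\<And>f. f \<in> E \<Longrightarrow> (\<Sum>m\<in>M - {n}. c m * a' m f) = 0"
      using insert.prems by auto
    define s where "s = (\<Sum>m\<in>M - {n}. c m * a m e)"
    define c' where "c' = c(n := - s / a n e)"
    have sum: "(\<Sum>m\<in>M. c' m * a m f) = (\<Sum>m\<in>M - {n}. c m * a m f) - s / a n e * a n f" for f
    proof -
      have "(\<Sum>m\<in>M. c' m * a m f) = c' n * a n f + (\<Sum>m\<in>M - {n}. c' m * a m f)"
        using n insert.prems by (simp add: sum.remove)
      also have "(\<Sum>m\<in>M - {n}. c' m * a m f) = (\<Sum>m\<in>M - {n}. c m * a m f)"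
        by (rule sum.cong) (auto simp: c'_def)
      finally show ?thesis by (simp add: c'_def)
    qed
    have "(\<Sum>m\<in>M. c' m * a m f) = 0" if "f \<in> E" for f
    proof -
      have "(\<Sum>m\<in>M - {n}. c m * a' m f) = (\<Sum>m\<in>M - {n}. c m * a m f) - s / a n e * a n f"
        by (simp add: a'_def s_def algebra_simps sum_subtractf sum_distrib_left sum_divide_distrib)
      thus ?thesis using c(2)[OF that] sum by simp
    qed
    moreover have "(\<Sum>m\<in>M. c' m * a m e) = 0"
      using n unfolding sum by (simp add: s_def)
    moreover have "\<exists>m\<in>M. c' m \<noteq> 0" using c(1) by (auto simp: c'_def)
    ultimately show ?thesis by (intro exI[of _ c']) auto
  qed
qed

lemma mdeg_sum: "mdeg (\<Sum>i\<in>A. f i) = (\<Sum>i\<in>A. mdeg (f i))"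
  by (induction A rule: infinite_finite_induct) (auto simp: mdeg_add)

lemma vars_sum_single: "vars (\<Sum>e\<in>M. Poly_Mapping.single (f e) (c e)) \<subseteq> (\<Union>e\<in>M. Poly_Mapping.keys (f e))"
proof
  fix v assume "v \<in> vars (\<Sum>e\<in>M. Poly_Mapping.single (f e) (c e))"
  then obtain m where m: "Poly_Mapping.lookup (\<Sum>e\<in>M. Poly_Mapping.single (f e) (c e)) m \<noteq> 0"
    and v: "v \<in> Poly_Mapping.keys m" by (auto simp: vars_def in_keys_iff)
  from m have "(\<Sum>e\<in>M. c e when f e = m) \<noteq> 0" by (simp add: lookup_sum lookup_single)
  then obtain e where "e \<in> M" "f e = m" by (auto elim!: sum.not_neutral_contains_not_neutral)
  thus "v \<in> (\<Union>e\<in>M. Poly_Mapping.keys (f e))" using v by auto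
qed

text \<open>On the hyperplane \<open>x $ i0 = 1\<close> a form of degree \<open>k\<close> in the \<open>g v\<close> vanishes as soon as it
  vanishes on a grid of \<open>(D\<cdot>k + 1)\<^bsup>n-1\<^esup>\<close> points. For large \<open>k\<close> this imposes fewer linear conditions
  than there are monomials of degree \<open>k\<close> in \<open>n + 1\<close> variables.\<close>

lemma many_forms_dependent:
  fixes g :: "'v \<Rightarrow> ('n::finite, 'a::field_char_0) mpoly"
  assumes hom: "\<And>v. v \<in> S \<Longrightarrow> homogeneous D (g v)" and D: "D > 0"
    and S: "finite S" "card S > CARD('n)"
  shows "\<not> alg_indep g S"
proof -
  define n where "n = CARD('n)"
  have n0: "n > 0" by (simp add: n_def)
  obtain S' where S': "S' \<subseteq> S" "card S' = Suc n"
    using S(2) obtain_subset_with_card_n[of "Suc n" S] by (metis Suc_leI n_def)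
  have fS': "finite S'" using S' S finite_subset by blast
  obtain v0 where v0: "v0 \<in> S'" using S' by fastforce
  define S0 where "S0 = S' - {v0}"
  have S0: "finite S0" "card S0 = n" using S' fS' v0 by (auto simp: S0_def)
  \<comment> \<open>For \<open>k = j * n\<close> one has
    \<open>D * k + 1 \<le> n * D * (j + 1)\<close>. With this \<open>j\<close> the number of grid
    points is at most \<open>(n * D * (j + 1)) ^ (n - 1) = j * (j + 1) ^ (n - 1)\<close>, less than
    the \<open>(j + 1) ^ n\<close> monomials.\<close>
  define j where "j = (n * D) ^ (n - 1)"
  define k where "k = j * n"
  define M where "M = PiE S0 (\<lambda>_. {..j})"
  \<comment> \<open>The exponents on \<open>S0\<close> are free in \<open>{..j}\<close>;
    \<open>v0\<close> fills the degree up to \<open>k\<close>, and the difference is not truncated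
    because \<open>k = j * n\<close>.\<close>
  define me where "me = (\<lambda>e. (\<Sum>v\<in>S0. Poly_Mapping.single v (e v)) +
     Poly_Mapping.single v0 (k - (\<Sum>v\<in>S0. e v)) :: 'v \<Rightarrow>\<^sub>0 nat)"
  obtain i0 :: 'n where True by simp
  define T where "T = UNIV - {i0}"
  define E where "E = PiE T (\<lambda>_. {..D * k})"
  have fM: "finite M" unfolding M_def by (intro finite_PiE S0) auto
  have fE: "finite E" unfolding E_def by (intro finite_PiE) auto
  have cT: "card T = n - 1" by (simp add: T_def n_def)
  have lookup_me: "Poly_Mapping.lookup (me e) v = e v" if "v \<in> S0" for e v
    using that S0 by (auto simp: me_def lookup_add lookup_sum lookup_single when_def S0_def)
  have inj: "inj_on me M"
  proof (rule inj_onI)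
    fix e e' assume e: "e \<in> M" "e' \<in> M" "me e = me e'"
    show "e = e'"
    proof (rule PiE_ext[OF e(1,2)[unfolded M_def]])
      fix v assume "v \<in> S0"
      thus "e v = e' v" using lookup_me[of v e] lookup_me[of v e'] e(3) by simp
    qed
  qed
  have mdeg_me: "mdeg (me e) = k" if "e \<in> M" for e
  proof -
    have "(\<Sum>v\<in>S0. e v) \<le> (\<Sum>v\<in>S0. j)" using that by (intro sum_mono) (auto simp: M_def)
    thus ?thesis using S0 by (simp add: me_def mdeg_add mdeg_sum k_def mult.commute)
  qed
  have keys_me: "Poly_Mapping.keys (me e) \<subseteq> S'" for e
  proof
    fix v assume "v \<in> Poly_Mapping.keys (me e)"
    show "v \<in> S'"
    proof (rule ccontr)
      assume "v \<notin> S'"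
      hence "v \<notin> S0" "v \<noteq> v0" using v0 by (auto simp: S0_def)
      hence "Poly_Mapping.lookup (me e) v = 0"
        by (auto simp: me_def lookup_add lookup_sum lookup_single when_def intro!: sum.neutral)
      thus False using \<open>v \<in> Poly_Mapping.keys (me e)\<close> by (simp add: in_keys_iff)
    qed
  qed
  have cardlt: "card E < card M"
  proof -
    have "n * D \<ge> 1" using n0 D by simp
    have "D * k + 1 \<le> n * D * (j + 1)" using \<open>n * D \<ge> 1\<close> by (simp add: k_def algebra_simps)
    hence "(D * k + 1) ^ (n - 1) \<le> (n * D * (j + 1)) ^ (n - 1)" by (rule power_mono) simp
    also have "\<dots> = j * (j + 1) ^ (n - 1)"
      unfolding power_mult_distrib[of "n * D"] j_def ..
    also have "\<dots> < (j + 1) * (j + 1) ^ (n - 1)" by simp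
    also have "\<dots> = (j + 1) ^ n" using n0 by (cases n) auto
    finally have "(D * k + 1) ^ (n - 1) < (j + 1) ^ n" .
    moreover have "card M = (j + 1) ^ n" using S0 by (simp add: M_def card_PiE)
    moreover have "card E = (D * k + 1) ^ (n - 1)"
      unfolding E_def by (subst card_PiE) (simp_all add: cT)
    ultimately show ?thesis by simp
  qed
  define pt where "pt = (\<lambda>e :: 'n \<Rightarrow> nat. (\<chi> i. if i = i0 then 1 else of_nat (e i)) :: 'a ^ 'n)"
  from underdetermined[OF fE fM cardlt, of "\<lambda>m e. pmon (\<lambda>v. pv (pt e) (g v)) (me m)"]
  obtain c where c: "\<exists>m\<in>M. c m \<noteq> 0"
    "\<And>e. e \<in> E \<Longrightarrow> (\<Sum>m\<in>M. c m * pmon (\<lambda>v. pv (pt e) (g v)) (me m)) = 0" by blast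
  define F where "F = (\<Sum>m\<in>M. Poly_Mapping.single (me m) (c m))"
  have F0: "F \<noteq> 0"
  proof
    assume "F = 0"
    obtain m where m: "m \<in> M" "c m \<noteq> 0" using c by auto
    have "Poly_Mapping.lookup F (me m) = (\<Sum>m'\<in>M. c m' when m' = m)"
      unfolding F_def lookup_sum lookup_single
      by (rule sum.cong) (use inj m in \<open>auto simp: when_def inj_on_def\<close>)
    also have "\<dots> = c m" using fM m by (simp add: when_def)
    finally show False using m \<open>F = 0\<close> by simp
  qed
  have Fhom: "homogeneous k F"
    unfolding F_def by (rule homogeneous_sum) (simp add: mdeg_me)
  have Fvars: "vars F \<subseteq> S'"
    using vars_sum_single[of me c M] keys_me unfolding F_def by blast
  define G where "G = psubst g F"
  have Ghom: "homogeneous (D * k) G"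
    unfolding G_def by (rule homogeneous_psubst[OF Fhom]) (use Fvars S' hom in auto)
  have grid: "pv (\<chi> i. y i) G = 0" if "\<forall>i. i \<notin> T \<longrightarrow> y i = 1" for y
  proof (rule grid_vanishing[where T = T and b = "D * k" and z = "\<lambda>_. 1" and
        h = "\<lambda>y. pv (\<chi> i. y i) G"])
    fix i and y :: "'n \<Rightarrow> 'a" assume "i \<in> T"
    let ?V = "\<lambda>l. [:(y(i := 0)) l, if l = i then 1 else 0:]"
    have "degree (line_poly ?V G) \<le> 1 * (D * k)"
      by (rule degree_line_poly[OF Ghom]) simp
    moreover have "poly (line_poly ?V G) t = pv (\<chi> l. (y(i := t)) l) G" for t
    proof -
      have "(\<lambda>l. poly (?V l) t) = ($) (\<chi> l. (y(i := t)) l)" by auto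
      thus ?thesis by simp
    qed
    ultimately show "\<exists>q. degree q \<le> D * k \<and> (\<forall>t. poly q t = pv (\<chi> l. (y(i := t)) l) G)"
      by (intro exI[of _ "line_poly ?V G"]) auto
  next
    fix y :: "'n \<Rightarrow> 'a"
    assume y: "\<forall>i\<in>T. y i \<in> of_nat ` {..D * k}" "\<forall>i. i \<notin> T \<longrightarrow> y i = 1"
    define e where "e = (\<lambda>i. if i \<in> T then (SOME b. b \<le> D * k \<and> y i = of_nat b) else undefined)"
    have e: "e i \<le> D * k \<and> y i = of_nat (e i)" if i: "i \<in> T" for i
    proof -
      have "\<exists>b. b \<le> D * k \<and> y i = of_nat b" using y(1) i by auto
      from someI_ex[OF this] show ?thesis using i by (simp add: e_def)
    qed
    have "e \<in> E" unfolding E_def using e by (auto simp: e_def)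
    moreover have "(\<chi> i. y i) = pt e"
      using e y(2) by (auto simp: cart_eq_iff pt_def T_def)
    ultimately show "pv (\<chi> i. y i) G = 0"
      using c(2)[of e] by (simp add: G_def F_def)
  qed (use that in \<open>auto simp: T_def\<close>)
  \<comment> \<open>Scaling carries the vanishing to all points with \<open>x $ i0\<close> nonzero;
    the factor \<open>X i0\<close> absorbs the others and is then cancelled.\<close>
  have "pv x G * pv x (X i0) = 0" for x
  proof (cases "x $ i0 = 0")
    case False
    define y where "y = inverse (x $ i0) *s x"
    have "pv (\<chi> i. y $ i) G = 0" by (rule grid) (use False in \<open>auto simp: T_def y_def\<close>)
    hence "pv y G = 0" by simp
    thus ?thesis using pv_scale[OF Ghom, of "inverse (x $ i0)" x] False by (simp add: y_def)
  qed simp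
  from vanishing_mult[OF this, of "\<chi> i. 1"] have "pv x G = 0" for x by simp
  hence "peval (\<lambda>v. pv x (g v)) F = 0" for x by (simp add: G_def)
  thus ?thesis using Fhom Fvars S' F0 unfolding alg_indep_def by blast
qed

section \<open>Linear independence and minors\<close>

lemma span_image_combination:
  fixes w :: "'v \<Rightarrow> 'a::field ^ 'n"
  assumes "finite S" "x \<in> vec.span (w ` S)"
  shows "\<exists>c. x = (\<Sum>v\<in>S. c v *s w v)"
  using assms(2)
proof (induction rule: vec.span_induct_alt)
  case base
  show ?case by (rule exI[of _ "\<lambda>_. 0"]) simp
next
  case (step c x y)
  then obtain v d where v: "v \<in> S" "x = w v" "y = (\<Sum>v\<in>S. d v *s w v)" by auto
  have "(\<Sum>u\<in>S. (d u + (if u = v then c else 0)) *s w u) = y + (\<Sum>u\<in>S. (if u = v then c *s w u else 0))"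
    unfolding v(3) by (subst sum.distrib[symmetric], rule sum.cong) (auto simp: vec.scale_left_distrib)
  also have "\<dots> = c *s x + y" using v assms(1) by (simp add: add.commute)
  finally show ?case by metis
qed

lemma combination_in_span:
  "(\<Sum>v\<in>S. c v *s w v) \<in> vec.span (w ` S)"
  by (intro vec.span_sum vec.span_scale vec.span_base) auto

lemma lin_indepD:
  "lin_indep w S \<Longrightarrow> (\<Sum>v\<in>S. c v *s w v) = 0 \<Longrightarrow> v \<in> S \<Longrightarrow> c v = 0"
  by (simp add: lin_indep_def)

lemma lin_indep_iff_independent:
  fixes w :: "'v \<Rightarrow> 'a::field ^ 'n"
  assumes S: "finite S"
  shows "lin_indep w S \<longleftrightarrow> inj_on w S \<and> vec.independent (w ` S)"
proof
  assume L: "lin_indep w S"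
  have inj: "inj_on w S"
  proof (rule inj_onI, rule ccontr)
    fix a b assume ab: "a \<in> S" "b \<in> S" "w a = w b" "a \<noteq> b"
    define c :: "'v \<Rightarrow> 'a" where "c = (\<lambda>v. if v = a then 1 else if v = b then -1 else 0)"
    have "(\<Sum>v\<in>S. c v *s w v) = (\<Sum>v\<in>{a, b}. c v *s w v)"
      using ab S by (intro sum.mono_neutral_right) (auto simp: c_def)
    also have "\<dots> = 0" using ab by (simp add: c_def)
    finally have "c a = 0" using L[unfolded lin_indep_def, rule_format, of c] ab by blast
    thus False by (simp add: c_def)
  qed
  have "vec.independent (w ` S)"
  proof (rule vec.independent_if_scalars_zero)
    fix f x assume f: "(\<Sum>x\<in>w ` S. f x *s x) = 0" "x \<in> w ` S"
    hence "(\<Sum>v\<in>S. f (w v) *s w v) = 0" using inj by (simp add: sum.reindex)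
    hence "\<forall>v\<in>S. f (w v) = 0" using L[unfolded lin_indep_def, rule_format, of "\<lambda>v. f (w v)"] by blast
    thus "f x = 0" using f(2) by blast
  qed (use S in auto)
  with inj show "inj_on w S \<and> vec.independent (w ` S)" ..
next
  assume R: "inj_on w S \<and> vec.independent (w ` S)"
  show "lin_indep w S"
    unfolding lin_indep_def
  proof (intro allI impI ballI)
    fix c v assume c: "(\<Sum>v\<in>S. c v *s w v) = 0" "v \<in> S"
    have "(\<Sum>x\<in>w ` S. c (the_inv_into S w x) *s x) = 0"
      using R c(1) by (simp add: sum.reindex the_inv_into_f_f)
    hence "c (the_inv_into S w (w v)) = 0"
      using vec.independentD[of "w ` S" "w ` S" "\<lambda>x. c (the_inv_into S w x)" "w v"] R c(2) S by blast
    thus "c v = 0" using R c(2) by (simp add: the_inv_into_f_f)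
  qed
qed

lemma lin_indep_iff_dim:
  fixes w :: "'v \<Rightarrow> 'a::field ^ 'n"
  assumes S: "finite S"
  shows "lin_indep w S \<longleftrightarrow> vec.dim (w ` S) = card S"
proof
  assume "lin_indep w S"
  thus "vec.dim (w ` S) = card S"
    using S by (simp add: lin_indep_iff_independent card_image vec.dim_eq_card_independent)
next
  assume d: "vec.dim (w ` S) = card S"
  have "vec.dim (w ` S) \<le> card (w ` S)"
    by (rule vec.dim_le_card) (use S vec.span_superset[of "w ` S"] in auto)
  moreover have "card (w ` S) \<le> card S" using S by (rule card_image_le)
  ultimately have c: "card (w ` S) = card S" using d by simp
  hence "inj_on w S" using S by (rule eq_card_imp_inj_on[rotated])
  moreover have "vec.independent (w ` S)"
    by (rule vec.card_le_dim_spanning[of _ "w ` S"]) (use S vec.span_superset[of "w ` S"] d c in auto)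
  ultimately show "lin_indep w S" using S by (simp add: lin_indep_iff_independent)
qed

lemma lin_indep_mono:
  assumes "lin_indep w S" "finite S" "T \<subseteq> S"
  shows "lin_indep w T"
  unfolding lin_indep_def
proof (intro allI impI ballI)
  fix c v assume c: "(\<Sum>v\<in>T. c v *s w v) = 0" and v: "v \<in> T"
  have "(\<Sum>v\<in>S. (if v \<in> T then c v else 0) *s w v) = (\<Sum>v\<in>T. c v *s w v)"
    using assms by (intro sum.mono_neutral_cong_right) auto
  with c have "(if v \<in> T then c v else 0) = 0"
    using lin_indepD[OF assms(1), of "\<lambda>v. if v \<in> T then c v else 0" v] assms(3) v by auto
  thus "c v = 0" using v by simp
qed

lemma lin_indep_reindex:
  assumes "bij_betw h T S"
  shows "lin_indep (\<lambda>t. w (h t)) T \<longleftrightarrow> lin_indep w S"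
proof -
  have s: "(\<Sum>t\<in>T. c (h t) *s w (h t)) = (\<Sum>v\<in>S. c v *s w v)" for c
    by (rule sum.reindex_bij_betw[OF assms])
  show ?thesis
  proof
    assume L: "lin_indep (\<lambda>t. w (h t)) T"
    show "lin_indep w S" unfolding lin_indep_def
    proof (intro allI impI ballI)
      fix c v assume "(\<Sum>v\<in>S. c v *s w v) = 0" "v \<in> S"
      moreover from this obtain t where "t \<in> T" "v = h t" using assms by (auto simp: bij_betw_def)
      ultimately show "c v = 0" using lin_indepD[OF L, of "\<lambda>t. c (h t)" t] s[of c] by simp
    qed
  next
    assume L: "lin_indep w S"
    show "lin_indep (\<lambda>t. w (h t)) T" unfolding lin_indep_def
    proof (intro allI impI ballI)
      fix c t assume c: "(\<Sum>t\<in>T. c t *s w (h t)) = 0" and t: "t \<in> T"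
      have "(\<Sum>v\<in>S. c (the_inv_into T h v) *s w v) = (\<Sum>t\<in>T. c t *s w (h t))"
        unfolding s[symmetric] using assms
        by (intro sum.cong) (auto simp: bij_betw_def the_inv_into_f_f)
      hence "c (the_inv_into T h (h t)) = 0"
        using lin_indepD[OF L, of "\<lambda>v. c (the_inv_into T h v)"] c t assms
        unfolding bij_betw_def by auto
      thus "c t = 0" using t assms by (simp add: bij_betw_def the_inv_into_f_f)
    qed
  qed
qed

text \<open>The size of the minors is the length of a list; as matrices with explicit dimensions
  they admit Laplace expansion and the adjugate.\<close>

definition pmat :: "('a::field ^ 'n) list \<Rightarrow> 'n list \<Rightarrow> 'a mat" where
  "pmat vs I = mat (length vs) (length vs) (\<lambda>(k, l). (vs ! k) $ (I ! l))"

lemma pmat_carrier [simp]: "pmat vs I \<in> carrier_mat (length vs) (length vs)"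
  by (simp add: pmat_def)

lemma pluecker_eq_det: "length I = length vs \<Longrightarrow> pluecker vs I = Determinant.det (pmat vs I)"
proof -
  have "\<sigma> k < length vs" if "\<sigma> permutes {0..<length vs}" "k < length vs" for \<sigma> k
    using permutes_in_image[OF that(1), of k] that(2) by simp
  thus "length I = length vs \<Longrightarrow> pluecker vs I = Determinant.det (pmat vs I)"
    unfolding pluecker_def det_def'[OF pmat_carrier]
    by (auto simp: pmat_def lessThan_atLeast0 intro!: sum.cong prod.cong)
qed

lemma pluecker_length: "pluecker vs I \<noteq> 0 \<Longrightarrow> length I = length vs"
  by (auto simp: pluecker_def split: if_splits)

abbreviation indep_list :: "('a::field ^ 'n) list \<Rightarrow> bool" where
  "indep_list vs \<equiv> lin_indep ((!) vs) {..<length vs}"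

lemma indep_list_iff_dim: "indep_list vs \<longleftrightarrow> vec.dim (set vs) = length vs"
proof -
  have "(!) vs ` {..<length vs} = set vs" by (auto simp: set_conv_nth)
  thus ?thesis by (simp add: lin_indep_iff_dim)
qed

lemma det_eq_0_imp_row_relation:
  fixes A :: "'a::field mat"
  assumes A: "A \<in> carrier_mat m m" and "Determinant.det A = 0"
  shows "\<exists>c. (\<exists>k<m. c k \<noteq> 0) \<and> (\<forall>l<m. (\<Sum>k<m. c k * A $$ (k, l)) = 0)"
proof -
  have "Determinant.det (transpose_mat A) = 0" using assms by (simp add: det_transpose)
  then obtain v where v: "v \<in> carrier_vec m" "v \<noteq> 0\<^sub>v m" "transpose_mat A *\<^sub>v v = 0\<^sub>v m"
    using det_0_iff_vec_prod_zero_field[of "transpose_mat A" m] A by auto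
  have "\<exists>k<m. vec_index v k \<noteq> 0" using v(1,2) by (auto simp: Matrix.vec_eq_iff)
  moreover have "(\<Sum>k<m. vec_index v k * A $$ (k, l)) = 0" if "l < m" for l
  proof -
    have "vec_index (transpose_mat A *\<^sub>v v) l = 0" using v(3) that by simp
    thus ?thesis using A v(1) that
      by (simp add: scalar_prod_def lessThan_atLeast0 mult.commute)
  qed
  ultimately show ?thesis by blast
qed

lemma row_relation_imp_det_eq_0:
  fixes A :: "'a::field mat"
  assumes A: "A \<in> carrier_mat m m" and "k < m" "c k \<noteq> 0"
    and "\<And>l. l < m \<Longrightarrow> (\<Sum>k<m. c k * A $$ (k, l)) = 0"
  shows "Determinant.det A = 0"
proof -
  define v where "v = Matrix.vec m c"
  have "transpose_mat A *\<^sub>v v = 0\<^sub>v m"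
    using A assms(4) by (intro eq_vecI) (auto simp: v_def scalar_prod_def lessThan_atLeast0 mult.commute)
  moreover have "v \<noteq> 0\<^sub>v m" using assms(2,3) by (auto simp: v_def Matrix.vec_eq_iff)
  moreover have "v \<in> carrier_vec m" by (simp add: v_def)
  ultimately have "Determinant.det (transpose_mat A) = 0"
    using det_0_iff_vec_prod_zero_field[of "transpose_mat A" m] A by auto
  thus ?thesis using A by (simp add: det_transpose)
qed

lemma pluecker_nonzero_imp_indep:
  assumes "pluecker vs I \<noteq> 0"
  shows "indep_list vs"
  unfolding lin_indep_def
proof (intro allI impI ballI, rule ccontr)
  fix c k assume c: "(\<Sum>k<length vs. c k *s (vs ! k)) = 0" and k: "k \<in> {..<length vs}" "c k \<noteq> 0"
  have "Determinant.det (pmat vs I) = 0"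
  proof (rule row_relation_imp_det_eq_0[OF pmat_carrier])
    fix l assume l: "l < length vs"
    have "(\<Sum>k<length vs. c k *s (vs ! k)) $ (I ! l) = 0" using c by simp
    thus "(\<Sum>k<length vs. c k * pmat vs I $$ (k, l)) = 0" using l by (simp add: pmat_def)
  qed (use k in auto)
  thus False using assms pluecker_length[OF assms] by (simp add: pluecker_eq_det)
qed

text \<open>Complete \<open>vs\<close> to a basis by coordinate axes, indexed by \<open>J\<close>,
  and take the columns outside \<open>J\<close>. A relation between the rows of this minor would
  give a nonzero combination of \<open>vs\<close> supported on \<open>J\<close>, but the spans of
  \<open>vs\<close> and of the axes in \<open>J\<close> meet only in zero.\<close>

lemma indep_imp_pluecker_nonzero:
  fixes vs :: "('a::field ^ 'n::finite) list"
  assumes L: "indep_list vs"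
  shows "\<exists>I. length I = length vs \<and> distinct I \<and> pluecker vs I \<noteq> 0"
proof -
  define m where "m = length vs"
  have img: "(!) vs ` {..<m} = set vs" by (auto simp: set_conv_nth m_def)
  have inj: "inj_on ((!) vs) {..<m}" and ind: "vec.independent (set vs)"
    using L lin_indep_iff_independent[of "{..<m}" "(!) vs"] img by (auto simp: m_def)
  have cm: "card (set vs) = m" using inj img by (metis card_image card_lessThan)
  define ax :: "'n \<Rightarrow> 'a ^ 'n" where "ax = (\<lambda>i. axis i 1)"
  have injax: "inj ax" by (auto simp: ax_def inj_on_def axis_eq_axis)
  obtain B where B: "set vs \<subseteq> B" "B \<subseteq> set vs \<union> Set.range ax" "vec.independent B"
    "set vs \<union> Set.range ax \<subseteq> vec.span B"
    using vec.maximal_independent_subset_extend[of "set vs" "set vs \<union> Set.range ax"] ind by blast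
  have "vec.span (Set.range ax) = UNIV"
    using vec.span_Basis unfolding cart_basis_def ax_def by (simp add: full_SetCompr_eq)
  hence spB: "vec.span B = UNIV"
    using B(4) vec.span_mono[of "Set.range ax" "vec.span B"]
    by (simp add: vec.span_span top.extremum_unique)
  have cB: "card B = CARD('n)"
    using vec.dim_eq_card[OF spB[symmetric, unfolded spB[symmetric]]] B(3) spB
    by (metis vec.dim_eq_card_independent vec.dim_span vec_dim_card)
  have fB: "finite B" using B(3) vec.finiteI_independent by blast
  define J where "J = {i. ax i \<in> B - set vs}"
  have imJ: "ax ` J = B - set vs" using B(2) by (auto simp: J_def)
  have "card J = card (B - set vs)" using injax imJ by (metis card_image inj_on_subset subset_UNIV)
  also have "\<dots> = CARD('n) - m" using B(1) cB cm fB by (simp add: card_Diff_subset)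
  finally have cJ: "card J = CARD('n) - m" .
  have "m \<le> CARD('n)" using B(1) cB cm fB by (metis card_mono)
  hence "card (- J) = m" using cJ by (simp add: Compl_eq_Diff_UNIV card_Diff_subset)
  then obtain I where I: "set I = - J" "distinct I" "length I = m"
    using finite_distinct_list[of "- J"] distinct_card by force
  have "Determinant.det (pmat vs I) \<noteq> 0"
  proof
    assume "Determinant.det (pmat vs I) = 0"
    from det_eq_0_imp_row_relation[OF pmat_carrier this] obtain c k where
      k: "k < m" "c k \<noteq> 0" and c: "\<And>l. l < m \<Longrightarrow> (\<Sum>k<m. c k * (vs ! k) $ (I ! l)) = 0"
      by (auto simp: m_def pmat_def)
    define x where "x = (\<Sum>k<m. c k *s (vs ! k))"
    have x0: "x $ i = 0" if i: "i \<notin> J" for i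
    proof -
      obtain l where "l < m" "i = I ! l" using I i in_set_conv_nth[of i I] by auto
      thus ?thesis using c[of l] by (simp add: x_def)
    qed
    have "x = (\<Sum>i\<in>UNIV. x $ i *s ax i)"
      unfolding ax_def by (simp add: basis_expansion)
    also have "\<dots> = (\<Sum>i\<in>J. x $ i *s ax i)"
      by (rule sum.mono_neutral_right) (auto simp: x0)
    finally have xJ: "x = (\<Sum>i\<in>J. x $ i *s ax i)" .
    hence "x \<in> vec.span (B - set vs)" using combination_in_span[of "\<lambda>i. x $ i" ax J] imJ by metis
    moreover have "x \<in> vec.span (set vs)"
      using combination_in_span[of c "(!) vs" "{..<m}"] img by (simp add: x_def)
    moreover have "vec.dim (vec.span (B - set vs) \<inter> vec.span (set vs)) = 0"
    proof -
      have "vec.independent (B - set vs)" using B(3) by (rule vec.independent_mono) auto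
      hence "vec.dim (vec.span (B - set vs)) = CARD('n) - m"
        using B(1) cB cm fB by (simp add: vec.dim_eq_card_independent card_Diff_subset)
      moreover have "vec.dim (vec.span (set vs)) = m"
        using ind cm by (simp add: vec.dim_eq_card_independent)
      moreover have "{x + y |x y. x \<in> vec.span (B - set vs) \<and> y \<in> vec.span (set vs)} = UNIV"
        using vec.span_Un[of "B - set vs" "set vs"] B(1) spB by (simp add: Un_absorb2)
      ultimately show ?thesis
        using vec.dim_sums_Int[of "vec.span (B - set vs)" "vec.span (set vs)"] \<open>m \<le> CARD('n)\<close>
        by (simp add: vec_dim_card del: vec.dim_UNIV vec.dim_eq_0)
    qed
    ultimately have "x = 0" unfolding vec.dim_eq_0 by blast
    hence "c k = 0" using L k unfolding lin_indep_def by (auto simp: x_def m_def)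
    thus False using k by simp
  qed
  thus ?thesis using I by (intro exI[of _ I]) (simp add: pluecker_eq_det m_def)
qed

text \<open>The factor is the determinant of a matrix expressing \<open>ws\<close> in
  \<open>vs\<close>. It may be zero: \<open>ws\<close> can be dependent, which is allowed for when
  two lists of relation gradients are compared.\<close>

lemma pluecker_change_of_basis:
  fixes vs ws :: "('a::field ^ 'n) list"
  assumes "set ws \<subseteq> vec.span (set vs)" "length ws = length vs"
  shows "\<exists>c. \<forall>I. pluecker ws I = c * pluecker vs I"
proof -
  define m where "m = length vs"
  have img: "(!) vs ` {..<m} = set vs" by (auto simp: set_conv_nth m_def)
  have "\<exists>d. ws ! k = (\<Sum>l<m. d l *s (vs ! l))" if "k < m" for k
    using span_image_combination[of "{..<m}" "ws ! k" "(!) vs"] that assms img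
    by (metis finite_lessThan m_def nth_mem subsetD)
  then obtain d where d: "\<And>k. k < m \<Longrightarrow> ws ! k = (\<Sum>l<m. d k l *s (vs ! l))" by metis
  define M where "M = mat m m (\<lambda>(k, l). d k l)"
  have "pluecker ws I = Determinant.det M * pluecker vs I" for I
  proof (cases "length I = m")
    case True
    have "pmat ws I = M * pmat vs I"
      using assms(2) d by (intro eq_matI)
        (auto simp: pmat_def M_def m_def scalar_prod_def lessThan_atLeast0)
    moreover have "Determinant.det (M * pmat vs I) = Determinant.det M * Determinant.det (pmat vs I)"
      by (rule det_mult) (auto simp: M_def m_def)
    ultimately show ?thesis using True assms(2)
      by (simp add: pluecker_eq_det m_def)
  qed (use assms in \<open>simp add: pluecker_def m_def\<close>)
  thus ?thesis by blast
qed

section \<open>Duality for the standard bilinear form\<close>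

lemma dotp_commute: "dotp x y = dotp y x"
  by (simp add: dotp_def mult.commute)

lemma dotp_sum_right: "dotp u (\<Sum>v\<in>S. c v *s w v) = (\<Sum>v\<in>S. c v * dotp u (w v))"
  using dotp_sum_left[of c w S u] by (simp add: dotp_commute[of u])

lemma dotp_add_left: "dotp (x + y) z = dotp x z + dotp y z"
  by (simp add: dotp_def algebra_simps sum.distrib)

lemma dotp_add_right: "dotp z (x + y) = dotp z x + dotp z y"
  by (simp add: dotp_def algebra_simps sum.distrib)

lemma dotp_diff_right: "dotp z (x - y) = dotp z x - dotp z (y :: 'a::comm_ring_1 ^ 'n)"
  by (simp add: dotp_def algebra_simps sum_subtractf)

lemma dotp_diff_left: "dotp (x - y) z = dotp x z - dotp y (z :: 'a::comm_ring_1 ^ 'n)"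
  by (simp add: dotp_def algebra_simps sum_subtractf)

lemma dotp_scale_left: "dotp (c *s x) z = c * dotp x z"
  by (simp add: dotp_def sum_distrib_left mult_ac)

lemma dotp_scale_right: "dotp z (c *s x) = c * dotp z x"
  by (simp add: dotp_def sum_distrib_left mult_ac)

lemma dotp_zero [simp]: "dotp 0 x = 0" "dotp x 0 = 0"
  by (simp_all add: dotp_def)

lemma dotp_nondegenerate: "(\<And>z. dotp y z = 0) \<Longrightarrow> y = 0"
  by (metis cart_eq_iff dotp_axis zero_index)

lemma dual_space_eq: "dual_space V = {x. \<forall>y\<in>V. dotp y x = 0}"
  by (simp add: dual_space_def dotp_def)

text \<open>The inverse of a nonsingular minor, written with the adjugate, gives the coefficients of
  \<open>ys\<close> on the axes chosen by \<open>I\<close>.\<close>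

lemma dual_family_exists:
  fixes vs :: "('a::field ^ 'n::finite) list"
  assumes "indep_list vs"
  shows "\<exists>ys. \<forall>k<length vs. \<forall>l<length vs. dotp (vs ! k) (ys l) = (if k = l then 1 else 0)"
proof -
  define m where "m = length vs"
  obtain I where I: "length I = m" "pluecker vs I \<noteq> 0"
    using indep_imp_pluecker_nonzero[OF assms] by (auto simp: m_def)
  define A where "A = pmat vs I"
  have A: "A \<in> carrier_mat m m" by (simp add: A_def m_def)
  have dA: "Determinant.det A \<noteq> 0" using I by (simp add: A_def pluecker_eq_det m_def)
  define ys where "ys = (\<lambda>l. \<Sum>j<m. (adj_mat A $$ (j, l) / Determinant.det A) *s axis (I ! j) (1::'a))"
  have "dotp (vs ! k) (ys l) = (if k = l then 1 else 0)" if "k < m" "l < m" for k l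
  proof -
    have "dotp (vs ! k) (ys l) = (\<Sum>j<m. (adj_mat A $$ (j, l) / Determinant.det A) * dotp (vs ! k) (axis (I ! j) 1))"
      unfolding ys_def dotp_sum_right ..
    also have "\<dots> = (\<Sum>j<m. A $$ (k, j) * adj_mat A $$ (j, l)) / Determinant.det A"
      using that by (simp add: dotp_axis A_def pmat_def m_def sum_divide_distrib mult_ac)
    also have "(\<Sum>j<m. A $$ (k, j) * adj_mat A $$ (j, l)) = (A * adj_mat A) $$ (k, l)"
      using A adj_mat(1)[OF A] that by (simp add: scalar_prod_def lessThan_atLeast0)
    also have "\<dots> = (if k = l then Determinant.det A else 0)"
      using adj_mat(2)[OF A] that by simp
    finally show ?thesis using dA by simp
  qed
  thus ?thesis unfolding m_def by blast
qed

lemma subspace_dual_space: "vec.subspace (dual_space V)"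
  by (auto simp: dual_space_eq vec.subspace_def dotp_add_right dotp_scale_right)

lemma dual_space_span: "dual_space (vec.span V) = dual_space V"
proof
  show "dual_space (vec.span V) \<subseteq> dual_space V"
    using vec.span_superset[of V] by (auto simp: dual_space_eq)
  show "dual_space V \<subseteq> dual_space (vec.span V)"
  proof
    fix x assume x: "x \<in> dual_space V"
    have "dotp y x = 0" if "y \<in> vec.span V" for y
      using that
    proof (induction rule: vec.span_induct_alt)
      case (step c a b)
      thus ?case using x by (simp add: dotp_add_left dotp_scale_left dual_space_eq)
    qed simp
    thus "x \<in> dual_space (vec.span V)" by (simp add: dual_space_eq)
  qed
qed

lemma indep_list_spanning_exists:
  fixes V :: "('a::field ^ 'n::finite) set"
  shows "\<exists>vs. set vs \<subseteq> V \<and> indep_list vs \<and> vec.span (set vs) = vec.span V \<and> length vs = vec.dim V"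
proof -
  obtain B where B: "B \<subseteq> V" "vec.independent B" "V \<subseteq> vec.span B" "card B = vec.dim V"
    using vec.basis_exists by metis
  have "finite B" using B(2) vec.finiteI_independent by blast
  then obtain vs where vs: "set vs = B" "distinct vs" using finite_distinct_list by blast
  have l: "length vs = card B" using vs distinct_card by metis
  have "indep_list vs"
    unfolding indep_list_iff_dim using B(2) by (simp add: l vs vec.dim_eq_card_independent)
  moreover have "vec.span (set vs) = vec.span V"
    unfolding vs using B vec.span_mono vec.span_span by (metis subset_antisym)
  ultimately show ?thesis using B vs l by metis
qed

text \<open>Given a basis \<open>vs\<close> and a dual family \<open>ys\<close>, every vector is the
  sum of a combination of \<open>ys\<close> with coefficients \<open>dotp (vs ! k) x\<close> and a
  vector of the dual space. This sum is direct, and it shows that \<open>x\<close> in the bidual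
  equals the combination of \<open>vs\<close> with coefficients
  \<open>dotp x (ys k)\<close>.\<close>

lemma dim_dual_space:
  fixes V :: "('a::field ^ 'n::finite) set"
  shows "vec.dim V + vec.dim (dual_space V) = CARD('n)"
    and "dual_space (dual_space V) = vec.span V"
proof -
  obtain vs where vs: "set vs \<subseteq> V" "indep_list vs" "vec.span (set vs) = vec.span V"
    "length vs = vec.dim V" using indep_list_spanning_exists by metis
  define m where "m = length vs"
  obtain ys where ys: "\<And>k l. k < m \<Longrightarrow> l < m \<Longrightarrow> dotp (vs ! k) (ys l) = (if k = l then 1 else 0)"
    using dual_family_exists[OF vs(2)] by (auto simp: m_def)
  have dual: "dual_space V = {x. \<forall>k<m. dotp (vs ! k) x = 0}"
  proof -
    have "dual_space V = dual_space (set vs)" using dual_space_span vs(3) by metis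
    thus ?thesis by (auto simp: dual_space_eq m_def all_set_conv_all_nth)
  qed
  have dy: "dotp (vs ! k) (\<Sum>l<m. c l *s ys l) = c k" if "k < m" for c k
  proof -
    have "dotp (vs ! k) (\<Sum>l<m. c l *s ys l) = (\<Sum>l<m. if k = l then c l else 0)"
      unfolding dotp_sum_right using ys that by (intro sum.cong) auto
    thus ?thesis using that by simp
  qed
  let ?Y = "vec.span (ys ` {..<m})"
  have "lin_indep ys {..<m}"
    unfolding lin_indep_def
  proof (intro allI impI ballI)
    fix c k assume "(\<Sum>l<m. c l *s ys l) = 0" "k \<in> {..<m}"
    thus "c k = 0" using dy[of k c] by simp
  qed
  hence dimY: "vec.dim ?Y = m" by (simp add: lin_indep_iff_dim)
  have decomp: "x - (\<Sum>k<m. dotp (vs ! k) x *s ys k) \<in> dual_space V" for x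
  proof -
    show ?thesis unfolding dual by (simp add: dy dotp_diff_right)
  qed
  have Yin: "(\<Sum>k<m. c k *s ys k) \<in> ?Y" for c
    by (rule combination_in_span)
  have "x \<in> {x + y |x y. x \<in> ?Y \<and> y \<in> dual_space V}" for x
  proof -
    have *: "x = (\<Sum>k<m. dotp (vs ! k) x *s ys k) + (x - (\<Sum>k<m. dotp (vs ! k) x *s ys k))" by simp
    show ?thesis by (rule CollectI, intro exI conjI, rule *, rule Yin, rule decomp)
  qed
  hence "{x + y |x y. x \<in> ?Y \<and> y \<in> dual_space V} = UNIV" by (rule UNIV_eq_I[symmetric])
  moreover have "?Y \<inter> dual_space V \<subseteq> {0}"
  proof
    fix x assume x: "x \<in> ?Y \<inter> dual_space V"
    then obtain c where c: "x = (\<Sum>l<m. c l *s ys l)"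
      using span_image_combination[of "{..<m}" x ys] by auto
    have "c k = 0" if "k < m" for k using x dy[OF that, of c] that unfolding c dual by auto
    thus "x \<in> {0}" by (simp add: c)
  qed
  hence "vec.dim (?Y \<inter> dual_space V) = 0" by (simp add: vec.dim_eq_0)
  ultimately have "CARD('n) = vec.dim ?Y + vec.dim (dual_space V)"
    using vec.dim_sums_Int[of ?Y "dual_space V"] subspace_dual_space[of V]
    by (simp add: vec_dim_card del: vec.dim_UNIV vec.dim_eq_0)
  thus "vec.dim V + vec.dim (dual_space V) = CARD('n)" using dimY vs(4) by (simp add: m_def)
  show "dual_space (dual_space V) = vec.span V"
  proof
    have "V \<subseteq> dual_space (dual_space V)"
      by (auto simp: dual_space_eq dotp_commute)
    thus "vec.span V \<subseteq> dual_space (dual_space V)"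
      by (rule vec.span_minimal) (rule subspace_dual_space)
    show "dual_space (dual_space V) \<subseteq> vec.span V"
    proof
      fix x assume x: "x \<in> dual_space (dual_space V)"
      define y where "y = x - (\<Sum>k<m. dotp x (ys k) *s (vs ! k))"
      have "dotp y z = 0" for z
      proof -
        define z' where "z' = z - (\<Sum>k<m. dotp (vs ! k) z *s ys k)"
        have z': "z' \<in> dual_space V" unfolding z'_def by (rule decomp)
        have xz: "dotp x z' = 0" using x z' dotp_commute[of x z'] unfolding dual_space_eq by auto
        have "dotp x z = dotp x (z' + (\<Sum>k<m. dotp (vs ! k) z *s ys k))" by (simp add: z'_def)
        also have "\<dots> = (\<Sum>k<m. dotp (vs ! k) z * dotp x (ys k))"
          unfolding dotp_add_right xz dotp_sum_right by simp
        also have "\<dots> = dotp (\<Sum>k<m. dotp x (ys k) *s (vs ! k)) z"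
          unfolding dotp_sum_left by (simp only: mult.commute)
        finally have e: "dotp x z = dotp (\<Sum>k<m. dotp x (ys k) *s (vs ! k)) z" .
        show ?thesis unfolding y_def dotp_diff_left e by simp
      qed
      hence "y = 0" by (rule dotp_nondegenerate)
      hence "x = (\<Sum>k<m. dotp x (ys k) *s (vs ! k))" by (simp add: y_def)
      also have "\<dots> \<in> vec.span ((!) vs ` {..<m})" by (rule combination_in_span)
      also have "(!) vs ` {..<m} = set vs" by (auto simp: set_conv_nth m_def)
      finally show "x \<in> vec.span V" using vs(3) by simp
    qed
  qed
qed

section \<open>Minors with polynomial entries, and openness of linear independence\<close>

definition ppluecker :: "('n \<Rightarrow> ('m, 'a::field) mpoly) list \<Rightarrow> 'n list \<Rightarrow> ('m, 'a) mpoly" where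
  "ppluecker ws I = (if length I = length ws
     then \<Sum>\<sigma> | \<sigma> permutes {..<length ws}.
            of_int (sign \<sigma>) * (\<Prod>k<length ws. (ws ! k) (I ! \<sigma> k))
     else 0)"

lemma peval_ppluecker:
  "peval V (ppluecker ws I) = pluecker (map (\<lambda>w. \<chi> i. peval V (w i)) ws) I"
  by (simp add: ppluecker_def pluecker_def)

lemma homogeneous_of_int: "homogeneous 0 (of_int k :: ('v, 'a::comm_ring_1) mpoly)"
  by (simp flip: single_of_int)

lemma homogeneous_ppluecker:
  assumes "\<And>k i. k < length ws \<Longrightarrow> homogeneous (d k) ((ws ! k) i)"
  shows "homogeneous (\<Sum>k<length ws. d k) (ppluecker ws I)"
proof -
  have "homogeneous (0 + (\<Sum>k<length ws. d k)) (of_int (sign \<sigma>) * (\<Prod>k<length ws. (ws ! k) (I ! \<sigma> k)))" for \<sigma>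
    by (intro homogeneous_mult homogeneous_of_int homogeneous_prod assms) auto
  thus ?thesis by (auto simp: ppluecker_def intro!: homogeneous_sum)
qed

text \<open>A maximal minor that is nonzero at \<open>p\<close> is the required form, since
  independence holds wherever it is nonzero. The degrees may vary with the vector because each term
  of a minor takes one factor from each vector.\<close>

lemma lin_indep_open:
  fixes wp :: "'v \<Rightarrow> 'n::finite \<Rightarrow> ('m::finite, 'a::field) mpoly"
  assumes "finite S" and hom: "\<And>v i. v \<in> S \<Longrightarrow> homogeneous (d v) (wp v i)"
    and L: "lin_indep (\<lambda>v. \<chi> i. pv p (wp v i)) S"
  shows "\<exists>\<eta> e. homogeneous e \<eta> \<and> pv p \<eta> \<noteq> 0 \<and>
    (\<forall>x. pv x \<eta> \<noteq> 0 \<longrightarrow> lin_indep (\<lambda>v. \<chi> i. pv x (wp v i)) S)"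
proof -
  obtain xs where xs: "set xs = S" "distinct xs" using assms(1) finite_distinct_list by blast
  define vs where "vs = (\<lambda>x. map (\<lambda>v. \<chi> i. pv x (wp v i)) xs)"
  have bij: "bij_betw ((!) xs) {..<length xs} S"
    using xs by (metis bij_betw_nth)
  have iff: "indep_list (vs x) \<longleftrightarrow> lin_indep (\<lambda>v. \<chi> i. pv x (wp v i)) S" for x
  proof -
    have "indep_list (vs x) \<longleftrightarrow> lin_indep (\<lambda>k. \<chi> i. pv x (wp (xs ! k) i)) {..<length xs}"
      unfolding lin_indep_def by (auto simp: vs_def)
    also have "\<dots> \<longleftrightarrow> lin_indep (\<lambda>v. \<chi> i. pv x (wp v i)) S"
      by (rule lin_indep_reindex[OF bij])
    finally show ?thesis .
  qed
  obtain I where I: "pluecker (vs p) I \<noteq> 0" using indep_imp_pluecker_nonzero L iff by metis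
  define \<eta> where "\<eta> = ppluecker (map wp xs) I"
  have ev: "pv x \<eta> = pluecker (vs x) I" for x
    by (simp add: \<eta>_def peval_ppluecker vs_def o_def)
  have "homogeneous (\<Sum>k<length (map wp xs). d (xs ! k)) \<eta>"
    unfolding \<eta>_def by (rule homogeneous_ppluecker) (use xs hom in \<open>auto simp: nth_mem\<close>)
  moreover have "pv p \<eta> \<noteq> 0" using I by (simp add: ev)
  moreover have "lin_indep (\<lambda>v. \<chi> i. pv x (wp v i)) S" if "pv x \<eta> \<noteq> 0" for x
    using pluecker_nonzero_imp_indep that unfolding ev iff[symmetric] by blast
  ultimately show ?thesis by blast
qed

section \<open>The Jacobian criterion\<close>

abbreviation relation :: "('v \<Rightarrow> ('n::finite, 'a::field) mpoly) \<Rightarrow> ('v, 'a) mpoly \<Rightarrow> bool" where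
  "relation g F \<equiv> \<forall>x. peval (\<lambda>v. pv x (g v)) F = 0"

lemma vars_empty_imp_const: "vars F = {} \<Longrightarrow> F = Poly_Mapping.single 0 (Poly_Mapping.lookup F 0)"
proof (rule poly_mapping_eqI)
  fix m assume v: "vars F = {}"
  show "Poly_Mapping.lookup F m = Poly_Mapping.lookup (Poly_Mapping.single 0 (Poly_Mapping.lookup F 0)) m"
  proof (cases "m = 0")
    case False
    hence "Poly_Mapping.keys m \<noteq> {}" by (metis keys_eq_empty)
    hence "m \<notin> Poly_Mapping.keys F" using v by (auto simp: vars_def)
    thus ?thesis using False by (simp add: in_keys_iff lookup_single)
  qed simp
qed

lemma vars_empty_relation:
  fixes g :: "'v \<Rightarrow> ('n::finite, 'a::field) mpoly"
  assumes "vars F = {}" "relation g F"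
  shows "F = 0"
proof -
  have F: "F = Poly_Mapping.single 0 (Poly_Mapping.lookup F 0)" by (rule vars_empty_imp_const) fact
  have "peval (\<lambda>v. pv 0 (g v)) (Poly_Mapping.single 0 (Poly_Mapping.lookup F 0)) = 0"
    using assms(2) F by metis
  hence "Poly_Mapping.lookup F 0 = 0" by simp
  thus ?thesis using F by simp
qed

lemma homogeneous_0_imp_vars_empty:
  assumes "homogeneous 0 F"
  shows "vars F = {}"
proof -
  have "Poly_Mapping.keys m = {}" if "m \<in> Poly_Mapping.keys F" for m
    using assms that by (auto simp: homogeneous_iff_mdeg mdeg_def in_keys_iff intro: poly_mapping_eqI)
  thus ?thesis by (auto simp: vars_def)
qed

lemma relation_gradient:
  fixes g :: "'v \<Rightarrow> ('n::finite, 'a::field_char_0) mpoly"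
  assumes "finite S" "vars F \<subseteq> S" "relation g F"
  shows "(\<Sum>v\<in>S. peval (\<lambda>v. pv x (g v)) (pdiff v F) *s gradient_at (g v) x) = 0"
  unfolding gradient_chain[OF assms(1,2), symmetric]
  by (rule gradient_vanishing) (simp add: assms(3))

lemma gradient_lin_indep_open:
  fixes g :: "'v \<Rightarrow> ('n::finite, 'a::field_char_0) mpoly"
  assumes "finite S" "\<And>v. v \<in> S \<Longrightarrow> homogeneous D (g v)"
    and "lin_indep (\<lambda>v. gradient_at (g v) p) S"
  shows "\<exists>\<eta> e. homogeneous e \<eta> \<and> pv p \<eta> \<noteq> 0 \<and>
    (\<forall>x. pv x \<eta> \<noteq> 0 \<longrightarrow> lin_indep (\<lambda>v. gradient_at (g v) x) S)"
  unfolding gradient_at_def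
  by (rule lin_indep_open[where d = "\<lambda>_. D - 1"])
    (use assms in \<open>auto simp: gradient_at_def intro!: homogeneous_pdiff[of D, simplified]\<close>)

text \<open>Differentiating a relation \<open>F\<close> gives a linear relation between the
  gradients, with the values of \<open>pdiff v F\<close> as coefficients. Where the gradients are
  independent these vanish, so every \<open>pdiff v F\<close> is a relation of lower degree and is
  zero by induction; then \<open>F\<close> is constant.\<close>

lemma lin_indep_imp_alg_indep:
  fixes g :: "'v \<Rightarrow> ('n::finite, 'a::field_char_0) mpoly"
  assumes S: "finite S" and hom: "\<And>v. v \<in> S \<Longrightarrow> homogeneous D (g v)"
    and L: "lin_indep (\<lambda>v. gradient_at (g v) p) S"
  shows "alg_indep g S"
proof -
  obtain \<eta> where \<eta>: "pv p \<eta> \<noteq> 0" "\<And>x. pv x \<eta> \<noteq> 0 \<Longrightarrow> lin_indep (\<lambda>v. gradient_at (g v) x) S"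
    using gradient_lin_indep_open[OF S hom L] by blast
  have "F = 0" if "homogeneous k F" "vars F \<subseteq> S" "relation g F" for k F
    using that
  proof (induction k arbitrary: F)
    case 0
    show ?case by (rule vars_empty_relation[OF homogeneous_0_imp_vars_empty[OF 0(1)] 0(3)])
  next
    case (Suc k)
    have "pdiff v F = 0" if v: "v \<in> S" for v
    proof (rule Suc.IH)
      show "homogeneous k (pdiff v F)" using homogeneous_pdiff[OF Suc.prems(1)] by simp
      show "vars (pdiff v F) \<subseteq> S" by (rule subset_trans[OF vars_pdiff Suc.prems(2)])
      have "pv x (psubst g (pdiff v F)) * pv x \<eta> = 0" for x
        using lin_indepD[OF \<eta>(2) relation_gradient[OF S Suc.prems(2,3)] v]
        by (cases "pv x \<eta> = 0") auto
      from vanishing_mult[OF this \<eta>(1)] show "relation g (pdiff v F)" by simp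
    qed
    hence "vars F = {}" using pdiff_eq_0_imp[of _ F] Suc.prems(2) by blast
    thus ?case by (rule vars_empty_relation) (rule Suc.prems(3))
  qed
  thus ?thesis unfolding alg_indep_def by blast
qed

text \<open>Take a nonzero relation of least degree. It involves \<open>j\<close>, since
  \<open>S\<close> is independent, so its derivative by \<open>j\<close> is nonzero of smaller
  degree and cannot be a relation.\<close>

lemma algebraic_relation_nondegenerate:
  fixes g :: "'v \<Rightarrow> ('n::finite, 'a::field_char_0) mpoly"
  assumes "alg_indep g S" "\<not> alg_indep g (insert j S)"
  shows "\<exists>k F. homogeneous k F \<and> vars F \<subseteq> insert j S \<and> relation g F \<and>
    (\<exists>x. peval (\<lambda>v. pv x (g v)) (pdiff j F) \<noteq> 0)"
proof -
  define P where "P = (\<lambda>k. \<exists>F. homogeneous k F \<and> vars F \<subseteq> insert j S \<and> relation g F \<and> F \<noteq> 0)"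
  define k where "k = (LEAST k. P k)"
  have "\<exists>k. P k" using assms(2) unfolding alg_indep_def P_def by blast
  hence "P k" unfolding k_def by (rule LeastI_ex)
  then obtain F where F: "homogeneous k F" "vars F \<subseteq> insert j S" "relation g F" "F \<noteq> 0"
    unfolding P_def by blast
  have j: "j \<in> vars F" using assms(1) F unfolding alg_indep_def by blast
  have "k \<noteq> 0" using homogeneous_0_imp_vars_empty F(1) j by (metis empty_iff)
  hence "\<not> P (k - 1)" unfolding k_def by (intro not_less_Least) auto
  moreover have "homogeneous (k - 1) (pdiff j F)" using F(1) by (rule homogeneous_pdiff)
  moreover have "vars (pdiff j F) \<subseteq> insert j S" by (rule subset_trans[OF vars_pdiff F(2)])
  moreover have "pdiff j F \<noteq> 0" using pdiff_eq_0_imp[of j F] j by auto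
  ultimately have "\<not> relation g (pdiff j F)" unfolding P_def by metis
  hence "\<exists>x. peval (\<lambda>v. pv x (g v)) (pdiff j F) \<noteq> 0" by simp
  thus ?thesis using F(1-3) by metis
qed

text \<open>Variables are renamed along an injection in order to move a family into a sum type. The
  map \<open>r\<close> pulls exponent vectors back and loses nothing on \<open>F\<close>, whose
  variables lie in the range of \<open>h\<close>.\<close>

lemma alg_indep_image:
  fixes g :: "'w \<Rightarrow> ('n::finite, 'a::field) mpoly" and h :: "'v \<Rightarrow> 'w"
  assumes h: "inj h" and A: "alg_indep (\<lambda>v. g (h v)) S"
  shows "alg_indep g (h ` S)"
  unfolding alg_indep_def
proof (intro allI impI)
  fix k F assume F: "homogeneous k F" "vars F \<subseteq> h ` S" "relation g F"
  define r where "r = (Poly_Mapping.map_key h :: ('w \<Rightarrow>\<^sub>0 nat) \<Rightarrow> ('v \<Rightarrow>\<^sub>0 nat))"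
  have lr: "Poly_Mapping.lookup (r m) v = Poly_Mapping.lookup m (h v)" for m v
    by (simp add: r_def map_key.rep_eq[OF h])
  have km: "Poly_Mapping.keys m = h ` Poly_Mapping.keys (r m)" if "m \<in> Poly_Mapping.keys F" for m
  proof -
    have iff: "v \<in> Poly_Mapping.keys (r m) \<longleftrightarrow> h v \<in> Poly_Mapping.keys m" for v
      by (simp add: in_keys_iff lr)
    show ?thesis
    proof (intro subset_antisym subsetI)
      fix w assume w: "w \<in> Poly_Mapping.keys m"
      hence "w \<in> vars F" using that by (auto simp: vars_def)
      then obtain v where "w = h v" using F(2) by auto
      thus "w \<in> h ` Poly_Mapping.keys (r m)" using w iff by simp
    next
      fix w assume "w \<in> h ` Poly_Mapping.keys (r m)"
      thus "w \<in> Poly_Mapping.keys m" using iff by auto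
    qed
  qed
  have inj: "inj_on r (Poly_Mapping.keys F)"
  proof (rule inj_onI, rule poly_mapping_eqI)
    fix m m' w assume m: "m \<in> Poly_Mapping.keys F" "m' \<in> Poly_Mapping.keys F" "r m = r m'"
    show "Poly_Mapping.lookup m w = Poly_Mapping.lookup m' w"
    proof (cases "w \<in> range h")
      case True
      thus ?thesis using lr m(3) by (metis imageE)
    next
      case False
      hence "w \<notin> Poly_Mapping.keys m" "w \<notin> Poly_Mapping.keys m'"
        using km[OF m(1)] km[OF m(2)] by auto
      thus ?thesis by (simp add: in_keys_iff)
    qed
  qed
  define F' where "F' = (\<Sum>m\<in>Poly_Mapping.keys F. Poly_Mapping.single (r m) (Poly_Mapping.lookup F m))"
  have lF: "Poly_Mapping.lookup F' (r m) = Poly_Mapping.lookup F m" if m: "m \<in> Poly_Mapping.keys F" for m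
  proof -
    have "Poly_Mapping.lookup F' (r m) = (\<Sum>m'\<in>Poly_Mapping.keys F. Poly_Mapping.lookup F m' when m' = m)"
      unfolding F'_def lookup_sum lookup_single
      by (rule sum.cong) (use inj m in \<open>auto simp: when_def inj_on_def\<close>)
    thus ?thesis using m by (simp add: when_def)
  qed
  have "mdeg (r m) = mdeg m" if "m \<in> Poly_Mapping.keys F" for m
    unfolding mdeg_def km[OF that]
    by (subst sum.reindex) (use h in \<open>auto simp: lr intro: inj_on_subset\<close>)
  hence "homogeneous k F'"
    unfolding F'_def using F(1) by (intro homogeneous_sum) (auto simp: homogeneous_iff_mdeg)
  moreover have "vars F' \<subseteq> S"
  proof -
    have "Poly_Mapping.keys (r m) \<subseteq> S" if "m \<in> Poly_Mapping.keys F" for m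
    proof
      fix v assume "v \<in> Poly_Mapping.keys (r m)"
      hence "h v \<in> Poly_Mapping.keys m" by (simp add: in_keys_iff lr)
      hence "h v \<in> h ` S" using F(2) that by (auto simp: vars_def)
      thus "v \<in> S" using h by (auto dest: injD)
    qed
    thus ?thesis using vars_sum_single[of r "Poly_Mapping.lookup F" "Poly_Mapping.keys F"]
      unfolding F'_def by blast
  qed
  moreover have pe: "peval (\<lambda>v. V (h v)) F' = peval V F" for V :: "'w \<Rightarrow> 'a"
  proof -
    have "pmon (\<lambda>v. V (h v)) (r m) = pmon V m" if "m \<in> Poly_Mapping.keys F" for m
      unfolding pmon_def km[OF that]
      by (subst prod.reindex) (use h in \<open>auto simp: lr intro: inj_on_subset\<close>)
    thus ?thesis by (simp add: F'_def) (simp add: peval_eq_aeval aeval_def)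
  qed
  have "relation (\<lambda>v. g (h v)) F'"
    using pe[of "\<lambda>w. pv _ (g w)"] F(3) by simp
  ultimately have "F' = 0" using A unfolding alg_indep_def by blast
  hence "Poly_Mapping.keys F = {}" using lF by (metis equals0I in_keys_iff lookup_zero)
  thus "F = 0" by simp
qed

lemma X_power: "X i ^ D = Poly_Mapping.single (Poly_Mapping.single i D) 1"
  by (induction D) (simp_all add: X_def mult_single flip: single_add)

lemma pdiff_single:
  "pdiff j (Poly_Mapping.single m c) =
    Poly_Mapping.single (m - Poly_Mapping.single j 1) (of_nat (Poly_Mapping.lookup m j) * c)"
  by (cases "c = 0") (auto simp: pdiff_def)

lemma gradient_X_power:
  "gradient_at (X i ^ D :: ('n::finite, 'a::field) mpoly) p = (of_nat D * (p $ i) ^ (D - 1)) *s axis i 1"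
proof -
  have "pv p (pdiff j (X i ^ D)) = of_nat D * (p $ i) ^ (D - 1) * (if j = i then 1 else 0)" for j
  proof (cases "j = i")
    case True
    thus ?thesis by (simp add: X_power pdiff_single flip: single_diff)
  qed (simp add: X_power pdiff_single lookup_single)
  thus ?thesis by (auto simp: gradient_at_def cart_eq_iff axis_def)
qed

lemma span_axes: "vec.span (Set.range (\<lambda>i. axis i (1::'a::field))) = (UNIV :: ('a ^ 'n) set)"
  using vec.span_Basis unfolding cart_basis_def by (simp add: full_SetCompr_eq)

text \<open>Enlarge the family by powers \<open>X i ^ D\<close> to a maximal algebraically independent set \<open>M\<close>, which has
  at most \<open>n\<close> elements. Differentiating the relations between \<open>M\<close> and the remaining \<open>X i ^ D\<close>
  shows that the gradients of \<open>M\<close> span at a general point, so they form a basis there. The power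
  \<open>D\<close> keeps the enlarged family equidegree.\<close>

theorem alg_indep_imp_lin_indep:
  fixes g :: "'v \<Rightarrow> ('n::finite, 'a::field_char_0) mpoly"
  assumes S: "finite S" and hom: "\<And>v. v \<in> S \<Longrightarrow> homogeneous D (g v)" and D: "D > 0"
    and A: "alg_indep g S"
  shows "\<exists>p. lin_indep (\<lambda>v. gradient_at (g v) p) S"
proof -
  define h where "h = case_sum g (\<lambda>i. X i ^ D)"
  define T where "T = (Inl ` S \<union> Set.range Inr :: ('v + 'n) set)"
  have fT: "finite T" unfolding T_def using S by simp
  have homh: "homogeneous D (h w)" if "w \<in> T" for w
    using that hom homogeneous_power[OF homogeneous_X, of D] by (auto simp: h_def T_def)
  define \<M> where "\<M> = {M. Inl ` S \<subseteq> M \<and> M \<subseteq> T \<and> alg_indep h M}"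
  have "finite \<M>" unfolding \<M>_def using fT by simp
  moreover have "Inl ` S \<in> \<M>"
    using alg_indep_image[of Inl h S] A by (auto simp: \<M>_def T_def h_def)
  ultimately obtain M where M: "M \<in> \<M>" and max: "\<And>M'. M' \<in> \<M> \<Longrightarrow> M \<subseteq> M' \<Longrightarrow> M = M'"
    using finite_has_maximal2 by metis
  have fM: "finite M" using M fT by (auto simp: \<M>_def intro: finite_subset)
  have cM: "card M \<le> CARD('n)"
    using many_forms_dependent[of M D h] homh D fM M unfolding \<M>_def by force
  have dep: "\<not> alg_indep h (insert (Inr i) M)" if "Inr i \<notin> M" for i
    using max[of "insert (Inr i) M"] that M by (auto simp: \<M>_def T_def)
  have "\<exists>F. vars F \<subseteq> insert (Inr i) M \<and> relation h F \<and>
      (\<exists>x. peval (\<lambda>v. pv x (h v)) (pdiff (Inr i) F) \<noteq> 0)" if "Inr i \<notin> M" for i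
    using algebraic_relation_nondegenerate[OF _ dep[OF that]] M unfolding \<M>_def by blast
  then obtain F where F: "\<And>i. Inr i \<notin> M \<Longrightarrow> vars (F i) \<subseteq> insert (Inr i) M"
    "\<And>i. Inr i \<notin> M \<Longrightarrow> relation h (F i)"
    "\<And>i. Inr i \<notin> M \<Longrightarrow> \<exists>x. peval (\<lambda>v. pv x (h v)) (pdiff (Inr i) (F i)) \<noteq> 0" by metis
  \<comment> \<open>The coordinates of \<open>p\<close> are required to be nonzero because the
    gradient of \<open>X i ^ D\<close> at \<open>p\<close> is
    \<open>of_nat D * (p $ i) ^ (D - 1)\<close> times an axis.\<close>
  define A where "A = (\<lambda>i. psubst h (pdiff (Inr i) (F i))) ` {i. Inr i \<notin> M} \<union> Set.range X"
  have "\<exists>p. \<forall>G\<in>A. pv p G \<noteq> 0"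
  proof (rule nonvanishing_common)
    fix G assume "G \<in> A"
    moreover have "\<exists>x. pv x (X i) \<noteq> (0::'a)" for i :: 'n by (rule exI[of _ "\<chi> i. 1"]) simp
    ultimately show "\<exists>x. pv x G \<noteq> 0" using F(3) by (auto simp: A_def simp del: peval_X)
  qed (simp add: A_def)
  then obtain p where p: "\<And>G. G \<in> A \<Longrightarrow> pv p G \<noteq> 0" by blast
  have pX: "p $ i \<noteq> 0" for i using p[of "X i"] by (simp add: A_def)
  define w where "w = (\<lambda>v. gradient_at (h v) p)"
  have wr: "w (Inr i) \<in> vec.span (w ` M)" for i
  proof (cases "Inr i \<in> M")
    case True
    thus ?thesis by (intro vec.span_base) auto
  next
    case False
    define c where "c = (\<lambda>v. peval (\<lambda>v. pv p (h v)) (pdiff v (F i)))"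
    have "psubst h (pdiff (Inr i) (F i)) \<in> A" using False by (auto simp: A_def)
    from p[OF this] have c0: "c (Inr i) \<noteq> 0" by (simp add: c_def)
    have "(\<Sum>v\<in>insert (Inr i) M. c v *s w v) = 0"
      unfolding c_def w_def by (rule relation_gradient) (use fM F False in auto)
    hence "c (Inr i) *s w (Inr i) = - (\<Sum>v\<in>M. c v *s w v)"
      using False fM by (simp add: eq_neg_iff_add_eq_0)
    also have "\<dots> \<in> vec.span (w ` M)" by (intro vec.span_neg combination_in_span)
    finally have "inverse (c (Inr i)) *s (c (Inr i) *s w (Inr i)) \<in> vec.span (w ` M)"
      by (rule vec.span_scale)
    thus ?thesis using c0 by (simp add: vec.scale_scale)
  qed
  have "axis i 1 \<in> vec.span (w ` M)" for i
  proof -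
    define b where "b = of_nat D * (p $ i) ^ (D - 1)"
    have b: "b \<noteq> 0" using D pX by (simp add: b_def)
    have "w (Inr i) = b *s axis i 1" by (simp add: w_def h_def gradient_X_power b_def)
    hence "inverse b *s (b *s axis i 1) \<in> vec.span (w ` M)"
      using vec.span_scale[OF wr[of i], of "inverse b"] by simp
    thus ?thesis using b by (simp add: vec.scale_scale)
  qed
  hence "vec.span (Set.range (\<lambda>i. axis i 1)) \<subseteq> vec.span (w ` M)"
    by (intro vec.span_minimal) auto
  hence "vec.span (w ` M) = UNIV" unfolding span_axes by blast
  hence d: "vec.dim (w ` M) = CARD('n)" by (metis vec.dim_span vec_dim_card)
  have "vec.dim (w ` M) \<le> card (w ` M)"
    by (rule vec.dim_le_card) (use fM vec.span_superset[of "w ` M"] in auto)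
  also have "\<dots> \<le> card M" using fM by (rule card_image_le)
  finally have "lin_indep w M" using d cM fM by (simp add: lin_indep_iff_dim)
  hence "lin_indep w (Inl ` S)" by (rule lin_indep_mono) (use M fM in \<open>auto simp: \<M>_def\<close>)
  hence "lin_indep (\<lambda>v. w (Inl v)) S"
    using lin_indep_reindex[of Inl S "Inl ` S" w] by (simp add: inj_on_imp_bij_betw)
  thus ?thesis by (auto simp: w_def h_def)
qed

text \<open>The rank of the Jacobian at \<open>p\<close>. The index type may be infinite, as for
  Pluecker coordinates indexed by lists; the number of variables still bounds the rank.\<close>

definition grank :: "('v \<Rightarrow> ('n::finite, 'a::field) mpoly) \<Rightarrow> 'a ^ 'n \<Rightarrow> nat" where
  "grank g p = vec.dim (Set.range (\<lambda>v. gradient_at (g v) p))"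

lemma grank_le: "grank (g :: 'v \<Rightarrow> ('n::finite, 'a::field) mpoly) p \<le> CARD('n)"
  unfolding grank_def by (metis vec.dim_subset_UNIV vec.dim_UNIV vec.dimension_def vec_dim_card)

lemma independent_gradients_exist:
  fixes g :: "'v \<Rightarrow> ('n::finite, 'a::field) mpoly"
  shows "\<exists>S. finite S \<and> card S = grank g p \<and> lin_indep (\<lambda>v. gradient_at (g v) p) S"
proof -
  define w where "w = (\<lambda>v. gradient_at (g v) p)"
  obtain B where B: "B \<subseteq> Set.range w" "vec.independent B" "card B = vec.dim (Set.range w)"
    using vec.basis_exists by metis
  have fB: "finite B" using B(2) vec.finiteI_independent by blast
  define s where "s = inv_into UNIV w"
  have ws: "w (s b) = b" if "b \<in> B" for b using B(1) that by (auto simp: s_def f_inv_into_f)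
  have inj: "inj_on s B" using ws by (metis inj_onI)
  have "w ` s ` B = B" using ws by (force simp: image_image)
  hence "vec.dim (w ` s ` B) = card (s ` B)"
    using B(2) inj by (simp add: card_image vec.dim_eq_card_independent)
  hence "lin_indep w (s ` B)" using fB by (simp add: lin_indep_iff_dim)
  moreover have "card (s ` B) = grank g p" using inj B(3) by (simp add: card_image grank_def w_def)
  ultimately show ?thesis using fB unfolding w_def by blast
qed

lemma lin_indep_card_le_grank:
  assumes "finite S" "lin_indep (\<lambda>v. gradient_at (g v) p) S"
  shows "card S \<le> grank g p"
proof -
  have "card S = vec.dim ((\<lambda>v. gradient_at (g v) p) ` S)" using assms by (simp add: lin_indep_iff_dim)
  also have "\<dots> \<le> grank g p" unfolding grank_def by (rule vec.dim_subset) auto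
  finally show ?thesis .
qed

lemma grank_open:
  fixes g :: "'v \<Rightarrow> ('n::finite, 'a::field_char_0) mpoly"
  assumes "\<And>v. homogeneous D (g v)"
  shows "\<exists>\<eta> e. homogeneous e \<eta> \<and> pv p \<eta> \<noteq> 0 \<and> (\<forall>x. pv x \<eta> \<noteq> 0 \<longrightarrow> grank g p \<le> grank g x)"
proof -
  obtain S where S: "finite S" "card S = grank g p" "lin_indep (\<lambda>v. gradient_at (g v) p) S"
    using independent_gradients_exist by blast
  from gradient_lin_indep_open[OF S(1) assms S(3)] obtain \<eta> e where
    "homogeneous e \<eta>" "pv p \<eta> \<noteq> 0" "\<And>x. pv x \<eta> \<noteq> 0 \<Longrightarrow> lin_indep (\<lambda>v. gradient_at (g v) x) S"
    by blast
  thus ?thesis using S lin_indep_card_le_grank by metis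
qed

section \<open>The Zariski topology and Krull dimension\<close>

text \<open>The common frame of projective space and of the Grassmannian in Pluecker coordinates.
  Proportionality of the vectors in \<open>c x\<close> makes the vanishing of a form at
  \<open>x\<close> meaningful; \<open>c x\<close> need not contain all multiples of its
  vectors.\<close>

locale cone_space =
  fixes P :: "'x set" and c :: "'x \<Rightarrow> ('v \<Rightarrow> 'a::field_char_0) set"
  assumes nonempty: "x \<in> P \<Longrightarrow> \<exists>v. v \<in> c x"
    and proportional: "x \<in> P \<Longrightarrow> v \<in> c x \<Longrightarrow> w \<in> c x \<Longrightarrow> \<exists>l. l \<noteq> 0 \<and> w = (\<lambda>i. l * v i)"
    and nonzero: "x \<in> P \<Longrightarrow> v \<in> c x \<Longrightarrow> \<exists>i. v i \<noteq> 0"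
begin

text \<open>With the existential quantifier, \<open>vanish F\<close> is the exact complement of
  \<open>D F\<close> inside \<open>P\<close> for every polynomial; for forms any vector of
  \<open>c x\<close> may be used.\<close>

definition vanish :: "('v, 'a) mpoly \<Rightarrow> 'x \<Rightarrow> bool" where
  "vanish F x \<longleftrightarrow> (\<exists>v\<in>c x. peval v F = 0)"

lemma vanish_iff:
  assumes "homogeneous d F" "x \<in> P" "v \<in> c x" "l \<noteq> 0"
  shows "vanish F x \<longleftrightarrow> peval (\<lambda>i. l * v i) F = 0"
proof -
  have "peval v F = 0" if w: "w \<in> c x" "peval w F = 0" for w
  proof -
    from proportional[OF assms(2,3) w(1)] obtain l where "l \<noteq> 0" "w = (\<lambda>i. l * v i)"
      by blast
    thus ?thesis using peval_scale[OF assms(1), of l v] w(2) by simp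
  qed
  hence "vanish F x \<longleftrightarrow> peval v F = 0" using assms(3) unfolding vanish_def by blast
  thus ?thesis using assms(4) peval_scale[OF assms(1), of l v] by simp
qed

lemma vanish_iff1:
  "homogeneous d F \<Longrightarrow> x \<in> P \<Longrightarrow> v \<in> c x \<Longrightarrow> vanish F x \<longleftrightarrow> peval v F = 0"
  using vanish_iff[of d F x v 1] by simp

lemma vanish_mult:
  assumes "homogeneous d F" "homogeneous e G" "x \<in> P"
  shows "vanish (F * G) x \<longleftrightarrow> vanish F x \<or> vanish G x"
proof -
  obtain v where v: "v \<in> c x" using nonempty[OF assms(3)] by blast
  show ?thesis
    using vanish_iff1[OF homogeneous_mult[OF assms(1,2)] assms(3) v]
      vanish_iff1[OF assms(1,3) v] vanish_iff1[OF assms(2,3) v] by simp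
qed

abbreviation T :: "'x topology" where "T \<equiv> zariski P c"

definition D :: "('v, 'a) mpoly \<Rightarrow> 'x set" where
  "D F = {x \<in> P. \<forall>v\<in>c x. peval v F \<noteq> 0}"

lemma zariski_eq: "T = topology_generated_by {D F |F d. homogeneous d F}"
  by (simp add: zariski_def D_def)

lemma in_D: "x \<in> D F \<longleftrightarrow> x \<in> P \<and> \<not> vanish F x"
  by (auto simp: D_def vanish_def)

text \<open>Since \<open>D (F * G) = D F \<inter> D G\<close> for forms, the generating sets are a
  basis and not only a subbasis.\<close>

lemma openin_zariski:
  "openin T U \<longleftrightarrow> (\<forall>x\<in>U. \<exists>F d. homogeneous d F \<and> x \<in> D F \<and> D F \<subseteq> U)"
proof
  assume "openin T U"
  hence "generate_topology_on {D F |F d. homogeneous d F} U"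
    unfolding zariski_eq by (simp add: openin_topology_generated_by_iff)
  thus "\<forall>x\<in>U. \<exists>F d. homogeneous d F \<and> x \<in> D F \<and> D F \<subseteq> U"
  proof (induction rule: generate_topology_on.induct)
    case (Int a b)
    show ?case
    proof
      fix x assume x: "x \<in> a \<inter> b"
      then obtain F d G e where F: "homogeneous d F" "x \<in> D F" "D F \<subseteq> a"
        and G: "homogeneous e G" "x \<in> D G" "D G \<subseteq> b" using Int.IH by (meson IntD1 IntD2)
      have "D (F * G) = D F \<inter> D G" by (auto simp: in_D vanish_mult[OF F(1) G(1)])
      thus "\<exists>F d. homogeneous d F \<and> x \<in> D F \<and> D F \<subseteq> a \<inter> b"
        using F G homogeneous_mult[OF F(1) G(1)] by blast
    qed
  next
    case (UN K)
    thus ?case by (meson Union_iff Union_upper subset_trans)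
  qed blast+
next
  assume R: "\<forall>x\<in>U. \<exists>F d. homogeneous d F \<and> x \<in> D F \<and> D F \<subseteq> U"
  have "openin T (D F)" if "homogeneous d F" for F d
    unfolding zariski_eq by (rule topology_generated_by_Basis) (use that in blast)
  thus "openin T U" using R openin_subopen[of T U] by meson
qed

lemma topspace_zariski: "topspace T = P"
proof -
  have "D 1 = P" by (auto simp: D_def)
  hence "P \<subseteq> \<Union>{D F |F d. homogeneous d F}" using homogeneous_one by blast
  moreover have "\<Union>{D F |F d. homogeneous d F} \<subseteq> P" by (auto simp: D_def)
  ultimately show ?thesis unfolding zariski_eq by simp
qed

lemma closedin_zariski:
  "closedin T C \<longleftrightarrow> C \<subseteq> P \<and>
     (\<forall>x\<in>P - C. \<exists>F d. homogeneous d F \<and> (\<forall>y\<in>C. vanish F y) \<and> \<not> vanish F x)"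
proof -
  have "D F \<subseteq> P - C \<longleftrightarrow> (\<forall>y\<in>C. vanish F y)" if "C \<subseteq> P" for F
    using that in_D[of _ F] by blast
  thus ?thesis unfolding closedin_def topspace_zariski openin_zariski
    by (auto simp: in_D) blast+
qed

lemma in_closure_zariski:
  assumes "A \<subseteq> P"
  shows "x \<in> T closure_of A \<longleftrightarrow> x \<in> P \<and> (\<forall>F d. homogeneous d F \<longrightarrow> (\<forall>y\<in>A. vanish F y) \<longrightarrow> vanish F x)"
proof
  assume x: "x \<in> T closure_of A"
  have "vanish F x" if "homogeneous d F" "\<forall>y\<in>A. vanish F y" for F d
  proof (rule ccontr)
    assume "\<not> vanish F x"
    moreover have "x \<in> P" using x by (auto simp: in_closure_of topspace_zariski)
    ultimately have "x \<in> D F" by (simp add: in_D)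
    moreover have "openin T (D F)" using that(1) by (auto simp: openin_zariski)
    ultimately have "\<exists>y. y \<in> A \<and> y \<in> D F" using x unfolding in_closure_of by blast
    thus False using that(2) by (auto simp: in_D)
  qed
  thus "x \<in> P \<and> (\<forall>F d. homogeneous d F \<longrightarrow> (\<forall>y\<in>A. vanish F y) \<longrightarrow> vanish F x)"
    using x by (auto simp: in_closure_of topspace_zariski)
next
  assume R: "x \<in> P \<and> (\<forall>F d. homogeneous d F \<longrightarrow> (\<forall>y\<in>A. vanish F y) \<longrightarrow> vanish F x)"
  have "\<exists>y. y \<in> A \<and> y \<in> U" if U: "x \<in> U" "openin T U" for U
  proof -
    obtain F d where F: "homogeneous d F" "x \<in> D F" "D F \<subseteq> U" using U openin_zariski by blast
    hence "\<not> (\<forall>y\<in>A. vanish F y)" using R by (auto simp: in_D)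
    thus ?thesis using F(3) assms by (auto simp: in_D subset_iff)
  qed
  thus "x \<in> T closure_of A" using R by (auto simp: in_closure_of topspace_zariski)
qed

lemma closedin_zero_locus: "homogeneous d F \<Longrightarrow> closedin T {x \<in> P. vanish F x}"
  unfolding closedin_zariski by auto

lemma irreducible_vanish_mult:
  assumes "irreducible_in T C" "homogeneous d F" "homogeneous e G" "\<And>x. x \<in> C \<Longrightarrow> vanish (F * G) x"
  shows "(\<forall>x\<in>C. vanish F x) \<or> (\<forall>x\<in>C. vanish G x)"
proof -
  have C: "C \<subseteq> P" using assms(1) by (simp add: irreducible_in_def topspace_zariski)
  have "C \<subseteq> {x \<in> P. vanish F x} \<union> {x \<in> P. vanish G x}"
    using C assms(4) vanish_mult[OF assms(2,3)] by blast
  hence "C \<subseteq> {x \<in> P. vanish F x} \<or> C \<subseteq> {x \<in> P. vanish G x}"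
    using assms(1) closedin_zero_locus[OF assms(2)] closedin_zero_locus[OF assms(3)]
    unfolding irreducible_in_def by blast
  thus ?thesis by blast
qed

text \<open>Primeness of the homogeneous ideal suffices: two closed sets that each miss a point of
  \<open>C\<close> are separated from these points by forms, and the product of the forms vanishes
  on \<open>C\<close> if the two sets cover it.\<close>

lemma irreducibleI:
  assumes "C \<subseteq> P" "C \<noteq> {}"
    and "\<And>d F e G. homogeneous d F \<Longrightarrow> homogeneous e G \<Longrightarrow> \<forall>x\<in>C. vanish (F * G) x \<Longrightarrow>
      (\<forall>x\<in>C. vanish F x) \<or> (\<forall>x\<in>C. vanish G x)"
  shows "irreducible_in T C"
  unfolding irreducible_in_def topspace_zariski
proof (intro conjI allI impI assms(1,2))
  fix A B assume AB: "closedin T A" "closedin T B" "C \<subseteq> A \<union> B"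
  show "C \<subseteq> A \<or> C \<subseteq> B"
  proof (rule ccontr)
    assume "\<not> (C \<subseteq> A \<or> C \<subseteq> B)"
    then obtain x y where x: "x \<in> C" "x \<notin> A" and y: "y \<in> C" "y \<notin> B" by blast
    obtain F d where F: "homogeneous d F" "\<forall>z\<in>A. vanish F z" "\<not> vanish F x"
      using AB(1) x assms(1) unfolding closedin_zariski by blast
    obtain G e where G: "homogeneous e G" "\<forall>z\<in>B. vanish G z" "\<not> vanish G y"
      using AB(2) y assms(1) unfolding closedin_zariski by blast
    have "\<forall>z\<in>C. vanish (F * G) z"
      using vanish_mult[OF F(1) G(1)] F(2) G(2) AB(3) assms(1) by blast
    from assms(3)[OF F(1) G(1) this] show False using F(3) G(3) x y by blast
  qed
qed

text \<open>An ideal-theoretic way to say that \<open>C\<close> is the closure of the image of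
  \<open>g\<close>. No individual parameters are mentioned, so those at which \<open>g\<close> gives
  no point of the space cause no trouble.\<close>

definition parametrized :: "'x set \<Rightarrow> ('v \<Rightarrow> ('n::finite, 'a) mpoly) \<Rightarrow> bool" where
  "parametrized C g \<longleftrightarrow> closedin T C \<and>
     (\<forall>d F. homogeneous d F \<longrightarrow> ((\<forall>x\<in>C. vanish F x) \<longleftrightarrow> relation g F))"

definition locus :: "('v \<Rightarrow> ('n::finite, 'a) mpoly) \<Rightarrow> 'x set" where
  "locus g = {x \<in> P. \<forall>d F. homogeneous d F \<longrightarrow> relation g F \<longrightarrow> vanish F x}"

text \<open>The scalar \<open>l\<close> leaves room for a common factor, such as the extra
  coordinate in the Pluecker family \<open>gw\<close>.\<close>

definition realized :: "('v \<Rightarrow> ('n::finite, 'a) mpoly) \<Rightarrow> 'a ^ 'n \<Rightarrow> bool" where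
  "realized g x \<longleftrightarrow> (\<exists>y\<in>P. \<exists>v\<in>c y. \<exists>l. l \<noteq> 0 \<and> (\<lambda>i. pv x (g i)) = (\<lambda>i. l * v i))"

lemma parametrized_imp_locus:
  assumes "parametrized C g"
  shows "C = locus g"
proof
  show "C \<subseteq> locus g"
    using assms unfolding parametrized_def locus_def closedin_zariski by blast
  show "locus g \<subseteq> C"
    using assms unfolding parametrized_def locus_def closedin_zariski by blast
qed

text \<open>Parameters with \<open>\<delta>\<close> nonzero give points of \<open>locus g\<close>,
  so a form vanishing on the locus pulls back to zero on a dense set of parameters.\<close>

lemma parametrized_locus:
  fixes g :: "'v \<Rightarrow> ('n::finite, 'a) mpoly"
  assumes r: "\<And>x. pv x \<delta> \<noteq> 0 \<Longrightarrow> realized g x" and p: "pv p \<delta> \<noteq> 0"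
  shows "parametrized (locus g) g"
  unfolding parametrized_def
proof (intro conjI allI impI)
  show "closedin T (locus g)"
    unfolding closedin_zariski locus_def by blast
  fix d and F :: "('v, 'a) mpoly" assume F: "homogeneous d F"
  show "(\<forall>x\<in>locus g. vanish F x) \<longleftrightarrow> relation g F"
  proof
    assume L: "\<forall>x\<in>locus g. vanish F x"
    have "pv x (psubst g F) * pv x \<delta> = 0" for x
    proof (cases "pv x \<delta> = 0")
      case False
      obtain y v l where y: "y \<in> P" "v \<in> c y" "l \<noteq> 0" "(\<lambda>i. pv x (g i)) = (\<lambda>i. l * v i)"
        using r[OF False] unfolding realized_def by blast
      have e: "vanish G y \<longleftrightarrow> peval (\<lambda>i. pv x (g i)) G = 0" if "homogeneous e G" for e G
        using vanish_iff[OF that y(1-3)] y(4) by simp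
      have "y \<in> locus g" using y(1) e by (auto simp: locus_def)
      hence "vanish F y" using L by blast
      thus ?thesis using e[OF F] by simp
    qed simp
    from vanishing_mult[OF this p] show "relation g F" by simp
  qed (use F in \<open>auto simp: locus_def\<close>)
qed

lemma parametrized_irreducible:
  fixes g :: "'v \<Rightarrow> ('n::finite, 'a) mpoly"
  assumes "parametrized C g"
  shows "irreducible_in T C"
proof (rule irreducibleI)
  show "C \<subseteq> P" using assms by (simp add: parametrized_def closedin_zariski)
  have one: "\<not> relation g 1" by simp
  show "C \<noteq> {}" using assms one homogeneous_one unfolding parametrized_def by blast
  fix d F e G
  assume FG: "homogeneous d F" "homogeneous e G" "\<forall>x\<in>C. vanish (F * G) x"
  have R: "(\<forall>x\<in>C. vanish H x) \<longleftrightarrow> relation g H" if "homogeneous k H" for k H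
    using assms that unfolding parametrized_def by blast
  have "relation g (F * G)" using R homogeneous_mult[OF FG(1,2)] FG(3) by blast
  hence z: "pv x (psubst g F) * pv x (psubst g G) = 0" for x by simp
  show "(\<forall>x\<in>C. vanish F x) \<or> (\<forall>x\<in>C. vanish G x)"
  proof (cases "relation g G")
    case False
    then obtain y where "pv y (psubst g G) \<noteq> 0" by auto
    from vanishing_mult[OF z this] have "relation g F" by simp
    thus ?thesis using R FG(1) by blast
  qed (use R FG(2) in blast)
qed

end

section \<open>Upper bound for chains of irreducible closed sets\<close>

lemma split_variable:
  fixes P :: "('v, 'a::comm_ring_1) mpoly"
  assumes "homogeneous k P"
  shows "\<exists>P0 P1. P = P0 + X j * P1 \<and> homogeneous k P0 \<and> vars P0 \<subseteq> vars P - {j} \<and>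
    homogeneous (k - 1) P1 \<and> vars P1 \<subseteq> vars P"
proof -
  let ?e = "Poly_Mapping.single j (1::nat)"
  define A where "A = {m \<in> Poly_Mapping.keys P. Poly_Mapping.lookup m j = 0}"
  define B where "B = {m \<in> Poly_Mapping.keys P. Poly_Mapping.lookup m j \<noteq> 0}"
  define P0 where "P0 = (\<Sum>m\<in>A. Poly_Mapping.single m (Poly_Mapping.lookup P m))"
  define P1 where "P1 = (\<Sum>m\<in>B. Poly_Mapping.single (m - ?e) (Poly_Mapping.lookup P m))"
  have Be: "?e + (m - ?e) = m" if "m \<in> B" for m
    using that by (intro poly_mapping_eqI) (auto simp: B_def lookup_add lookup_minus lookup_single when_def)
  have "P = (\<Sum>m\<in>A \<union> B. Poly_Mapping.single m (Poly_Mapping.lookup P m))"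
    by (subst mpoly_sum_monomials, rule sum.cong) (auto simp: A_def B_def)
  also have "\<dots> = P0 + (\<Sum>m\<in>B. Poly_Mapping.single m (Poly_Mapping.lookup P m))"
    unfolding P0_def by (rule sum.union_disjoint) (auto simp: A_def B_def)
  also have "(\<Sum>m\<in>B. Poly_Mapping.single m (Poly_Mapping.lookup P m)) = X j * P1"
    unfolding P1_def sum_distrib_left X_def mult_single
    by (rule sum.cong) (auto simp: Be[simplified])
  finally have "P = P0 + X j * P1" .
  moreover have "homogeneous k P0"
    unfolding P0_def by (rule homogeneous_sum) (use assms in \<open>auto simp: A_def homogeneous_iff_mdeg\<close>)
  moreover have "vars P0 \<subseteq> vars P - {j}"
  proof
    fix v assume "v \<in> vars P0"
    then obtain m where m: "m \<in> A" "v \<in> Poly_Mapping.keys m"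
      using vars_sum_single[of "\<lambda>m. m" "Poly_Mapping.lookup P" A] unfolding P0_def by auto
    hence "v \<in> vars P" "v \<noteq> j" by (auto simp: A_def vars_def)
    thus "v \<in> vars P - {j}" by simp
  qed
  moreover have "homogeneous (k - 1) P1"
    unfolding P1_def
  proof (rule homogeneous_sum)
    fix m assume m: "m \<in> B"
    have "mdeg m = k" using m assms by (auto simp: B_def homogeneous_iff_mdeg)
    moreover have "mdeg m = 1 + mdeg (m - ?e)" using Be[OF m] mdeg_add[of ?e "m - ?e"] by simp
    ultimately have "mdeg (m - ?e) = k - 1" by linarith
    thus "homogeneous (k - 1) (Poly_Mapping.single (m - ?e) (Poly_Mapping.lookup P m))"
      unfolding homogeneous_single by blast
  qed
  moreover have "vars P1 \<subseteq> vars P"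
  proof
    fix v assume "v \<in> vars P1"
    then obtain m where m: "m \<in> B" "v \<in> Poly_Mapping.keys (m - ?e)"
      using vars_sum_single[of "\<lambda>m. m - ?e" "Poly_Mapping.lookup P" B] unfolding P1_def by auto
    have "v \<in> Poly_Mapping.keys m" using m(2) by (auto simp: in_keys_iff lookup_minus)
    thus "v \<in> vars P" using m(1) by (auto simp: B_def vars_def)
  qed
  ultimately show ?thesis by blast
qed

context cone_space
begin

text \<open>Writing \<open>Q = Q0 + X j * Q1\<close> with \<open>j\<close> not in \<open>Q0\<close>, restriction to the previous set of the chain
  kills \<open>Q0\<close>, and irreducibility then lets one cancel \<open>H j\<close>. By truncated subtraction, \<open>Cs (j - 1)\<close>
  is \<open>Cs 0\<close> for \<open>j = 0\<close> as well.\<close>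

lemma chain_independent:
  assumes irr: "\<And>i. i \<le> n \<Longrightarrow> irreducible_in T (Cs i)"
    and mono: "\<And>i. i < n \<Longrightarrow> Cs i \<subseteq> Cs (Suc i)"
    and H: "\<And>i. i \<le> n \<Longrightarrow> homogeneous d (H i)"
    and nv: "\<And>i. i \<le> n \<Longrightarrow> \<exists>x\<in>Cs i. \<not> vanish (H i) x"
    and v: "\<And>i x. i < n \<Longrightarrow> x \<in> Cs i \<Longrightarrow> vanish (H (Suc i)) x"
    and j: "j \<le> Suc n"
    and Q: "homogeneous k Q" "vars Q \<subseteq> {..<j}"
      "\<And>x. x \<in> Cs (j - 1) \<Longrightarrow> vanish (psubst H Q) x"
  shows "Q = 0"
  using j Q
proof (induction j arbitrary: k Q)
  case 0
  have C0: "Cs 0 \<subseteq> P" "Cs 0 \<noteq> {}" using irr[of 0] by (auto simp: irreducible_in_def topspace_zariski)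
  then obtain x where x: "x \<in> Cs 0" "x \<in> P" by blast
  have "vars Q = {}" using 0(3) by simp
  hence Q: "Q = Poly_Mapping.single 0 (Poly_Mapping.lookup Q 0)" by (rule vars_empty_imp_const)
  have "vanish (psubst H Q) x" using 0(4) x by simp
  then obtain v where "peval (\<lambda>i. peval v (H i)) Q = 0" unfolding vanish_def by auto
  hence "Poly_Mapping.lookup Q 0 = 0" by (subst (asm) Q) simp
  thus ?case using Q by simp
next
  case (Suc j)
  have jn: "j \<le> n" using Suc.prems(1) by simp
  have hs: "homogeneous (d * l) (psubst H R)" if "homogeneous l R" "vars R \<subseteq> {..<Suc j}" for l R
    by (rule homogeneous_psubst[OF that(1)]) (use that(2) H jn in force)
  show ?case
    using Suc.prems(2-4)
  \<comment> \<open>\<open>Q1\<close> may still contain \<open>X j\<close>, so it is treated by an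
    inner induction on the degree, while \<open>Q0\<close> falls under the outer one.\<close>
  proof (induction k arbitrary: Q)
    case 0
    have "vars Q = {}" using 0(1) by (rule homogeneous_0_imp_vars_empty)
    moreover obtain x where x: "x \<in> Cs j" "x \<in> P"
      using irr[OF jn] by (auto simp: irreducible_in_def topspace_zariski)
    hence "vanish (psubst H Q) x" using 0(3) by simp
    then obtain v where "peval (\<lambda>i. peval v (H i)) Q = 0" unfolding vanish_def by auto
    ultimately show ?case
      using vars_empty_imp_const[of Q] by (metis mult_1_right pmon_zero peval_simps(4) single_zero)
  next
    case (Suc k)
    obtain Q0 Q1 where q: "Q = Q0 + X j * Q1" "homogeneous (Suc k) Q0" "vars Q0 \<subseteq> vars Q - {j}"
      "homogeneous k Q1" "vars Q1 \<subseteq> vars Q"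
      using split_variable[OF Suc.prems(1), of j] by auto
    have v0: "vars Q0 \<subseteq> {..<j}" and v1: "vars Q1 \<subseteq> {..<Suc j}"
      using q(3,5) Suc.prems(2) by (auto simp: less_Suc_eq subset_iff)
    have CP: "Cs i \<subseteq> P" if "i \<le> n" for i
      using irr[OF that] by (simp add: irreducible_in_def topspace_zariski)
    have "Q0 = 0"
    proof (cases j)
      case 0
      hence "vars Q0 = {}" using v0 by simp
      from vars_empty_imp_const[OF this] have "Q0 = Poly_Mapping.single 0 (Poly_Mapping.lookup Q0 0)" .
      moreover from this have "homogeneous (Suc k) (Poly_Mapping.single 0 (Poly_Mapping.lookup Q0 0) :: (nat, 'a) mpoly)"
        using q(2) by simp
      hence "Poly_Mapping.lookup Q0 0 = 0" by simp
      ultimately show ?thesis by simp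
    next
      case (Suc j')
      show ?thesis
      proof (rule \<open>\<And>k Q. j \<le> Suc n \<Longrightarrow> homogeneous k Q \<Longrightarrow> vars Q \<subseteq> {..<j} \<Longrightarrow>
          (\<And>x. x \<in> Cs (j - 1) \<Longrightarrow> vanish (psubst H Q) x) \<Longrightarrow> Q = 0\<close>)
        show "j \<le> Suc n" "homogeneous (Suc k) Q0" "vars Q0 \<subseteq> {..<j}" using jn q v0 by auto
        fix x assume "x \<in> Cs (j - 1)"
        hence x: "x \<in> Cs j'" "x \<in> P" "x \<in> Cs j" using Suc jn mono[of j'] CP[of j'] by auto
        obtain w where w: "w \<in> c x" using nonempty x by blast
        have "vanish (H j) x" using v[of j' x] x Suc jn by simp
        hence "peval w (H j) = 0" using vanish_iff1[OF H[OF jn] x(2) w] by simp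
        moreover have "vanish (psubst H Q) x" using Suc.prems(3) x by simp
        hence "peval w (psubst H Q) = 0"
          using vanish_iff1[OF hs[OF Suc.prems(1,2)] x(2) w] by simp
        ultimately have "peval w (psubst H Q0) = 0" by (simp add: q(1))
        thus "vanish (psubst H Q0) x" using w by (auto simp: vanish_def)
      qed
    qed
    have "(\<forall>x\<in>Cs j. vanish (H j) x) \<or> (\<forall>x\<in>Cs j. vanish (psubst H Q1) x)"
    proof (rule irreducible_vanish_mult[OF irr[OF jn] H[OF jn] hs[OF q(4) v1]])
      fix x assume x: "x \<in> Cs j"
      obtain w where w: "w \<in> c x" using nonempty x CP[OF jn] by blast
      have "vanish (psubst H Q) x" using Suc.prems(3) x by simp
      hence "peval w (psubst H Q) = 0"
        using vanish_iff1[OF hs[OF Suc.prems(1,2)] _ w] x CP[OF jn] by auto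
      hence "peval w (H j * psubst H Q1) = 0" by (simp add: q(1) \<open>Q0 = 0\<close>)
      thus "vanish (H j * psubst H Q1) x" using w by (auto simp: vanish_def)
    qed
    hence "\<forall>x\<in>Cs j. vanish (psubst H Q1) x" using nv[OF jn] by blast
    hence "Q1 = 0" using Suc.IH[OF q(4) v1] by simp
    thus ?case using q(1) \<open>Q0 = 0\<close> by simp
  qed
qed

text \<open>The forms attached to the chain are pulled back by \<open>g\<close>. By the Jacobian
  criterion the \<open>n + 1\<close> independent pullbacks have independent gradients at some point,
  and by the chain rule these lie in the span of the gradients of \<open>g\<close>.\<close>

theorem chain_length_le_grank:
  fixes g :: "'v \<Rightarrow> ('n::finite, 'a) mpoly"
  assumes par: "parametrized C g"
    and hom: "\<And>v. homogeneous E (g v)" and E: "E > 0"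
    and rank: "\<And>x. grank g x \<le> \<rho>"
    and irr: "\<And>i. i \<le> n \<Longrightarrow> closedin T (Cs i) \<and> irreducible_in T (Cs i)"
    and mono: "\<And>i. i < n \<Longrightarrow> Cs i \<subset> Cs (Suc i)"
    and sub: "Cs n \<subseteq> C"
  shows "Suc n \<le> \<rho>"
proof -
  have CP: "Cs i \<subseteq> P" "Cs i \<noteq> {}" if "i \<le> n" for i
    using irr[OF that] by (auto simp: irreducible_in_def topspace_zariski)
  have "\<exists>h d. homogeneous d h \<and> d > 0 \<and> (\<exists>x\<in>Cs i. \<not> vanish h x) \<and>
      (\<forall>i'. i = Suc i' \<longrightarrow> (\<forall>x\<in>Cs i'. vanish h x))" if i: "i \<le> n" for i
  proof (cases i)
    case 0
    \<comment> \<open>For the smallest set a coordinate that does not vanish identically is taken.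
      This makes \<open>n + 1\<close> forms out of a chain of length \<open>n\<close> and explains
      the shift between rank and dimension.\<close>
    obtain x where x: "x \<in> Cs 0" "x \<in> P" using CP[of 0] by auto
    obtain v l where v: "v \<in> c x" "v l \<noteq> 0" using nonempty[OF x(2)] nonzero[OF x(2)] by blast
    have "\<not> vanish (X l) x" using vanish_iff1[OF homogeneous_X x(2) v(1)] v(2) by simp
    thus ?thesis using 0 x homogeneous_X[of l] by (intro exI[of _ "X l"] exI[of _ "Suc 0"]) auto
  next
    case (Suc i')
    obtain y where y: "y \<in> Cs i" "y \<notin> Cs i'" using mono[of i'] i Suc by auto
    have "closedin T (Cs i')" "y \<in> P - Cs i'" using irr[of i'] i Suc y CP(1)[OF i] by auto
    then obtain F d where F: "homogeneous d F" "\<forall>x\<in>Cs i'. vanish F x" "\<not> vanish F y"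
      unfolding closedin_zariski by blast
    \<comment> \<open>A constant vanishing on the nonempty set \<open>Cs i'\<close> is zero.
      Positive degrees are needed for the common multiple \<open>\<Delta>\<close>.\<close>
    have "d \<noteq> 0"
    proof
      assume "d = 0"
      hence "vars F = {}" using F(1) homogeneous_0_imp_vars_empty by blast
      hence Fc: "F = Poly_Mapping.single 0 (Poly_Mapping.lookup F 0)" by (rule vars_empty_imp_const)
      obtain x where x: "x \<in> Cs i'" using CP[of i'] i Suc by auto
      then obtain v where "peval v F = 0" using F(2) by (auto simp: vanish_def)
      hence "Poly_Mapping.lookup F 0 = 0" by (subst (asm) Fc) simp
      hence "F = 0" using Fc by simp
      moreover obtain w where "w \<in> c y" using nonempty y CP[OF i] by blast
      ultimately show False using F(3) by (auto simp: vanish_def)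
    qed
    thus ?thesis using F y Suc by blast
  qed
  then obtain h d where h: "\<And>i. i \<le> n \<Longrightarrow> homogeneous (d i) (h i)" "\<And>i. i \<le> n \<Longrightarrow> d i > (0::nat)"
    "\<And>i. i \<le> n \<Longrightarrow> \<exists>x\<in>Cs i. \<not> vanish (h i) x"
    "\<And>i x. Suc i \<le> n \<Longrightarrow> x \<in> Cs i \<Longrightarrow> vanish (h (Suc i)) x"
    by metis
  \<comment> \<open>Powers bring the forms to the common degree \<open>\<Delta>\<close> without
    changing their zero loci.\<close>
  define \<Delta> where "\<Delta> = (\<Prod>i\<le>n. d i)"
  have \<Delta>0: "\<Delta> > 0" using h(2) by (auto simp: \<Delta>_def intro!: prod_pos)
  have dvd: "d i dvd \<Delta>" if "i \<le> n" for i unfolding \<Delta>_def using that by (intro dvd_prodI) auto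
  define H where "H = (\<lambda>i. h i ^ (\<Delta> div d i))"
  have ex: "\<Delta> div d i > 0" if "i \<le> n" for i
    using dvd_imp_le[OF dvd[OF that] \<Delta>0] h(2)[OF that] by (simp add: div_greater_zero_iff)
  have Hhom: "homogeneous \<Delta> (H i)" if "i \<le> n" for i
    using homogeneous_power[OF h(1)[OF that], of "\<Delta> div d i"] dvd[OF that] by (simp add: H_def)
  have Hv: "vanish (H i) x \<longleftrightarrow> vanish (h i) x" if i: "i \<le> n" and x: "x \<in> P" for i x
  proof -
    obtain w where w: "w \<in> c x" using nonempty[OF x] by blast
    show ?thesis
      using vanish_iff1[OF Hhom[OF i] x w] vanish_iff1[OF h(1)[OF i] x w] ex[OF i]
      by (simp add: H_def)
  qed
  define G where "G = (\<lambda>i. psubst g (H i))"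
  have Ghom: "homogeneous (E * \<Delta>) (G i)" if "i \<in> {..<Suc n}" for i
    unfolding G_def by (rule homogeneous_psubst) (use that Hhom hom in auto)
  have "alg_indep G {..<Suc n}"
    unfolding alg_indep_def
  proof (intro allI impI)
    fix k Q assume Q: "homogeneous k Q" "vars Q \<subseteq> {..<Suc n}" "relation G Q"
    have hq: "homogeneous (\<Delta> * k) (psubst H Q)"
      by (rule homogeneous_psubst[OF Q(1)]) (use Q(2) Hhom in force)
    have "relation g (psubst H Q)" using Q(3) by (simp add: G_def)
    hence vC: "\<forall>x\<in>C. vanish (psubst H Q) x" using par hq unfolding parametrized_def by blast
    show "Q = 0"
    proof (rule chain_independent[where n = n and Cs = Cs and H = H and j = "Suc n" and d = \<Delta>])
      show "\<And>i. i \<le> n \<Longrightarrow> irreducible_in T (Cs i)" using irr by blast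
      show "\<And>i. i < n \<Longrightarrow> Cs i \<subseteq> Cs (Suc i)" using mono by blast
      show "\<And>i. i \<le> n \<Longrightarrow> \<exists>x\<in>Cs i. \<not> vanish (H i) x" using h(3) Hv CP(1) by blast
      show "vanish (H (Suc i)) x" if "i < n" "x \<in> Cs i" for i x
        using h(4)[of i x] Hv[of "Suc i" x] CP(1)[of i] that by auto
      show "\<And>x. x \<in> Cs (Suc n - 1) \<Longrightarrow> vanish (psubst H Q) x" using vC sub by auto
    qed (use Q Hhom in auto)
  qed
  from alg_indep_imp_lin_indep[OF _ Ghom _ this] E \<Delta>0 obtain p where
    p: "lin_indep (\<lambda>i. gradient_at (G i) p) {..<Suc n}" by auto
  let ?R = "Set.range (\<lambda>v. gradient_at (g v) p)"
  have "gradient_at (G i) p \<in> vec.span ?R" for i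
  proof -
    have "gradient_at (G i) p \<in> vec.span ((\<lambda>v. gradient_at (g v) p) ` vars (H i))"
      unfolding G_def by (subst gradient_chain[OF finite_vars order_refl]) (rule combination_in_span)
    also have "\<dots> \<subseteq> vec.span ?R" by (rule vec.span_mono) auto
    finally show ?thesis .
  qed
  hence "vec.dim ((\<lambda>i. gradient_at (G i) p) ` {..<Suc n}) \<le> grank g p"
    unfolding grank_def by (intro vec.dim_mono) auto
  thus ?thesis using p rank[of p] by (simp add: lin_indep_iff_dim)
qed

end

section \<open>Lower bound: restriction of a family to a flag of linear subspaces\<close>

definition lin_map :: "'n \<Rightarrow> 'a::field ^ 'n \<Rightarrow> 'n set \<Rightarrow> 'a ^ 'n \<Rightarrow> 'a ^ 'n::finite" where
  "lin_map i p S x = x $ i *s p + (\<chi> j. if j \<in> S then x $ j else 0)"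

text \<open>Composition with \<open>lin_map\<close>, kept in the same variables so that all results
  on families apply again; coordinate \<open>i\<close> serves as the parameter along
  \<open>p\<close>.\<close>

definition restrict_family ::
  "'n \<Rightarrow> 'a::field ^ 'n \<Rightarrow> 'n set \<Rightarrow> ('v \<Rightarrow> ('n::finite, 'a) mpoly) \<Rightarrow> 'v \<Rightarrow> ('n, 'a) mpoly" where
  "restrict_family i p S g v = psubst (\<lambda>j. Poly_Mapping.single 0 (p $ j) * X i + (if j \<in> S then X j else 0)) (g v)"

lemma pv_restrict_family: "pv x (restrict_family i p S g v) = pv (lin_map i p S x) (g v)"
proof -
  have "(\<lambda>j. p $ j * x $ i + (if j \<in> S then x $ j else 0)) = ($) (lin_map i p S x)"
    by (auto simp: lin_map_def mult.commute)
  moreover have "pv x (if j \<in> S then X j else 0) = (if j \<in> S then x $ j else 0)" for j by simp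
  ultimately show ?thesis by (simp add: restrict_family_def)
qed

lemma homogeneous_restrict_family:
  assumes "homogeneous D (g v)"
  shows "homogeneous D (restrict_family i p S g v)"
proof -
  have "homogeneous (0 + Suc 0) (Poly_Mapping.single 0 (p $ j) * X i)" for j
    by (intro homogeneous_mult homogeneous_X homogeneous_const)
  hence "homogeneous (1 * D) (restrict_family i p S g v)"
    unfolding restrict_family_def by (intro homogeneous_psubst[OF assms] homogeneous_add) auto
  thus ?thesis by simp
qed

lemma gradient_restrict_family:
  fixes g :: "'v \<Rightarrow> ('n::finite, 'a::field_char_0) mpoly"
  shows "dotp (gradient_at (restrict_family i p S g v) x) u =
    dotp (gradient_at (g v) (lin_map i p S x)) (lin_map i p S u)"
proof -
  let ?L = "\<lambda>x u j. [:x $ j, u $ j:]"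
  have "line_poly (?L x u) (restrict_family i p S g v) =
      line_poly (?L (lin_map i p S x) (lin_map i p S u)) (g v)"
  proof (rule poly_eqI_char_0)
    fix t
    have 1: "(\<lambda>j. x $ j + t * u $ j) = ($) (x + t *s u)" for x u :: "'a ^ 'n" by auto
    have "lin_map i p S (x + t *s u) = lin_map i p S x + t *s lin_map i p S u"
      by (auto simp: lin_map_def cart_eq_iff algebra_simps)
    thus "poly (line_poly (?L x u) (restrict_family i p S g v)) t =
      poly (line_poly (?L (lin_map i p S x) (lin_map i p S u)) (g v)) t"
      by (simp add: 1 pv_restrict_family)
  qed
  thus ?thesis by (simp only: pderiv_line_at_0[symmetric])
qed

lemma dual_space_gradients:
  "dual_space (Set.range (\<lambda>v. gradient_at (g v) p)) = {u. \<forall>v. dotp (gradient_at (g v) p) u = 0}"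
  by (auto simp: dual_space_eq)

lemma grank_eq:
  fixes g :: "'v \<Rightarrow> ('n::finite, 'a::field) mpoly"
  shows "grank g p + vec.dim {u. \<forall>v. dotp (gradient_at (g v) p) u = 0} = CARD('n)"
  unfolding grank_def dual_space_gradients[symmetric] by (rule dim_dual_space(1))

lemma grank_restrict_family_le:
  fixes g :: "'v \<Rightarrow> ('n::finite, 'a::field_char_0) mpoly"
  shows "grank (restrict_family i p S g) x \<le> card (insert i S)"
proof -
  let ?A = "{x :: 'a ^ 'n. \<forall>j. j \<notin> insert i S \<longrightarrow> x $ j = 0}"
  have "gradient_at (restrict_family i p S g v) x $ j = 0" if "j \<notin> insert i S" for v j
  proof -
    have "lin_map i p S (axis j 1) = 0"
      using that by (auto simp: lin_map_def cart_eq_iff axis_def)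
    thus ?thesis using gradient_restrict_family[of i p S g v x "axis j 1"] by (simp add: dotp_axis)
  qed
  hence "grank (restrict_family i p S g) x \<le> vec.dim ?A"
    unfolding grank_def by (intro vec.dim_subset) auto
  thus ?thesis by (simp only: dim_substandard_cart)
qed

text \<open>\<open>lin_map\<close> sends \<open>axis i 1\<close> to \<open>p\<close>. A direction is
  in the kernel of the restricted Jacobian iff its image lies in \<open>K\<close>, and
  \<open>ind\<close> then forces its coordinates in \<open>insert i S\<close> to vanish.\<close>

lemma grank_restrict_family:
  fixes g :: "'v \<Rightarrow> ('n::finite, 'a::field_char_0) mpoly"
  assumes K: "K = {u. \<forall>v. dotp (gradient_at (g v) p) u = 0}"
    and ind: "\<And>a b. (a *s p + (\<chi> j. if j \<in> S then b j else 0)) \<in> K \<Longrightarrow> a = 0 \<and> (\<forall>j\<in>S. b j = 0)"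
    and i: "i \<notin> S"
  shows "grank (restrict_family i p S g) (axis i 1) = card (insert i S)"
proof -
  have e: "lin_map i p S (axis i 1) = p"
    using i by (auto simp: lin_map_def cart_eq_iff axis_def)
  have "0 \<in> K" by (simp add: K)
  have "{u. \<forall>v. dotp (gradient_at (restrict_family i p S g v) (axis i 1)) u = 0} =
    {u :: 'a ^ 'n. lin_map i p S u \<in> K}"
    by (simp add: gradient_restrict_family e K)
  also have "\<dots> = {u :: 'a ^ 'n. \<forall>j. j \<notin> - insert i S \<longrightarrow> u $ j = 0}"
  proof (intro Collect_cong iffI allI impI)
    fix u :: "'a ^ 'n" and j assume "lin_map i p S u \<in> K" "j \<notin> - insert i S"
    thus "u $ j = 0" using ind[of "u $ i" "\<lambda>j. u $ j"] by (auto simp: lin_map_def)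
  next
    fix u :: "'a ^ 'n" assume u: "\<forall>j. j \<notin> - insert i S \<longrightarrow> u $ j = 0"
    have "lin_map i p S u = 0" using u by (auto simp: lin_map_def cart_eq_iff)
    thus "lin_map i p S u \<in> K" using \<open>0 \<in> K\<close> by simp
  qed
  finally have "grank (restrict_family i p S g) (axis i 1) + card (- insert i S) = CARD('n)"
    using grank_eq[of "restrict_family i p S g" "axis i 1"] by (simp only: dim_substandard_cart)
  moreover have "card (insert i S) + card (- insert i S) = CARD('n)"
    using card_Un_disjoint[of "insert i S" "- insert i S"] by (simp add: Compl_partition)
  ultimately show ?thesis by linarith
qed

text \<open>Exchange argument: a basis of \<open>K\<close> together with \<open>p\<close> is
  completed to a basis by coordinate axes, and \<open>S\<close> collects the axes used.\<close>

lemma complementary_axes: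
  fixes K :: "('a::field ^ 'n::finite) set"
  assumes K: "vec.subspace K" and p: "p \<notin> K"
  shows "\<exists>S. card S + vec.dim K + 1 = CARD('n) \<and>
    (\<forall>a b. (a *s p + (\<chi> j. if j \<in> S then b j else 0)) \<in> K \<longrightarrow> a = 0 \<and> (\<forall>j\<in>S. b j = 0))"
proof -
  define ax :: "'n \<Rightarrow> 'a ^ 'n" where "ax = (\<lambda>i. axis i 1)"
  have injax: "inj ax" by (auto simp: ax_def inj_on_def axis_eq_axis)
  obtain B0 where B0: "B0 \<subseteq> K" "vec.independent B0" "K \<subseteq> vec.span B0" "card B0 = vec.dim K"
    using vec.basis_exists by metis
  have sB0: "vec.span B0 = K" using B0 K by (meson subset_antisym vec.span_minimal)
  have fB0: "finite B0" using B0(2) vec.finiteI_independent by blast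
  have pB0: "p \<notin> B0" using p B0(1) by blast
  have ind: "vec.independent (insert p B0)"
    using B0(2) p sB0 by (simp add: vec.independent_insert)
  obtain B where B: "insert p B0 \<subseteq> B" "B \<subseteq> insert p B0 \<union> Set.range ax" "vec.independent B"
    "insert p B0 \<union> Set.range ax \<subseteq> vec.span B"
    using vec.maximal_independent_subset_extend[of "insert p B0" "insert p B0 \<union> Set.range ax"] ind
    by blast
  have "vec.span (Set.range ax) \<subseteq> vec.span B"
    using B(4) by (intro vec.span_minimal) auto
  hence spB: "vec.span B = UNIV" unfolding ax_def span_axes by blast
  have cB: "card B = CARD('n)"
    using B(3) spB by (metis vec.dim_eq_card_independent vec.dim_span vec_dim_card)
  have fB: "finite B" using B(3) vec.finiteI_independent by blast
  define S where "S = {j. ax j \<in> B - insert p B0}"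
  have imS: "ax ` S = B - insert p B0" using B(2) by (auto simp: S_def)
  have "card S = card (B - insert p B0)" using injax imS by (metis card_image inj_on_subset subset_UNIV)
  also have "\<dots> + card (insert p B0) = card B"
    using fB B(1) by (metis card_Diff_subset card_mono finite_subset le_add_diff_inverse2)
  finally have cS: "card S + vec.dim K + 1 = CARD('n)"
    using cB fB0 pB0 B0(4) by simp
  have "a = 0 \<and> (\<forall>j\<in>S. b j = 0)" if ab: "(a *s p + (\<chi> j. if j \<in> S then b j else 0)) \<in> K" for a b
  proof -
    define y where "y = (\<chi> j. if j \<in> S then b j else 0)"
    have "y = (\<Sum>j\<in>UNIV. y $ j *s ax j)" unfolding ax_def by (simp add: basis_expansion)
    also have "\<dots> = (\<Sum>j\<in>S. y $ j *s ax j)"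
      by (rule sum.mono_neutral_right) (auto simp: y_def)
    also have "\<dots> = (\<Sum>j\<in>S. b j *s ax j)" by (rule sum.cong) (auto simp: y_def)
    finally have y: "y = (\<Sum>j\<in>S. b j *s ax j)" .
    obtain d where d: "a *s p + y = (\<Sum>v\<in>B0. d v *s v)"
      using span_image_combination[OF fB0, of "a *s p + y" "\<lambda>v. v"] ab sB0 by (auto simp: y_def)
    \<comment> \<open>Coefficients in the basis \<open>B\<close> of the vanishing vector obtained by
      subtracting the expansion of \<open>a *s p + y\<close> in \<open>B0\<close> from
      \<open>a *s p + y\<close> itself.\<close>
    define u where "u = (\<lambda>v. if v = p then a else if v \<in> B0 then - d v else b (the_inv ax v))"
    have dis: "B = insert p B0 \<union> ax ` S" using imS B(1) by auto
    have pS: "p \<notin> ax ` S" and BS: "B0 \<inter> ax ` S = {}" using imS by auto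
    have "(\<Sum>v\<in>B. u v *s v) = (\<Sum>v\<in>insert p B0. u v *s v) + (\<Sum>v\<in>ax ` S. u v *s v)"
      unfolding dis by (rule sum.union_disjoint) (use fB0 pS BS in auto)
    also have "(\<Sum>v\<in>insert p B0. u v *s v) = a *s p + (\<Sum>v\<in>B0. - d v *s v)"
    proof -
      have "(\<Sum>v\<in>B0. u v *s v) = (\<Sum>v\<in>B0. - d v *s v)"
        by (rule sum.cong) (use pB0 in \<open>auto simp: u_def\<close>)
      thus ?thesis using fB0 pB0 by (simp add: u_def)
    qed
    also have "(\<Sum>v\<in>ax ` S. u v *s v) = y"
    proof -
      have "(\<Sum>v\<in>ax ` S. u v *s v) = (\<Sum>j\<in>S. u (ax j) *s ax j)"
        using injax by (subst sum.reindex) (auto intro: inj_on_subset)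
      also have "\<dots> = y" unfolding y
        by (rule sum.cong) (use pS BS injax in \<open>auto simp: u_def the_inv_f_f\<close>)
      finally show ?thesis .
    qed
    also have "a *s p + (\<Sum>v\<in>B0. - d v *s v) + y = (a *s p + y) - (\<Sum>v\<in>B0. d v *s v)"
      by (simp add: sum_negf)
    also have "\<dots> = 0" using d by simp
    finally have z: "(\<Sum>v\<in>B. u v *s v) = 0" .
    have u0: "u v = 0" if "v \<in> B" for v
      using vec.independentD[OF B(3) fB order_refl z that] .
    have "a = 0" using u0[of p] B(1) by (simp add: u_def)
    moreover have "b j = 0" if "j \<in> S" for j
    proof -
      have "u (ax j) = b j" using pS BS injax that by (auto simp: u_def the_inv_f_f)
      thus ?thesis using u0[of "ax j"] that imS by auto
    qed
    ultimately show ?thesis by blast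
  qed
  thus ?thesis using cS by blast
qed

context cone_space
begin

lemma parametrized_subset:
  assumes "parametrized C g" "\<And>d F. homogeneous d F \<Longrightarrow> relation g F \<Longrightarrow> relation g' F"
  shows "locus g' \<subseteq> C"
  using assms unfolding parametrized_imp_locus[OF assms(1)] locus_def by blast

text \<open>The complement of the Jacobian kernel is spanned by \<open>p\<close> and some axes.
  Restricting \<open>g\<close> to \<open>p\<close> and the first \<open>i\<close> of these axes
  gives families of maximal rank \<open>i + 1\<close>, whose loci form the chain. Euler's identity
  keeps \<open>p\<close> outside the kernel, since some \<open>g v\<close> is nonzero at
  \<open>p\<close>.\<close>

theorem grank_chain:
  fixes g :: "'v \<Rightarrow> ('n::finite, 'a) mpoly"
  assumes par: "parametrized C g"
    and hom: "\<And>v. homogeneous E (g v)" and E: "E > 0"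
    and \<delta>: "\<And>x. pv x \<delta> \<noteq> 0 \<Longrightarrow> realized g x" and p: "pv p \<delta> \<noteq> 0"
  shows "\<exists>Cs. (\<forall>i<grank g p. closedin T (Cs i) \<and> irreducible_in T (Cs i) \<and> Cs i \<subseteq> C) \<and>
     (\<forall>i. Suc i < grank g p \<longrightarrow> Cs i \<subset> Cs (Suc i)) \<and> grank g p > 0"
proof -
  define K where "K = {u. \<forall>v. dotp (gradient_at (g v) p) u = 0}"
  have K: "vec.subspace K"
    unfolding K_def dual_space_gradients[symmetric] by (rule subspace_dual_space)
  have "p \<notin> K"
  proof
    assume "p \<in> K"
    hence "of_nat E * pv p (g v) = 0" for v
      using Euler_identity[OF hom, of v p] by (simp add: K_def)
    hence z: "pv p (g v) = 0" for v using E by simp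
    obtain y v l where y: "y \<in> P" "v \<in> c y" "l \<noteq> 0" "(\<lambda>i. pv p (g i)) = (\<lambda>i. l * v i)"
      using \<delta>[OF p] unfolding realized_def by blast
    obtain i where "v i \<noteq> 0" using nonzero y by blast
    thus False using z[of i] fun_cong[OF y(4), of i] y(3) by simp
  qed
  from complementary_axes[OF K this] obtain S where
    cS: "card S + vec.dim K + 1 = CARD('n)" and
    ind: "\<And>a b. (a *s p + (\<chi> j. if j \<in> S then b j else 0)) \<in> K \<Longrightarrow> a = 0 \<and> (\<forall>j\<in>S. b j = 0)"
    by blast
  define \<rho> where "\<rho> = grank g p"
  have \<rho>: "\<rho> = Suc (card S)" using grank_eq[of g p] cS unfolding K_def[symmetric] \<rho>_def by simp
  have "card S < CARD('n)" using cS by simp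
  then obtain i0 where i0: "i0 \<notin> S" by (metis UNIV_eq_I less_irrefl)
  obtain ts where ts: "set ts = S" "distinct ts" using finite_distinct_list[of S] by auto
  have lts: "length ts = card S" using ts distinct_card by metis
  define R where "R = (\<lambda>i. set (take i ts))"
  define h where "h = (\<lambda>i. restrict_family i0 p (R i) g)"
  have RS: "R i \<subseteq> S" for i using ts(1) by (auto simp: R_def dest: in_set_takeD)
  have cR: "card (insert i0 (R i)) = Suc i" if "i < \<rho>" for i
  proof -
    have "card (R i) = i" unfolding R_def using that ts(2) lts \<rho> by (simp add: distinct_card)
    moreover have "i0 \<notin> R i" using RS i0 by blast
    ultimately show ?thesis by (simp add: R_def)
  qed
  have gr: "grank (h i) (axis i0 1) = Suc i" if "i < \<rho>" for i
    unfolding cR[OF that, symmetric] h_def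
  proof (rule grank_restrict_family[OF K_def])
    fix a b assume "(a *s p + (\<chi> j. if j \<in> R i then b j else 0)) \<in> K"
    moreover have "(\<chi> j. if j \<in> R i then b j else 0) =
        (\<chi> j. if j \<in> S then (if j \<in> R i then b j else 0) else 0)"
      using RS by (auto simp: cart_eq_iff)
    ultimately have "a = 0 \<and> (\<forall>j\<in>S. (if j \<in> R i then b j else 0) = 0)"
      using ind[of a "\<lambda>j. if j \<in> R i then b j else 0"] by simp
    thus "a = 0 \<and> (\<forall>j\<in>R i. b j = 0)" using RS by (metis subsetD)
  qed (use RS i0 in blast)
  have gle: "grank (h i) x \<le> Suc i" if "i < \<rho>" for i x
    unfolding cR[OF that, symmetric] h_def by (rule grank_restrict_family_le)
  have homh: "homogeneous E (h i v)" for i v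
    unfolding h_def by (rule homogeneous_restrict_family) (rule hom)
  have hg: "relation (h i) F" if "relation g F" for i F
    using that by (simp add: h_def pv_restrict_family)
  have hh: "relation (h i) F" if "relation (h (Suc i)) F" for i F
  proof
    fix x :: "'a ^ 'n"
    \<comment> \<open>Erasing the coordinate that is new in \<open>R (Suc i)\<close> makes the
      larger member of the flag take the value of the smaller one at \<open>x\<close>.\<close>
    define x' where "x' = (\<chi> j. if j \<in> R i \<or> j = i0 then x $ j else 0)"
    have "R i \<subseteq> R (Suc i)" by (simp add: R_def set_take_subset_set_take)
    hence "lin_map i0 p (R (Suc i)) x' = lin_map i0 p (R i) x"
      using RS i0 by (auto simp: lin_map_def cart_eq_iff x'_def)
    thus "peval (\<lambda>v. pv x (h i v)) F = 0"
      using that[rule_format, of x'] by (simp add: h_def pv_restrict_family)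
  qed
  define Cs where "Cs = (\<lambda>i. locus (h i))"
  have parh: "parametrized (Cs i) (h i)" if "i < \<rho>" for i
    unfolding Cs_def
  proof (rule parametrized_locus)
    define \<delta>' where "\<delta>' = restrict_family i0 p (R i) (\<lambda>_. \<delta>) ()"
    show "realized (h i) x" if "pv x \<delta>' \<noteq> 0" for x
      using \<delta>[of "lin_map i0 p (R i) x"] that
      by (simp add: realized_def h_def pv_restrict_family \<delta>'_def)
    have "lin_map i0 p (R i) (axis i0 1) = p"
      using i0 RS by (auto simp: lin_map_def cart_eq_iff axis_def)
    thus "pv (axis i0 1) \<delta>' \<noteq> 0" using p by (simp add: pv_restrict_family \<delta>'_def)
  qed
  have "closedin T (Cs i) \<and> irreducible_in T (Cs i) \<and> Cs i \<subseteq> C" if "i < \<rho>" for i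
    using parh[OF that] parametrized_irreducible[OF parh[OF that]] parametrized_subset[OF par hg]
    by (simp add: parametrized_def Cs_def)
  moreover have "Cs i \<subset> Cs (Suc i)" if i: "Suc i < \<rho>" for i
    unfolding less_le_not_le
  proof
    show "Cs i \<subseteq> Cs (Suc i)"
      unfolding Cs_def[THEN fun_cong, of i] by (rule parametrized_subset[OF parh[OF i] hh])
    show "\<not> Cs (Suc i) \<subseteq> Cs i"
    proof
      assume sub: "Cs (Suc i) \<subseteq> Cs i"
      obtain A where A: "finite A" "card A = grank (h (Suc i)) (axis i0 1)"
        "lin_indep (\<lambda>v. gradient_at (h (Suc i) v) (axis i0 1)) A"
        using independent_gradients_exist by blast
      \<comment> \<open>If the loci coincided, both families would satisfy the same relations; the
        \<open>i + 2\<close> indices in \<open>A\<close> would then be independent for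
        \<open>h i\<close>, whose rank is at most \<open>i + 1\<close>.\<close>
      have ai: "alg_indep (h (Suc i)) A" by (rule lin_indep_imp_alg_indep[OF A(1) homh A(3)])
      have "alg_indep (h i) A"
        unfolding alg_indep_def
      proof (intro allI impI)
        fix k F assume F: "homogeneous k F" "vars F \<subseteq> A" "relation (h i) F"
        have "\<forall>x\<in>Cs i. vanish F x"
          using parh[of i] i F(1,3) unfolding parametrized_def by auto
        hence "\<forall>x\<in>Cs (Suc i). vanish F x" using sub by blast
        hence "relation (h (Suc i)) F" using parh[OF i] F(1) unfolding parametrized_def by blast
        thus "F = 0" using ai F(1,2) unfolding alg_indep_def by blast
      qed
      from alg_indep_imp_lin_indep[OF A(1) homh E this] obtain q where
        "lin_indep (\<lambda>v. gradient_at (h i v) q) A" by blast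
      hence "card A \<le> Suc i"
        using lin_indep_card_le_grank[OF A(1)] gle[of i q] i by fastforce
      thus False using A(2) gr[OF i] by simp
    qed
  qed
  ultimately show ?thesis unfolding \<rho>_def[symmetric] using \<rho> by (intro exI[of _ Cs]) auto
qed

section \<open>The Krull dimension of a parametrized closed set\<close>

lemma irreducible_in_subtopology:
  assumes C: "closedin T C" and A: "A \<subseteq> C"
  shows "irreducible_in (subtopology T C) A \<longleftrightarrow> irreducible_in T A"
proof -
  have CP: "C \<subseteq> P" using C by (simp add: closedin_zariski)
  have ts: "topspace (subtopology T C) = C" using CP by (auto simp: topspace_subtopology topspace_zariski)
  show ?thesis
  proof
    assume L: "irreducible_in (subtopology T C) A"
    show "irreducible_in T A" unfolding irreducible_in_def
    proof (intro conjI allI impI)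
      show "A \<subseteq> topspace T" using A CP by (simp add: topspace_zariski)
      show "A \<noteq> {}" using L by (simp add: irreducible_in_def)
      fix U V assume UV: "closedin T U" "closedin T V" "A \<subseteq> U \<union> V"
      have "closedin (subtopology T C) (U \<inter> C)" "closedin (subtopology T C) (V \<inter> C)"
        using UV C by (auto simp: closedin_closed_subtopology)
      moreover have "A \<subseteq> (U \<inter> C) \<union> (V \<inter> C)" using UV(3) A by blast
      ultimately have "A \<subseteq> U \<inter> C \<or> A \<subseteq> V \<inter> C" using L unfolding irreducible_in_def by blast
      thus "A \<subseteq> U \<or> A \<subseteq> V" by blast
    qed
  next
    assume "irreducible_in T A"
    thus "irreducible_in (subtopology T C) A"
      using A ts C by (auto simp: irreducible_in_def closedin_closed_subtopology)
  qed
qed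

text \<open>The rank is the dimension of the affine cone; subtracting one passes to the set of its
  lines. The hypothesis \<open>max\<close> says that \<open>p\<close> attains the generic
  rank.\<close>

theorem krull_dim_parametrized:
  fixes g :: "'v \<Rightarrow> ('n::finite, 'a) mpoly"
  assumes par: "parametrized C g"
    and hom: "\<And>v. homogeneous E (g v)" and E: "E > 0"
    and \<delta>: "\<And>x. pv x \<delta> \<noteq> 0 \<Longrightarrow> realized g x" and p: "pv p \<delta> \<noteq> 0"
    and max: "\<And>x. grank g x \<le> grank g p"
  shows "krull_dim (subtopology T C) = enat (grank g p - 1)" and "grank g p > 0"
proof -
  have C: "closedin T C" using par by (simp add: parametrized_def)
  from grank_chain[OF par hom E \<delta> p] obtain Cs where
    Cs: "\<And>i. i < grank g p \<Longrightarrow> closedin T (Cs i) \<and> irreducible_in T (Cs i) \<and> Cs i \<subseteq> C"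
    "\<And>i. Suc i < grank g p \<Longrightarrow> Cs i \<subset> Cs (Suc i)" and pos: "grank g p > 0" by blast
  show "grank g p > 0" by (rule pos)
  let ?ch = "\<lambda>n. \<exists>Cs. (\<forall>i\<le>n. closedin (subtopology T C) (Cs i) \<and> irreducible_in (subtopology T C) (Cs i)) \<and>
     (\<forall>i<n. Cs i \<subset> Cs (Suc i))"
  have "?ch (grank g p - 1)"
  proof (intro exI[of _ Cs] conjI allI impI)
    fix i assume "i \<le> grank g p - 1"
    hence "i < grank g p" using pos by simp
    thus "closedin (subtopology T C) (Cs i)" "irreducible_in (subtopology T C) (Cs i)"
      using Cs(1) C by (auto simp: closedin_closed_subtopology irreducible_in_subtopology)
  next
    fix i assume "i < grank g p - 1"
    thus "Cs i \<subset> Cs (Suc i)" using Cs(2)[of i] by simp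
  qed
  hence "enat (grank g p - 1) \<le> krull_dim (subtopology T C)"
    unfolding krull_dim_def by (intro Sup_upper) blast
  moreover have "krull_dim (subtopology T C) \<le> enat (grank g p - 1)"
    unfolding krull_dim_def
  proof (rule Sup_least)
    fix e assume "e \<in> {enat n |n. ?ch n}"
    then obtain n Ds where e: "e = enat n" and
      Ds: "\<And>i. i \<le> n \<Longrightarrow> closedin (subtopology T C) (Ds i) \<and> irreducible_in (subtopology T C) (Ds i)"
      "\<And>i. i < n \<Longrightarrow> Ds i \<subset> Ds (Suc i)" by blast
    have D': "closedin T (Ds i) \<and> Ds i \<subseteq> C" if "i \<le> n" for i
      using Ds(1)[OF that] C by (simp add: closedin_closed_subtopology)
    have "Suc n \<le> grank g p"
    proof (rule chain_length_le_grank[OF par hom E max])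
      show "closedin T (Ds i) \<and> irreducible_in T (Ds i)" if "i \<le> n" for i
        using D'[OF that] Ds(1)[OF that] irreducible_in_subtopology[OF C, of "Ds i"] by blast
      show "Ds n \<subseteq> C" using D' by blast
    qed (use Ds(2) in blast)
    thus "e \<le> enat (grank g p - 1)" by (simp add: e)
  qed
  ultimately show "krull_dim (subtopology T C) = enat (grank g p - 1)" by (rule antisym[rotated])
qed

end

section \<open>Projective space and the Grassmannian as cone spaces\<close>

lemma proj_point_eq_span:
  fixes L :: "('a::field ^ 'n::finite) set"
  assumes "L \<in> proj_points V" "v \<in> L" "v \<noteq> 0"
  shows "L = vec.span {v}"
proof -
  have L: "vec.subspace L" "vec.dim L = 1" using assms(1) by (auto simp: proj_points_def)
  have "vec.span {v} \<subseteq> L" using L(1) assms(2) by (intro vec.span_minimal) auto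
  moreover have "vec.dim (vec.span {v}) = 1" using assms(3) by simp
  ultimately show ?thesis
    using vec.subspace_dim_equal[of "vec.span {v}" L] L by auto
qed

lemma proj_point_exists:
  fixes L :: "('a::field ^ 'n::finite) set"
  assumes "L \<in> proj_points V"
  shows "\<exists>v. v \<in> L \<and> v \<noteq> 0"
proof (rule ccontr)
  assume "\<nexists>v. v \<in> L \<and> v \<noteq> 0"
  hence "L \<subseteq> {0}" by auto
  hence "vec.dim L = 0" by (simp add: vec.dim_eq_0)
  moreover have "vec.dim L = 1" using assms by (simp add: proj_points_def)
  ultimately show False by (simp del: vec.dim_eq_0)
qed

lemma span_proj_point:
  fixes v :: "'a::field ^ 'n::finite"
  assumes "v \<noteq> 0" "vec.subspace V"
  shows "vec.span {v} \<in> proj_points V \<longleftrightarrow> v \<in> V"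
proof
  assume "vec.span {v} \<in> proj_points V"
  thus "v \<in> V" using vec.span_base[of v "{v}"] by (auto simp: proj_points_def)
next
  assume "v \<in> V"
  hence "vec.span {v} \<subseteq> V" using assms(2) by (intro vec.span_minimal) auto
  thus "vec.span {v} \<in> proj_points V" using assms(1) by (simp add: proj_points_def)
qed

lemma span_singleton_nonzero:
  "w \<in> vec.span {v} - {0} \<longleftrightarrow> (\<exists>k. k \<noteq> 0 \<and> w = k *s v) \<and> (w :: 'a::field ^ 'n) \<noteq> 0"
  by (auto simp: vec.span_singleton)

interpretation proj: cone_space "proj_points (UNIV :: ('a::field_char_0 ^ 'n::finite) set)"
  "\<lambda>L. {($) v |v. v \<in> L \<and> v \<noteq> 0}"
proof
  fix L :: "('a ^ 'n) set" assume L: "L \<in> proj_points UNIV"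
  show "\<exists>v. v \<in> {($) v |v. v \<in> L \<and> v \<noteq> 0}" using proj_point_exists[OF L] by blast
  fix v assume "v \<in> {($) v |v. v \<in> L \<and> v \<noteq> 0}"
  then obtain a where a: "v = ($) a" "a \<in> L" "a \<noteq> 0" by auto
  show "\<exists>i. v i \<noteq> 0" using a by (auto simp: cart_eq_iff)
  fix w assume "w \<in> {($) v |v. v \<in> L \<and> v \<noteq> 0}"
  then obtain b where b: "w = ($) b" "b \<in> L" "b \<noteq> 0" by auto
  obtain k where "k \<noteq> 0" "b = k *s a"
    using span_singleton_nonzero[of b a] b proj_point_eq_span[OF L a(2,3)] by auto
  thus "\<exists>l. l \<noteq> 0 \<and> w = (\<lambda>i. l * v i)" using a b by (intro exI[of _ k]) auto
qed

lemma zariski_proj_eq: "zariski_proj = proj.T"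
  by (simp add: zariski_proj_def)

lemma proj_vanish_span:
  fixes v :: "'a::field_char_0 ^ 'n::finite"
  assumes "homogeneous d F" "v \<noteq> 0"
  shows "proj.vanish F (vec.span {v}) \<longleftrightarrow> pv v F = 0"
proof (rule proj.vanish_iff1[OF assms(1)])
  show "vec.span {v} \<in> proj_points UNIV" using assms(2) by (simp add: span_proj_point)
  show "($) v \<in> {($) w |w. w \<in> vec.span {v} \<and> w \<noteq> 0}" using assms(2) vec.span_base[of v "{v}"] by auto
qed

lemma proj_points_cases:
  fixes L :: "('a::field ^ 'n::finite) set"
  assumes "L \<in> proj_points V"
  obtains v where "v \<noteq> 0" "L = vec.span {v}" "v \<in> V"
proof -
  obtain v where v: "v \<in> L" "v \<noteq> 0" using proj_point_exists[OF assms] by blast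
  moreover have "v \<in> V" using v assms by (auto simp: proj_points_def)
  ultimately show thesis using that proj_point_eq_span[OF assms v] by blast
qed

lemma grassmannian_basis_indep:
  fixes vs :: "('a::field ^ 'n::finite) list"
  assumes "vec.span (set vs) \<in> grassmannian m" "length vs = m"
  shows "indep_list vs"
  using assms unfolding indep_list_iff_dim by (simp add: grassmannian_def)

text \<open>The coordinate vectors of a subspace come from all its bases, and a change of basis
  multiplies them by one scalar, nonzero because both vectors are.\<close>

interpretation grass: cone_space "grassmannian m :: ('a::field_char_0 ^ 'n::finite) set set"
  "\<lambda>V. {pluecker vs |vs. length vs = m \<and> vec.span (set vs) = V}" for m
proof
  fix V :: "('a ^ 'n) set" assume V: "V \<in> grassmannian m"
  hence V': "vec.subspace V" "vec.dim V = m" by (auto simp: grassmannian_def)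
  obtain vs where vs: "vec.span (set vs) = vec.span V" "length vs = vec.dim V"
    using indep_list_spanning_exists[of V] by blast
  have "vec.span V = V" using V'(1) by (rule vec.span_eq_iff[THEN iffD2])
  thus "\<exists>v. v \<in> {pluecker vs |vs. length vs = m \<and> vec.span (set vs) = V}"
    using vs V'(2) by blast
  have nz: "\<exists>i. v i \<noteq> 0" if "v \<in> {pluecker vs |vs. length vs = m \<and> vec.span (set vs) = V}" for v
    using that indep_imp_pluecker_nonzero grassmannian_basis_indep[of _ m] V by blast
  fix v assume v: "v \<in> {pluecker vs |vs. length vs = m \<and> vec.span (set vs) = V}"
  show "\<exists>i. v i \<noteq> 0" by (rule nz[OF v])
  fix w assume w: "w \<in> {pluecker vs |vs. length vs = m \<and> vec.span (set vs) = V}"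
  from v obtain vs where vs: "v = pluecker vs" "length vs = m" "vec.span (set vs) = V" by blast
  from w obtain ws where ws: "w = pluecker ws" "length ws = m" "vec.span (set ws) = V" by blast
  have "set ws \<subseteq> vec.span (set vs)" using vec.span_superset[of "set ws"] vs(3) ws(3) by simp
  from pluecker_change_of_basis[OF this] obtain a where a: "\<And>I. pluecker ws I = a * pluecker vs I"
    using vs(2) ws(2) by auto
  have "a \<noteq> 0" using nz[OF w] a by (auto simp: ws(1))
  moreover have "w = (\<lambda>i. a * v i)" using a by (auto simp: vs(1) ws(1))
  ultimately show "\<exists>l. l \<noteq> 0 \<and> w = (\<lambda>i. l * v i)" by blast
qed

lemma zariski_grassmannian_eq: "zariski_grassmannian m = grass.T m"
  by (simp add: zariski_grassmannian_def)

section \<open>Recovering a subspace from its Pluecker coordinates\<close>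

text \<open>Laplace expansion along column \<open>l\<close>: the cofactors do not involve that
  column, so varying it yields a vector in the span of \<open>vs\<close>.\<close>

lemma pluecker_update_column:
  fixes vs :: "('a::field ^ 'n::finite) list"
  assumes I: "length I = length vs" and l: "l < length vs"
  shows "(\<chi> i. pluecker vs (I[l := i])) = (\<Sum>k<length vs. cofactor (pmat vs I) k l *s (vs ! k))"
proof -
  have "pluecker vs (I[l := i]) = (\<Sum>k<length vs. cofactor (pmat vs I) k l * (vs ! k) $ i)" for i
  proof -
    let ?A = "pmat vs (I[l := i])"
    have "cofactor ?A k l = cofactor (pmat vs I) k l" if "k < length vs" for k
    proof -
      have "mat_delete ?A k l = mat_delete (pmat vs I) k l"
        by (rule eq_matI) (use I l in \<open>auto simp: mat_delete_def pmat_def\<close>)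
      thus ?thesis by (simp add: cofactor_def)
    qed
    moreover have "pluecker vs (I[l := i]) = (\<Sum>k<length vs. ?A $$ (k, l) * cofactor ?A k l)"
      using I l by (simp add: pluecker_eq_det laplace_expansion_column[OF pmat_carrier])
    ultimately show ?thesis using I l by (simp add: pmat_def mult.commute)
  qed
  thus ?thesis by (simp add: cart_eq_iff)
qed

text \<open>A matrix times its adjugate is its determinant, which inverts the column formula. The
  spanning vectors have single Pluecker coordinates as entries, so information on the derivatives of
  these coordinates becomes information on the subspace.\<close>

lemma basis_from_pluecker:
  fixes vs :: "('a::field ^ 'n::finite) list"
  assumes nz: "pluecker vs I \<noteq> 0"
  shows "set vs \<subseteq> vec.span ((\<lambda>l. \<chi> i. pluecker vs (I[l := i])) ` {..<length vs})"
proof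
  have I: "length I = length vs" using pluecker_length[OF nz] .
  define m where "m = length vs"
  define A where "A = pmat vs I"
  have A: "A \<in> carrier_mat m m" by (simp add: A_def m_def)
  have dA: "Determinant.det A \<noteq> 0" using nz I by (simp add: A_def pluecker_eq_det)
  define y where "y = (\<lambda>l. \<chi> i. pluecker vs (I[l := i]))"
  have y: "y l = (\<Sum>k<m. cofactor A k l *s (vs ! k))" if "l < m" for l
    using pluecker_update_column[OF I] that by (simp add: y_def A_def m_def)
  fix v assume "v \<in> set vs"
  then obtain k where k: "k < m" "v = vs ! k" by (auto simp: in_set_conv_nth m_def)
  have adj: "(\<Sum>l<m. A $$ (k, l) * cofactor A k' l) = (if k' = k then Determinant.det A else 0)" if "k' < m" for k'
  proof -
    have "(A * adj_mat A) $$ (k, k') = (\<Sum>l<m. A $$ (k, l) * cofactor A k' l)"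
      using A that k by (simp add: adj_mat_def scalar_prod_def lessThan_atLeast0)
    thus ?thesis using adj_mat(2)[OF A] that k by auto
  qed
  have "(\<Sum>l<m. A $$ (k, l) *s y l) = (\<Sum>l<m. \<Sum>k'<m. (A $$ (k, l) * cofactor A k' l) *s (vs ! k'))"
    by (simp add: y vec.scale_sum_right vec.scale_scale)
  also have "\<dots> = (\<Sum>k'<m. (\<Sum>l<m. A $$ (k, l) * cofactor A k' l) *s (vs ! k'))"
    by (subst sum.swap) (simp add: vec.scale_sum_left)
  also have "\<dots> = (\<Sum>k'<m. if k' = k then Determinant.det A *s (vs ! k) else 0)"
    by (rule sum.cong) (auto simp: adj)
  also have "\<dots> = Determinant.det A *s v" using k by simp
  finally have "Determinant.det A *s v \<in> vec.span (y ` {..<m})"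
    using combination_in_span[of "\<lambda>l. A $$ (k, l)" y "{..<m}"] by simp
  hence "inverse (Determinant.det A) *s (Determinant.det A *s v) \<in> vec.span (y ` {..<m})"
    by (rule vec.span_scale)
  thus "v \<in> vec.span ((\<lambda>l. \<chi> i. pluecker vs (I[l := i])) ` {..<length vs})"
    using dA by (simp add: vec.scale_scale y_def m_def)
qed

section \<open>Rules for directional derivatives\<close>

lemma gradient_mult:
  fixes F G :: "('n::finite, 'a::field_char_0) mpoly"
  shows "dotp (gradient_at (F * G) p) u =
    pv p F * dotp (gradient_at G p) u + pv p G * dotp (gradient_at F p) u"
proof -
  let ?L = "line_poly (\<lambda>i. [:p $ i, u $ i:])"
  have "?L (F * G) = ?L F * ?L G" by (rule poly_eqI_char_0) simp
  hence "poly (pderiv (?L (F * G))) 0 =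
      poly (?L F) 0 * poly (pderiv (?L G)) 0 + poly (?L G) 0 * poly (pderiv (?L F)) 0"
    by (simp add: pderiv_mult)
  thus ?thesis unfolding pderiv_line_at_0 by simp
qed

lemma gradient_sum:
  fixes F :: "'i \<Rightarrow> ('n::finite, 'a::field_char_0) mpoly"
  shows "dotp (gradient_at (\<Sum>i\<in>A. F i) p) u = (\<Sum>i\<in>A. dotp (gradient_at (F i) p) u)"
proof -
  let ?L = "line_poly (\<lambda>i. [:p $ i, u $ i:])"
  have "?L (\<Sum>i\<in>A. F i) = (\<Sum>i\<in>A. ?L (F i))" by (rule poly_eqI_char_0) (simp add: poly_sum)
  moreover have "pderiv (\<Sum>i\<in>A. q i) = (\<Sum>i\<in>A. pderiv (q i))" for q :: "'i \<Rightarrow> 'a poly"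
    by (induction A rule: infinite_finite_induct) (auto simp: pderiv_add)
  ultimately have "poly (pderiv (?L (\<Sum>i\<in>A. F i))) 0 = (\<Sum>i\<in>A. poly (pderiv (?L (F i))) 0)"
    by (simp add: poly_sum)
  thus ?thesis unfolding pderiv_line_at_0 by simp
qed

lemma linear_form_gradient:
  fixes G :: "('n::finite, 'a::field_char_0) mpoly"
  assumes "homogeneous 1 G"
  shows "pv x G = dotp (gradient_at G p) x"
proof -
  have "pv x (pdiff l G) = pv p (pdiff l G)" for l
  proof -
    have "homogeneous 0 (pdiff l G)" using homogeneous_pdiff[OF assms] by simp
    hence "pdiff l G = Poly_Mapping.single 0 (Poly_Mapping.lookup (pdiff l G) 0)"
      by (intro vars_empty_imp_const homogeneous_0_imp_vars_empty)
    thus ?thesis by (metis peval_simps(4) pmon_zero)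
  qed
  hence "gradient_at G x = gradient_at G p" by (simp add: gradient_at_def)
  thus ?thesis using Euler_identity[OF assms, of x] by simp
qed

context cone_space
begin

lemma closure_eq_locus:
  fixes g :: "'v \<Rightarrow> ('n::finite, 'a) mpoly"
  assumes A: "A \<subseteq> P"
    and v: "\<And>d F. homogeneous d F \<Longrightarrow> (\<forall>y\<in>A. vanish F y) \<longleftrightarrow> relation g F"
  shows "T closure_of A = locus g"
proof -
  have "(\<forall>F d. homogeneous d F \<longrightarrow> (\<forall>y\<in>A. vanish F y) \<longrightarrow> vanish F z) \<longleftrightarrow>
      (\<forall>d F. homogeneous d F \<longrightarrow> relation g F \<longrightarrow> vanish F z)" for z
    using v by metis
  hence "z \<in> T closure_of A \<longleftrightarrow> z \<in> locus g" for z
    unfolding in_closure_zariski[OF A] locus_def mem_Collect_eq by (rule conj_cong[OF refl])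
  thus ?thesis by auto
qed

end

section \<open>Cubics with vanishing Hessian\<close>

text \<open>The coordinate functions have the axes as gradients, hence are algebraically
  independent.\<close>

lemma homogeneous_zero_test:
  fixes F :: "('n::finite, 'a::field_char_0) mpoly"
  assumes "homogeneous d F" "\<And>x. pv x F = 0"
  shows "F = 0"
proof -
  have grad: "gradient_at (X v :: ('n, 'a) mpoly) 0 = axis v 1" for v
    using gradient_X_power[of v 1 "0 :: 'a ^ 'n"] by simp
  have "lin_indep (\<lambda>v. gradient_at (X v :: ('n, 'a) mpoly) 0) UNIV"
    unfolding lin_indep_def grad
  proof (intro allI impI ballI)
    fix c :: "'n \<Rightarrow> 'a" and v assume "(\<Sum>v\<in>UNIV. c v *s axis v 1) = 0"
    moreover have "(\<Sum>v\<in>UNIV. c v *s axis v 1) = (\<chi> v. c v)"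
      using basis_expansion[of "\<chi> v. c v"] by simp
    ultimately show "c v = 0" by (simp add: cart_eq_iff)
  qed
  hence "alg_indep (X :: 'n \<Rightarrow> ('n, 'a) mpoly) UNIV"
    by (rule lin_indep_imp_alg_indep[where D = "Suc 0", rotated 2]) auto
  thus ?thesis using assms unfolding alg_indep_def by simp
qed

locale cubic =
  fixes f :: "('n::finite, 'a::field_char_0) mpoly"
  assumes f3: "homogeneous 3 f" and f0: "f \<noteq> 0" and hess: "vanishing_hessian f"
begin

definition polars :: "'n \<Rightarrow> ('n, 'a) mpoly" where
  "polars j = pdiff j f"

definition phi :: "'a ^ 'n \<Rightarrow> 'a ^ 'n" where
  "phi x = gradient_at f x"

lemma homogeneous_polars: "homogeneous 2 (polars j)"
  using homogeneous_pdiff[OF f3, of j] by (simp add: polars_def)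

lemma phi_nth: "phi x $ j = pv x (polars j)"
  by (simp add: phi_def gradient_at_def polars_def)

lemma eval_polars: "(\<lambda>j. pv x (polars j)) = ($) (phi x)"
  by (simp add: phi_nth fun_eq_iff)

lemma phi_scale: "phi (k *s x) = k ^ 2 *s phi x"
  by (simp add: cart_eq_iff phi_nth pv_scale[OF homogeneous_polars])

lemma hessian_nth: "hessian_at f x $ i $ j = pv x (pdiff i (pdiff j f))"
  by (simp add: hessian_at_def)

lemma gradient_polars: "gradient_at (polars j) x $ i = hessian_at f x $ i $ j"
  by (simp add: gradient_at_def polars_def hessian_at_def)

lemma dotp_gradient_polars: "dotp (gradient_at (polars j) x) u = (hessian_at f x *v u) $ j"
  by (simp add: dotp_def gradient_polars matrix_vector_mult_def hessian_nth pdiff_commute[of _ j])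

text \<open>The third derivatives of a cubic are constants, symmetric in the three indices, so both
  sides come from one symmetric trilinear form.\<close>

lemma hessian_commute: "hessian_at f x *v y = hessian_at f y *v x"
proof -
  define t where "t = (\<lambda>l i j. pv 0 (pdiff l (pdiff i (pdiff j f))))"
  have ev: "pv x (pdiff i (pdiff j f)) = (\<Sum>l\<in>UNIV. t l i j * x $ l)" for x i j
  proof -
    have "homogeneous 1 (pdiff i (pdiff j f))"
      using homogeneous_pdiff[OF homogeneous_polars, of i j] by (simp add: polars_def)
    from linear_form_gradient[OF this, of x 0] show ?thesis
      by (simp add: dotp_def gradient_at_def t_def)
  qed
  have sym: "t l i j = t j i l" for l i j
    unfolding t_def by (metis pdiff_commute)
  have "(hessian_at f x *v y) $ i = (hessian_at f y *v x) $ i" for i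
  proof -
    have "(hessian_at f x *v y) $ i = (\<Sum>j\<in>UNIV. \<Sum>l\<in>UNIV. t l i j * x $ l * y $ j)"
      by (simp add: matrix_vector_mult_def hessian_nth ev sum_distrib_right)
    also have "\<dots> = (\<Sum>l\<in>UNIV. \<Sum>j\<in>UNIV. t j i l * y $ j * x $ l)"
      by (subst sum.swap) (simp add: sym[of _ i] mult_ac)
    also have "\<dots> = (hessian_at f y *v x) $ i"
      by (simp add: matrix_vector_mult_def hessian_nth ev sum_distrib_right)
    finally show ?thesis .
  qed
  thus ?thesis by (simp add: cart_eq_iff)
qed

lemma hessian_scale: "hessian_at f (k *s x) *v u = k *s (hessian_at f x *v u)"
  by (simp add: hessian_commute[of _ u] vector_scalar_commute)

definition ker :: "'a ^ 'n \<Rightarrow> ('a ^ 'n) set" where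
  "ker x = {u. hessian_at f x *v u = 0}"

lemma ker_eq: "ker x = {u. \<forall>j. dotp (gradient_at (polars j) x) u = 0}"
  by (auto simp: ker_def dotp_gradient_polars cart_eq_iff)

lemma subspace_ker: "vec.subspace (ker x)"
  unfolding ker_eq dual_space_gradients[symmetric] by (rule subspace_dual_space)

lemma grank_ker: "grank polars x + vec.dim (ker x) = CARD('n)"
  unfolding ker_eq by (rule grank_eq)

text \<open>The vanishing Hessian enters here: the determinant is zero at every point, so every
  kernel contains a nonzero vector.\<close>

lemma grank_polars_less: "grank polars x < CARD('n)"
proof -
  have "Determinants.det (hessian_at f x) =
      pv x (Determinants.det ((\<chi> i j. pdiff i (pdiff j f)) :: ('n, 'a) mpoly ^ 'n ^ 'n))"
    by (simp add: Determinants.det_def hessian_at_def)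
  also have "\<dots> = 0" using hess unfolding vanishing_hessian_def by simp
  finally have "\<not> invertible (hessian_at f x)" by (simp add: invertible_det_nz)
  hence "\<not> inj ((*v) (hessian_at f x))"
    unfolding invertible_left_inverse matrix_left_invertible_injective .
  then obtain u where "u \<noteq> 0" "hessian_at f x *v u = 0"
    by (metis matrix_left_invertible_injective matrix_left_invertible_ker)
  hence "\<not> ker x \<subseteq> {0}" by (auto simp: ker_def)
  hence "vec.dim (ker x) \<noteq> 0" by (simp add: vec.dim_eq_0)
  thus ?thesis using grank_ker[of x] by linarith
qed

lemma polar_nonvanishing: "\<exists>i x. pv x (polars i) \<noteq> 0"
proof (rule ccontr)
  assume "\<nexists>i x. pv x (polars i) \<noteq> 0"
  hence "polars i = 0" for i using homogeneous_zero_test[OF homogeneous_polars] by blast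
  hence "vars f = {}" using pdiff_eq_0_imp[of _ f] by (auto simp: polars_def)
  hence "f = Poly_Mapping.single 0 (Poly_Mapping.lookup f 0)" by (rule vars_empty_imp_const)
  moreover from this have "homogeneous 3 (Poly_Mapping.single 0 (Poly_Mapping.lookup f 0) :: ('n, 'a) mpoly)"
    using f3 by simp
  hence "Poly_Mapping.lookup f 0 = 0" by simp
  ultimately show False using f0 by simp
qed

subsection \<open>Relations between the partial derivatives\<close>

definition rels :: "('n, 'a) mpoly set" where
  "rels = {F. (\<exists>d. homogeneous d F) \<and> relation polars F}"

text \<open>The conormal space of the polar image at \<open>phi x\<close>.\<close>

definition rel_span :: "'a ^ 'n \<Rightarrow> ('a ^ 'n) set" where
  "rel_span x = vec.span ((\<lambda>F. gradient_at F (phi x)) ` rels)"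

definition gl :: "('n, 'a) mpoly list \<Rightarrow> 'a ^ 'n \<Rightarrow> ('a ^ 'n) list" where
  "gl Fs x = map (\<lambda>F. gradient_at F (phi x)) Fs"

definition gp :: "('n, 'a) mpoly list \<Rightarrow> 'n list \<Rightarrow> ('n, 'a) mpoly" where
  "gp Fs = ppluecker (map (\<lambda>F i. psubst polars (pdiff i F)) Fs)"

lemma length_gl [simp]: "length (gl Fs x) = length Fs"
  by (simp add: gl_def)

lemma pv_gp: "pv x (gp Fs I) = pluecker (gl Fs x) I"
proof -
  have "map (\<lambda>w. \<chi> i. pv x (w i)) (map (\<lambda>F i. psubst polars (pdiff i F)) Fs) = gl Fs x"
    by (simp add: gl_def gradient_at_def eval_polars)
  thus ?thesis by (simp add: gp_def peval_ppluecker)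
qed

lemma homogeneous_gp:
  assumes "set Fs \<subseteq> rels"
  shows "\<exists>e. \<forall>I. homogeneous e (gp Fs I)"
proof -
  have "\<exists>d. homogeneous d F" if "F \<in> set Fs" for F using assms that by (auto simp: rels_def)
  then obtain d where d: "\<And>F. F \<in> set Fs \<Longrightarrow> homogeneous (d F) F" by metis
  let ?ws = "map (\<lambda>F i. psubst polars (pdiff i F)) Fs"
  have "homogeneous (\<Sum>k<length ?ws. 2 * (d (Fs ! k) - 1)) (gp Fs I)" for I
    unfolding gp_def
  proof (rule homogeneous_ppluecker)
    fix k i assume k: "k < length ?ws"
    hence "homogeneous (d (Fs ! k)) (Fs ! k)" using d by simp
    hence "homogeneous (2 * (d (Fs ! k) - 1)) (psubst polars (pdiff i (Fs ! k)))"
      by (intro homogeneous_psubst homogeneous_pdiff homogeneous_polars)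
    thus "homogeneous (2 * (d (Fs ! k) - 1)) ((?ws ! k) i)" using k by simp
  qed
  thus ?thesis by blast
qed

lemma gl_in_rel_span: "set Fs \<subseteq> rels \<Longrightarrow> set (gl Fs x) \<subseteq> rel_span x"
  unfolding gl_def rel_span_def by (auto intro!: vec.span_base)

text \<open>Differentiating F(phi x) = 0 with respect to \<open>x\<close> yields the symmetric
  Hessian applied to the gradient of \<open>F\<close> at \<open>phi x\<close>.\<close>

lemma rel_span_subset_ker: "rel_span x \<subseteq> ker x"
  unfolding rel_span_def
proof (rule vec.span_minimal[OF _ subspace_ker], safe)
  fix F assume "F \<in> rels"
  hence "relation polars F" by (simp add: rels_def)
  from relation_gradient[OF finite_class.finite_UNIV subset_UNIV this, of x]
  have s: "(\<Sum>v\<in>UNIV. pv (phi x) (pdiff v F) *s gradient_at (polars v) x) = 0"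
    by (simp add: eval_polars)
  have "(hessian_at f x *v gradient_at F (phi x)) $ i = 0" for i
  proof -
    have "(\<Sum>v\<in>UNIV. pv (phi x) (pdiff v F) *s gradient_at (polars v) x) $ i = 0" using s by simp
    thus ?thesis
      by (simp add: matrix_vector_mult_def gradient_polars gradient_at_def[of F] mult.commute)
  qed
  thus "gradient_at F (phi x) \<in> ker x" by (simp add: ker_def cart_eq_iff)
qed

lemma basis_of_rel_span:
  "\<exists>Fs. set Fs \<subseteq> rels \<and> indep_list (gl Fs x) \<and> length Fs = vec.dim (rel_span x) \<and> vec.span (set (gl Fs x)) = rel_span x"
proof -
  obtain vs where vs: "set vs \<subseteq> (\<lambda>F. gradient_at F (phi x)) ` rels" "indep_list vs"
    "vec.span (set vs) = rel_span x" "length vs = vec.dim ((\<lambda>F. gradient_at F (phi x)) ` rels)"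
    using indep_list_spanning_exists unfolding rel_span_def by metis
  have "\<forall>v\<in>set vs. \<exists>F. F \<in> rels \<and> gradient_at F (phi x) = v" using vs(1) by auto
  then obtain h where h: "\<And>v. v \<in> set vs \<Longrightarrow> h v \<in> rels \<and> gradient_at (h v) (phi x) = v"
    by metis
  have "gl (map h vs) x = vs" using h by (simp add: gl_def map_idI)
  moreover have "set (map h vs) \<subseteq> rels" using h by auto
  moreover have "length (map h vs) = vec.dim (rel_span x)" using vs(4) by (simp add: rel_span_def)
  ultimately show ?thesis using vs by metis
qed

lemma gl_indep_open:
  assumes "indep_list (gl Fs p)" "set Fs \<subseteq> rels"
  shows "\<exists>\<eta> e. homogeneous e \<eta> \<and> pv p \<eta> \<noteq> 0 \<and> (\<forall>x. pv x \<eta> \<noteq> 0 \<longrightarrow> indep_list (gl Fs x))"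
proof -
  obtain I where "pluecker (gl Fs p) I \<noteq> 0" using indep_imp_pluecker_nonzero[OF assms(1)] by blast
  hence "pv p (gp Fs I) \<noteq> 0" by (simp add: pv_gp)
  moreover have "indep_list (gl Fs x)" if "pv x (gp Fs I) \<noteq> 0" for x
    using that pluecker_nonzero_imp_indep[of "gl Fs x" I] by (simp add: pv_gp)
  ultimately show ?thesis using homogeneous_gp[OF assms(2)] by blast
qed

lemma indep_gl_dim: "indep_list (gl Fs x) \<Longrightarrow> set Fs \<subseteq> rels \<Longrightarrow> length Fs \<le> vec.dim (rel_span x)"
  using vec.dim_subset[OF gl_in_rel_span[of Fs x]] unfolding indep_list_iff_dim by simp

end

locale cubic_rank = cubic f for f :: "('n::finite, 'a::field_char_0) mpoly" +
  fixes r :: nat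
  assumes rank_le: "\<And>x. grank polars x \<le> r" and rank_attained: "\<exists>x. grank polars x = r"
begin

lemma rank_open: "\<exists>\<eta> e p. homogeneous e \<eta> \<and> pv p \<eta> \<noteq> 0 \<and> (\<forall>x. pv x \<eta> \<noteq> 0 \<longrightarrow> grank polars x = r)"
proof -
  obtain p where p: "grank polars p = r" using rank_attained by blast
  from grank_open[of 2 polars p, OF homogeneous_polars] p rank_le show ?thesis
    by (metis le_antisym)
qed

text \<open>At a special \<open>x\<close> the kernel of the Hessian may be too large to give this
  bound. Relation gradients independent at \<open>x\<close> stay independent at a general
  \<open>y\<close>, where the kernel has the generic dimension.\<close>

lemma dim_rel_span_le: "vec.dim (rel_span x) \<le> CARD('n) - r"
proof -
  obtain Fs where Fs: "set Fs \<subseteq> rels" "indep_list (gl Fs x)" "length Fs = vec.dim (rel_span x)"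
    using basis_of_rel_span by metis
  obtain \<eta> where \<eta>: "pv x \<eta> \<noteq> 0" "\<And>y. pv y \<eta> \<noteq> 0 \<Longrightarrow> indep_list (gl Fs y)"
    using gl_indep_open[OF Fs(2,1)] by blast
  obtain \<zeta> p where \<zeta>: "pv p \<zeta> \<noteq> 0" "\<And>y. pv y \<zeta> \<noteq> 0 \<Longrightarrow> grank polars y = r"
    using rank_open by blast
  obtain y where y: "pv y \<eta> \<noteq> 0" "pv y \<zeta> \<noteq> 0"
    using nonvanishing_pair_line[OF \<eta>(1) \<zeta>(1)] by blast
  have "length Fs \<le> vec.dim (rel_span y)" using indep_gl_dim[OF \<eta>(2)[OF y(1)] Fs(1)] .
  also have "\<dots> \<le> vec.dim (ker y)" by (rule vec.dim_subset[OF rel_span_subset_ker])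
  also have "\<dots> = CARD('n) - r" using grank_ker[of y] \<zeta>(2)[OF y(2)] by simp
  finally show ?thesis using Fs(3) by simp
qed

text \<open>Choose \<open>S\<close> with \<open>r\<close> algebraically independent polars. Every
  other index \<open>j\<close> has a relation in the variables \<open>insert j S\<close>. On the
  coordinates outside \<open>S\<close> the gradients of these relations form a diagonal matrix, with
  nonzero entries at a general point.\<close>

lemma dim_rel_span_attained: "\<exists>p. vec.dim (rel_span p) = CARD('n) - r"
proof -
  obtain p where p: "grank polars p = r" using rank_attained by blast
  obtain S where S: "finite S" "card S = r" "lin_indep (\<lambda>v. gradient_at (polars v) p) S"
    using independent_gradients_exist[of polars p] p by auto
  have ai: "alg_indep polars S"
    by (rule lin_indep_imp_alg_indep[OF S(1) homogeneous_polars S(3)])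
  have dep: "\<not> alg_indep polars (insert j S)" if "j \<notin> S" for j
  proof
    assume A: "alg_indep polars (insert j S)"
    obtain q where "lin_indep (\<lambda>v. gradient_at (polars v) q) (insert j S)"
      using alg_indep_imp_lin_indep[OF _ homogeneous_polars _ A] by auto
    hence "card (insert j S) \<le> r" using lin_indep_card_le_grank[of "insert j S" polars q] rank_le[of q] by simp
    thus False using that S by simp
  qed
  have "\<exists>F. F \<in> rels \<and> vars F \<subseteq> insert j S \<and> (\<exists>x. pv x (psubst polars (pdiff j F)) \<noteq> 0)"
    if "j \<notin> S" for j
    using algebraic_relation_nondegenerate[OF ai dep[OF that]] unfolding rels_def by auto
  then obtain F where F: "\<And>j. j \<notin> S \<Longrightarrow> F j \<in> rels" "\<And>j. j \<notin> S \<Longrightarrow> vars (F j) \<subseteq> insert j S"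
    "\<And>j. j \<notin> S \<Longrightarrow> \<exists>x. pv x (psubst polars (pdiff j (F j))) \<noteq> 0" by metis
  have "\<exists>x. \<forall>G\<in>(\<lambda>j. psubst polars (pdiff j (F j))) ` (- S). pv x G \<noteq> 0"
    by (rule nonvanishing_common) (use F(3) in auto)
  then obtain x where x: "\<And>j. j \<notin> S \<Longrightarrow> pv x (psubst polars (pdiff j (F j))) \<noteq> 0" by auto
  have "lin_indep (\<lambda>j. gradient_at (F j) (phi x)) (- S)"
    unfolding lin_indep_def
  proof (intro allI impI ballI)
    fix c k assume c: "(\<Sum>j\<in>- S. c j *s gradient_at (F j) (phi x)) = 0" and k: "k \<in> - S"
    have z: "gradient_at (F j) (phi x) $ k = 0" if "j \<in> - S" "j \<noteq> k" for j
    proof -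
      have "k \<notin> vars (F j)" using F(2)[of j] that k by auto
      thus ?thesis by (simp add: gradient_at_def pdiff_eq_0)
    qed
    have "0 = (\<Sum>j\<in>- S. c j *s gradient_at (F j) (phi x)) $ k" using c by simp
    also have "\<dots> = (\<Sum>j\<in>- S. c j * gradient_at (F j) (phi x) $ k)" by simp
    also have "\<dots> = (\<Sum>j\<in>{k}. c j * gradient_at (F j) (phi x) $ k)"
      by (rule sum.mono_neutral_right) (use k z in auto)
    finally have "c k * pv x (psubst polars (pdiff k (F k))) = 0"
      by (simp add: gradient_at_def eval_polars)
    thus "c k = 0" using x k by simp
  qed
  hence "card (- S) = vec.dim ((\<lambda>j. gradient_at (F j) (phi x)) ` (- S))"
    by (simp add: lin_indep_iff_dim)
  also have "\<dots> \<le> vec.dim (rel_span x)"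
    unfolding rel_span_def by (rule vec.dim_subset) (use F(1) in \<open>auto intro!: vec.span_base\<close>)
  finally have "CARD('n) - r \<le> vec.dim (rel_span x)"
    using S by (simp add: Compl_eq_Diff_UNIV card_Diff_subset)
  thus ?thesis using dim_rel_span_le[of x] by (intro exI[of _ x]) simp
qed

subsection \<open>The polar image\<close>

lemma polar_map_span:
  assumes "x \<noteq> 0"
  shows "polar_map f (vec.span {x}) = vec.span {phi x}"
proof
  show "polar_map f (vec.span {x}) \<subseteq> vec.span {phi x}"
    unfolding polar_map_def
  proof (intro vec.span_minimal image_subsetI)
    fix w assume "w \<in> vec.span {x} - {0}"
    then obtain k where "w = k *s x" using span_singleton_nonzero[of w x] by auto
    hence "gradient_at f w = k ^ 2 *s phi x" using phi_scale by (simp add: phi_def)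
    thus "gradient_at f w \<in> vec.span {phi x}" by (simp add: vec.span_scale vec.span_base)
  qed simp
  show "vec.span {phi x} \<subseteq> polar_map f (vec.span {x})"
    unfolding polar_map_def phi_def
    by (rule vec.span_mono) (use assms vec.span_base[of x "{x}"] in auto)
qed

lemma polar_domain_span:
  assumes "x \<noteq> 0"
  shows "vec.span {x} \<in> polar_domain f \<longleftrightarrow> phi x \<noteq> 0"
proof -
  have "vec.span {x} \<in> proj_points UNIV" using assms by (simp add: span_proj_point)
  moreover have "vec.span {phi x} \<in> proj_points UNIV \<longleftrightarrow> phi x \<noteq> 0"
    by (cases "phi x = 0") (auto simp: span_proj_point proj_points_def)
  ultimately show ?thesis by (simp add: polar_domain_def polar_map_span[OF assms])
qed

lemma phi_zero: "phi 0 = 0"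
  using phi_scale[of 0 0] by simp

lemma polar_image_points: "polar_map f ` polar_domain f = {vec.span {phi x} |x. phi x \<noteq> 0}"
proof (intro subset_antisym subsetI)
  fix z assume "z \<in> polar_map f ` polar_domain f"
  then obtain p where p: "p \<in> polar_domain f" "z = polar_map f p" by blast
  hence "p \<in> proj_points UNIV" by (simp add: polar_domain_def)
  then obtain x where x: "x \<noteq> 0" "p = vec.span {x}" by (rule proj_points_cases)
  show "z \<in> {vec.span {phi x} |x. phi x \<noteq> 0}"
    using p x polar_domain_span[OF x(1)] polar_map_span[OF x(1)] by auto
next
  fix z assume "z \<in> {vec.span {phi x} |x. phi x \<noteq> 0}"
  then obtain x where x: "phi x \<noteq> 0" "z = vec.span {phi x}" by blast
  hence "x \<noteq> 0" using phi_zero by auto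
  thus "z \<in> polar_map f ` polar_domain f"
    using x polar_domain_span polar_map_span by blast
qed

lemma polars_realized:
  assumes "phi x \<noteq> 0"
  shows "proj.realized polars x"
  unfolding proj.realized_def
proof (intro bexI exI conjI)
  show "(\<lambda>i. pv x (polars i)) = (\<lambda>i. 1 * (phi x) $ i)" by (simp add: eval_polars)
  show "($) (phi x) \<in> {($) v |v. v \<in> vec.span {phi x} \<and> v \<noteq> 0}"
    using assms vec.span_base[of "phi x" "{phi x}"] by auto
  show "vec.span {phi x} \<in> proj_points UNIV" using assms by (simp add: span_proj_point)
qed simp

text \<open>Image points exist only where \<open>phi\<close> is nonzero; multiplying by a polar that
  is not identically zero, and cancelling it, removes this restriction.\<close>

lemma polar_image_parametrized: "proj.parametrized (polar_image f) polars"
proof -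
  obtain i x where ix: "pv x (polars i) \<noteq> 0" using polar_nonvanishing by blast
  have nz: "phi y \<noteq> 0" if "pv y (polars i) \<noteq> 0" for y using that by (metis phi_nth zero_index)
  let ?A = "{vec.span {phi x} |x. phi x \<noteq> 0}"
  have AP: "?A \<subseteq> proj_points UNIV" by (auto simp: span_proj_point)
  have v: "(\<forall>y\<in>?A. proj.vanish F y) \<longleftrightarrow> relation polars F" if F: "homogeneous d F" for d F
  proof
    assume L: "\<forall>y\<in>?A. proj.vanish F y"
    have "pv y (psubst polars F) * pv y (polars i) = 0" for y
    proof (cases "phi y = 0")
      case False
      hence "proj.vanish F (vec.span {phi y})" using L by blast
      thus ?thesis using proj_vanish_span[OF F False] by (simp add: eval_polars)
    qed (use nz in auto)
    from vanishing_mult[OF this ix] show "relation polars F" by simp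
  next
    assume "relation polars F"
    thus "\<forall>y\<in>?A. proj.vanish F y" using proj_vanish_span[OF F] by (auto simp: eval_polars)
  qed
  have "polar_image f = proj.locus polars"
    unfolding polar_image_def polar_image_points zariski_proj_eq
    by (rule proj.closure_eq_locus[OF AP v])
  thus ?thesis using proj.parametrized_locus[OF polars_realized[OF nz] ix] by simp
qed

lemma polar_in_image: "phi x \<noteq> 0 \<Longrightarrow> vec.span {phi x} \<in> polar_image f"
proof -
  assume x: "phi x \<noteq> 0"
  have "vec.span {phi x} \<in> proj.locus polars"
    unfolding proj.locus_def using x proj_vanish_span[of _ _ "phi x"]
    by (auto simp: span_proj_point eval_polars)
  thus ?thesis using proj.parametrized_imp_locus[OF polar_image_parametrized] by simp
qed

lemma vanishes_on_polar_image:
  assumes "homogeneous d F"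
  shows "vanishes_on F (polar_image f) \<longleftrightarrow> relation polars F"
proof -
  have P: "polar_image f \<subseteq> proj_points UNIV"
    using polar_image_parametrized by (simp add: proj.parametrized_def proj.closedin_zariski)
  have "(\<forall>v\<in>z - {0}. pv v F = 0) \<longleftrightarrow> proj.vanish F z" if z: "z \<in> polar_image f" for z
  proof -
    have zP: "z \<in> proj_points UNIV" using z P by blast
    have "pv v F = 0 \<longleftrightarrow> proj.vanish F z" if "v \<in> z" "v \<noteq> 0" for v
      using proj.vanish_iff1[OF assms zP, of "($) v"] that by blast
    thus ?thesis using proj_point_exists[OF zP] by blast
  qed
  hence "vanishes_on F (polar_image f) \<longleftrightarrow> (\<forall>z\<in>polar_image f. proj.vanish F z)"
    unfolding vanishes_on_def by (rule ball_cong[OF refl])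
  also have "\<dots> \<longleftrightarrow> relation polars F"
    using polar_image_parametrized assms by (simp add: proj.parametrized_def)
  finally show ?thesis .
qed

text \<open>Along a line the gradients of a form are proportional, so the single vector
  \<open>y\<close> suffices, and the forms vanishing on the polar image are the relations.\<close>

lemma tangent_space_polar:
  assumes y: "y \<noteq> 0"
  shows "tangent_space (polar_image f) (vec.span {y}) = dual_space ((\<lambda>F. gradient_at F y) ` rels)"
proof -
  have K: "(\<forall>v\<in>vec.span {y} - {0}. (\<Sum>i\<in>UNIV. pv v (pdiff i F) * u $ i) = 0) \<longleftrightarrow> dotp (gradient_at F y) u = 0"
    if F: "homogeneous d F" for F d u
  proof -
    have s: "(\<Sum>i\<in>UNIV. pv (k *s y) (pdiff i F) * u $ i) = k ^ (d - 1) * dotp (gradient_at F y) u" for k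
      using homogeneous_pdiff[OF F]
      by (simp add: pv_scale[of "d - 1"] dotp_def gradient_at_def sum_distrib_left mult.assoc)
    show ?thesis
    proof
      assume L: "\<forall>v\<in>vec.span {y} - {0}. (\<Sum>i\<in>UNIV. pv v (pdiff i F) * u $ i) = 0"
      have "y \<in> vec.span {y} - {0}" using y by (simp add: vec.span_base)
      hence "(\<Sum>i\<in>UNIV. pv y (pdiff i F) * u $ i) = 0" using L by blast
      thus "dotp (gradient_at F y) u = 0" by (simp add: dotp_def gradient_at_def)
    next
      assume R: "dotp (gradient_at F y) u = 0"
      show "\<forall>v\<in>vec.span {y} - {0}. (\<Sum>i\<in>UNIV. pv v (pdiff i F) * u $ i) = 0"
      proof
        fix v assume "v \<in> vec.span {y} - {0}"
        then obtain k where "v = k *s y" using span_singleton_nonzero[of v y] by auto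
        thus "(\<Sum>i\<in>UNIV. pv v (pdiff i F) * u $ i) = 0" using s[of k] R by simp
      qed
    qed
  qed
  show ?thesis
  proof (intro subset_antisym subsetI)
    fix u assume u: "u \<in> tangent_space (polar_image f) (vec.span {y})"
    have "dotp (gradient_at F y) u = 0" if F: "F \<in> rels" for F
    proof -
      obtain d where d: "homogeneous d F" "relation polars F" using F by (auto simp: rels_def)
      thus ?thesis using u K[OF d(1)] vanishes_on_polar_image[OF d(1)]
        unfolding tangent_space_def by blast
    qed
    thus "u \<in> dual_space ((\<lambda>F. gradient_at F y) ` rels)" by (simp add: dual_space_eq)
  next
    fix u assume u: "u \<in> dual_space ((\<lambda>F. gradient_at F y) ` rels)"
    show "u \<in> tangent_space (polar_image f) (vec.span {y})"
      unfolding tangent_space_def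
    proof (rule CollectI, intro allI impI)
      fix F d assume F: "homogeneous d F \<and> vanishes_on F (polar_image f)"
      hence "F \<in> rels" using vanishes_on_polar_image[of d F] unfolding rels_def by blast
      hence "dotp (gradient_at F y) u = 0" using u by (simp add: dual_space_eq)
      thus "\<forall>v\<in>vec.span {y} - {0}. (\<Sum>i\<in>UNIV. pv v (pdiff i F) * u $ i) = 0"
        using K F by blast
    qed
  qed
qed

lemma perazzo_map_span:
  assumes "x \<noteq> 0" "phi x \<noteq> 0"
  shows "perazzo_map f (vec.span {x}) = rel_span x"
  unfolding perazzo_map_def polar_map_span[OF assms(1)] tangent_space_polar[OF assms(2)]
    dim_dual_space(2) rel_span_def ..

lemma proj_dim_polar_image: "proj_dim (polar_image f) = enat (r - 1)" and rank_pos: "r > 0"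
proof -
  obtain i x where ix: "pv x (polars i) \<noteq> 0" using polar_nonvanishing by blast
  have nz: "phi y \<noteq> 0" if "pv y (polars i) \<noteq> 0" for y using that by (metis phi_nth zero_index)
  obtain \<zeta> q where \<zeta>: "pv q \<zeta> \<noteq> 0" "\<And>y. pv y \<zeta> \<noteq> 0 \<Longrightarrow> grank polars y = r"
    using rank_open by blast
  obtain p where p: "pv p (polars i) \<noteq> 0" "pv p \<zeta> \<noteq> 0"
    using nonvanishing_pair_line[OF ix \<zeta>(1)] by blast
  have pr: "grank polars p = r" using \<zeta>(2) p by blast
  have m: "grank polars y \<le> grank polars p" for y using rank_le pr by simp
  note K = proj.krull_dim_parametrized[OF polar_image_parametrized homogeneous_polars _
      polars_realized[OF nz] p(1) m, unfolded pr]
  show "proj_dim (polar_image f) = enat (r - 1)" "r > 0"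
    using K by (simp_all add: proj_dim_def zariski_proj_eq)
qed

lemma codim_eq: "codim_polar_image f = CARD('n) - r"
  using rank_pos by (simp add: codim_polar_image_def proj_dim_polar_image)

lemma rank_less: "r < CARD('n)"
  using grank_polars_less rank_attained by metis

text \<open>Smoothness at \<open>phi x\<close> means tangent dimension \<open>r\<close>, that is,
  conormal dimension \<open>CARD('n) - r\<close>; elsewhere the conormal space is smaller.\<close>

lemma perazzo_domain_span:
  assumes x: "x \<noteq> 0"
  shows "vec.span {x} \<in> perazzo_domain f \<longleftrightarrow> phi x \<noteq> 0 \<and> vec.dim (rel_span x) = CARD('n) - r"
proof (cases "phi x = 0")
  case False
  have "vec.dim (rel_span x) + vec.dim (tangent_space (polar_image f) (vec.span {phi x})) = CARD('n)"
    unfolding tangent_space_polar[OF False] rel_span_def using dim_dual_space(1) by simp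
  moreover have "enat (r - 1) + 1 = enat r" using rank_pos by (simp add: one_enat_def)
  ultimately have "vec.span {phi x} \<in> smooth_locus (polar_image f) \<longleftrightarrow> vec.dim (rel_span x) = CARD('n) - r"
    using polar_in_image[OF False] rank_less
    by (auto simp: smooth_locus_def proj_dim_polar_image)
  thus ?thesis using False
    by (simp add: perazzo_domain_def polar_domain_span[OF x] polar_map_span[OF x])
qed (simp add: perazzo_domain_def polar_domain_span[OF x])

end

section \<open>The Perazzo image\<close>

text \<open>The relations \<open>Fs\<close> are fixed so that their gradients form a basis of the
  conormal space wherever \<open>\<eta>\<close> is nonzero; there the Perazzo map has polynomial
  Pluecker coordinates. Where \<open>\<zeta>\<close> is nonzero the Hessian has its generic
  rank.\<close>

locale cubic_frame = cubic_rank f r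
  for f :: "('n::finite, 'a::field_char_0) mpoly" and r :: nat +
  fixes Fs :: "('n, 'a) mpoly list" and i0 :: 'n and \<eta> \<zeta> :: "('n, 'a) mpoly" and e :: nat
  assumes Fs_rels: "set Fs \<subseteq> rels" and Fs_length: "length Fs = CARD('n) - r"
    and \<eta>: "\<And>x. pv x \<eta> \<noteq> 0 \<Longrightarrow> indep_list (gl Fs x)" and \<eta>_nz: "\<exists>x. pv x \<eta> \<noteq> 0"
    and \<zeta>: "\<And>x. pv x \<zeta> \<noteq> 0 \<Longrightarrow> grank polars x = r" and \<zeta>_nz: "\<exists>x. pv x \<zeta> \<noteq> 0"
    and i0: "\<exists>x. pv x (polars i0) \<noteq> 0"
    and e: "\<And>I. homogeneous e (gp Fs I)"
begin

text \<open>The extra factor \<open>X i0\<close> makes the degree positive even when \<open>gp Fs\<close> is constant, that is,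
  when all relations in \<open>Fs\<close> are linear and the cubic is a cone.\<close>

definition gw :: "'n list \<Rightarrow> ('n, 'a) mpoly" where
  "gw I = X i0 * gp Fs I"

lemma homogeneous_gw: "homogeneous (Suc e) (gw I)"
  using homogeneous_mult[OF homogeneous_X e, of i0 I] by (simp add: gw_def)

lemma pv_gw: "pv x (gw I) = x $ i0 * pluecker (gl Fs x) I"
  by (simp add: gw_def pv_gp)

lemma subspace_rel_span: "vec.subspace (rel_span x)"
  by (simp add: rel_span_def)

lemma span_gl:
  assumes "indep_list (gl Fs x)"
  shows "vec.span (set (gl Fs x)) = rel_span x" and "vec.dim (rel_span x) = CARD('n) - r"
proof -
  have d: "vec.dim (set (gl Fs x)) = CARD('n) - r" using assms Fs_length unfolding indep_list_iff_dim by simp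
  have sub: "vec.span (set (gl Fs x)) \<subseteq> rel_span x"
    using gl_in_rel_span[OF Fs_rels] subspace_rel_span by (intro vec.span_minimal)
  show "vec.dim (rel_span x) = CARD('n) - r" using vec.dim_subset[OF sub] d dim_rel_span_le[of x] by simp
  thus "vec.span (set (gl Fs x)) = rel_span x"
    using vec.subspace_dim_equal[OF vec.subspace_span subspace_rel_span sub] d by simp
qed

lemma rel_span_eq_ker: "vec.dim (rel_span x) = CARD('n) - r \<Longrightarrow> grank polars x = r \<Longrightarrow> rel_span x = ker x"
  using vec.subspace_dim_equal[OF subspace_rel_span subspace_ker rel_span_subset_ker, of x] grank_ker[of x] by simp

lemma perazzo_points:
  "perazzo_map f ` perazzo_domain f = {rel_span x |x. phi x \<noteq> 0 \<and> vec.dim (rel_span x) = CARD('n) - r}"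
proof (intro subset_antisym subsetI)
  fix z assume "z \<in> perazzo_map f ` perazzo_domain f"
  then obtain p where p: "p \<in> perazzo_domain f" "z = perazzo_map f p" by blast
  hence "p \<in> proj_points UNIV" by (simp add: perazzo_domain_def polar_domain_def)
  then obtain x where x: "x \<noteq> 0" "p = vec.span {x}" by (rule proj_points_cases)
  show "z \<in> {rel_span x |x. phi x \<noteq> 0 \<and> vec.dim (rel_span x) = CARD('n) - r}"
    using p x perazzo_domain_span[OF x(1)] perazzo_map_span[OF x(1)] by auto
next
  fix z assume "z \<in> {rel_span x |x. phi x \<noteq> 0 \<and> vec.dim (rel_span x) = CARD('n) - r}"
  then obtain x where x: "phi x \<noteq> 0" "vec.dim (rel_span x) = CARD('n) - r" "z = rel_span x" by blast
  hence "x \<noteq> 0" using phi_zero by auto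
  thus "z \<in> perazzo_map f ` perazzo_domain f"
    using x perazzo_domain_span perazzo_map_span by (metis image_eqI)
qed

lemma vanish_rel_span_iff:
  assumes "homogeneous d F" "indep_list (gl Gs x)" "vec.span (set (gl Gs x)) = rel_span x" "length Gs = CARD('n) - r"
  shows "grass.vanish (CARD('n) - r) F (rel_span x) \<longleftrightarrow> peval (pluecker (gl Gs x)) F = 0"
proof (rule grass.vanish_iff1[OF assms(1)])
  have "vec.dim (rel_span x) = CARD('n) - r"
    using assms(2,4) unfolding assms(3)[symmetric] indep_list_iff_dim by simp
  thus "rel_span x \<in> grassmannian (CARD('n) - r)" using subspace_rel_span by (simp add: grassmannian_def)
  show "pluecker (gl Gs x) \<in> {pluecker vs |vs. length vs = CARD('n) - r \<and> vec.span (set vs) = rel_span x}"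
    by (rule CollectI, rule exI[of _ "gl Gs x"]) (simp add: assms(3,4))
qed

lemma gw_realized:
  assumes "pv x (\<eta> * X i0) \<noteq> 0"
  shows "grass.realized (CARD('n) - r) gw x"
  unfolding grass.realized_def
proof (intro bexI exI conjI)
  have x: "indep_list (gl Fs x)" "x $ i0 \<noteq> 0" using assms \<eta> by auto
  show "(\<lambda>I. pv x (gw I)) = (\<lambda>I. x $ i0 * pluecker (gl Fs x) I)" by (simp add: pv_gw)
  show "x $ i0 \<noteq> 0" by (rule x)
  show "pluecker (gl Fs x) \<in> {pluecker vs |vs. length vs = CARD('n) - r \<and> vec.span (set vs) = rel_span x}"
    by (rule CollectI, rule exI[of _ "gl Fs x"]) (simp add: span_gl(1)[OF x(1)] Fs_length)
  show "rel_span x \<in> grassmannian (CARD('n) - r)"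
    using span_gl(2)[OF x(1)] subspace_rel_span by (simp add: grassmannian_def)
qed

lemma peval_gw: "homogeneous d F \<Longrightarrow> peval (\<lambda>I. pv x (gw I)) F = (x $ i0) ^ d * peval (pluecker (gl Fs x)) F"
  unfolding pv_gw by (rule peval_scale)

lemma coordinate_nonvanishing: "\<exists>x :: 'a ^ 'n. pv x (X i) \<noteq> 0"
  by (rule exI[of _ "\<chi> i. 1"]) simp

lemma generic_point: "\<exists>x. pv x (\<eta> * X i0 * polars i0) \<noteq> 0"
proof -
  have "\<exists>x. \<forall>G\<in>{\<eta>, X i0, polars i0}. pv x G \<noteq> 0"
    by (rule nonvanishing_common) (use \<eta>_nz i0 coordinate_nonvanishing[of i0] in auto)
  thus ?thesis by auto
qed

text \<open>At a point of the Perazzo domain outside the open set where \<open>gl Fs\<close> is independent, another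
  basis \<open>gl Gs\<close> of relation gradients is used. Its Pluecker coordinates are proportional to those of
  \<open>gl Fs\<close> wherever the latter is independent, so the same forms vanish on them.\<close>

lemma perazzo_image_parametrized: "grass.parametrized (CARD('n) - r) (perazzo_image f) gw"
proof -
  let ?A = "{rel_span x |x. phi x \<noteq> 0 \<and> vec.dim (rel_span x) = CARD('n) - r}"
  obtain p where p: "pv p (\<eta> * X i0 * polars i0) \<noteq> 0" using generic_point by blast
  hence p': "pv p (\<eta> * X i0) \<noteq> 0" by auto
  have A: "?A \<subseteq> grassmannian (CARD('n) - r)" using subspace_rel_span by (auto simp: grassmannian_def)
  have v: "(\<forall>V\<in>?A. grass.vanish (CARD('n) - r) F V) \<longleftrightarrow> relation gw F" if F: "homogeneous d F" for d F
  proof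
    assume L: "\<forall>V\<in>?A. grass.vanish (CARD('n) - r) F V"
    have "pv y (psubst gw F) * pv y (\<eta> * X i0 * polars i0) = 0" for y
    proof (cases "pv y (\<eta> * X i0 * polars i0) = 0")
      case False
      hence ind: "indep_list (gl Fs y)" and "phi y \<noteq> 0" using \<eta> by (auto simp flip: phi_nth)
      hence "rel_span y \<in> ?A" using span_gl(2) by blast
      hence "grass.vanish (CARD('n) - r) F (rel_span y)" using L by blast
      hence "peval (pluecker (gl Fs y)) F = 0"
        using vanish_rel_span_iff[OF F ind span_gl(1)[OF ind] Fs_length] by simp
      thus ?thesis by (simp add: peval_gw[OF F])
    qed simp
    from vanishing_mult[OF this p] show "relation gw F" by simp
  next
    assume R: "relation gw F"
    show "\<forall>V\<in>?A. grass.vanish (CARD('n) - r) F V"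
    proof
      fix V assume "V \<in> ?A"
      then obtain x where x: "vec.dim (rel_span x) = CARD('n) - r" "V = rel_span x" by blast
      obtain Gs where Gs: "set Gs \<subseteq> rels" "indep_list (gl Gs x)" "length Gs = CARD('n) - r"
        "vec.span (set (gl Gs x)) = rel_span x" using basis_of_rel_span[of x] x(1) by metis
      have "pv y (psubst (gp Gs) F) * pv y (\<eta> * X i0) = 0" for y
      proof (cases "pv y (\<eta> * X i0) = 0")
        case False
        hence ind: "indep_list (gl Fs y)" and y: "y $ i0 \<noteq> 0" using \<eta> by auto
        have "set (gl Gs y) \<subseteq> vec.span (set (gl Fs y))"
          using gl_in_rel_span[OF Gs(1)] span_gl(1)[OF ind] by simp
        from pluecker_change_of_basis[OF this] obtain c where
          "\<And>I. pluecker (gl Gs y) I = c * pluecker (gl Fs y) I"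
          using Gs(3) Fs_length by auto
        hence "peval (\<lambda>I. pv y (gp Gs I)) F = c ^ d * peval (pluecker (gl Fs y)) F"
          by (simp add: pv_gp peval_scale[OF F])
        moreover have "peval (pluecker (gl Fs y)) F = 0"
          using R peval_gw[OF F, of y] y by simp
        ultimately show ?thesis by simp
      qed simp
      from vanishing_mult[OF this p'] have "pv x (psubst (gp Gs) F) = 0" .
      hence "peval (pluecker (gl Gs x)) F = 0" by (simp add: pv_gp)
      thus "grass.vanish (CARD('n) - r) F V" using vanish_rel_span_iff[OF F Gs(2,4,3)] x(2) by simp
    qed
  qed
  have "perazzo_image f = grass.locus (CARD('n) - r) gw"
    unfolding perazzo_image_def perazzo_points codim_eq zariski_grassmannian_eq
    by (rule grass.closure_eq_locus[OF A v])
  thus ?thesis using grass.parametrized_locus[OF gw_realized p'] by simp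
qed

section \<open>The linear space L(x) and the Jacobian of the Perazzo map\<close>

definition fibre_space :: "'a ^ 'n \<Rightarrow> ('a ^ 'n) set" where
  "fibre_space x = {u. ker x \<subseteq> ker u}"

text \<open>The symmetry H(u)v = H(v)u turns the inclusion of kernels into linear conditions on
  \<open>u\<close>.\<close>

lemma fibre_space_eq: "fibre_space x = (\<Inter>v\<in>ker x. ker v)"
  by (auto simp: fibre_space_def ker_def hessian_commute subset_iff)

lemma subspace_fibre_space: "vec.subspace (fibre_space x)"
  unfolding fibre_space_eq by (intro vec.subspace_Int subspace_ker)

lemma self_in_fibre_space: "x \<in> fibre_space x"
  by (simp add: fibre_space_def)

lemma rel_span_const_on_fibre_space:
  assumes "pv x \<eta> \<noteq> 0" "pv x \<zeta> \<noteq> 0" "y \<in> fibre_space x" "pv y \<eta> \<noteq> 0" "pv y \<zeta> \<noteq> 0"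
  shows "rel_span y = rel_span x"
proof -
  have d: "vec.dim (rel_span x) = CARD('n) - r" "vec.dim (rel_span y) = CARD('n) - r" using span_gl(2) \<eta> assms by blast+
  have "rel_span x = ker x" "rel_span y = ker y" using rel_span_eq_ker d \<zeta> assms by blast+
  hence "rel_span x \<subseteq> rel_span y" using assms(3) by (simp add: fibre_space_def)
  thus ?thesis using vec.subspace_dim_equal[OF subspace_rel_span subspace_rel_span, of x y] d by simp
qed

text \<open>The line through \<open>p\<close> in direction \<open>u\<close> stays in
  \<open>fibre_space p\<close>, where general points share one \<open>rel_span\<close>; the Pluecker
  vectors on it remain proportional to the one at \<open>p\<close>. The cross products
  \<open>R\<close> therefore vanish as polynomials in \<open>t\<close>. Their derivative at
  \<open>0\<close> gives the claim, with \<open>c\<close> the logarithmic derivative of a nonzero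
  coordinate \<open>J\<close>.\<close>

lemma derivative_on_fibre_space:
  assumes p: "pv p \<eta> \<noteq> 0" "pv p \<zeta> \<noteq> 0" "p $ i0 \<noteq> 0" and u: "u \<in> fibre_space p"
  shows "\<exists>c. \<forall>I. dotp (gradient_at (gw I) p) u = c * pv p (gw I)"
proof -
  define L where "L = (\<lambda>i. [:p $ i, u $ i:])"
  have ev: "poly (line_poly L G) t = pv (p + t *s u) G" for G t
  proof -
    have "(\<lambda>v. poly (L v) t) = ($) (p + t *s u)" by (rule ext) (simp add: L_def)
    thus ?thesis by simp
  qed
  obtain J where "pluecker (gl Fs p) J \<noteq> 0" using indep_imp_pluecker_nonzero[OF \<eta>[OF p(1)]] by blast
  hence J: "pv p (gw J) \<noteq> 0" using p(3) by (simp add: pv_gw)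
  have "dotp (gradient_at (gw I) p) u * pv p (gw J) = dotp (gradient_at (gw J) p) u * pv p (gw I)" for I
  proof -
    define R where "R = line_poly L (gw I) * [:pv p (gw J):] - line_poly L (gw J) * [:pv p (gw I):]"
    \<comment> \<open>The factor absorbs the parameters whose points are not general; it is nonzero
      at \<open>t = 0\<close> and is cancelled afterwards.\<close>
    have "R * line_poly L (\<eta> * \<zeta>) = 0"
    proof (rule poly_eqI_char_0)
      fix t
      define x where "x = p + t *s u"
      show "poly (R * line_poly L (\<eta> * \<zeta>)) t = poly 0 t"
      proof (cases "pv x (\<eta> * \<zeta>) = 0")
        case True
        thus ?thesis unfolding poly_mult ev x_def by simp
      next
        case False
        hence x: "pv x \<eta> \<noteq> 0" "pv x \<zeta> \<noteq> 0" by auto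
        have "x \<in> fibre_space p"
          unfolding x_def using u self_in_fibre_space subspace_fibre_space by (intro vec.subspace_add vec.subspace_scale)
        hence "rel_span x = rel_span p" using rel_span_const_on_fibre_space p x by blast
        hence "set (gl Fs x) \<subseteq> vec.span (set (gl Fs p))"
          using gl_in_rel_span[OF Fs_rels, of x] span_gl(1)[OF \<eta>[OF p(1)]] by simp
        from pluecker_change_of_basis[OF this] obtain c where
          "\<And>I. pluecker (gl Fs x) I = c * pluecker (gl Fs p) I" by auto
        hence "pv x (gw I) * pv p (gw J) = pv x (gw J) * pv p (gw I)" by (simp add: pv_gw)
        hence "poly R t = 0" unfolding R_def poly_diff poly_mult ev x_def by simp
        thus ?thesis by simp
      qed
    qed
    moreover have "poly (line_poly L (\<eta> * \<zeta>)) 0 \<noteq> 0" unfolding ev using p by simp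
    hence "line_poly L (\<eta> * \<zeta>) \<noteq> 0" by (metis poly_0)
    ultimately have "R = 0" by simp
    hence "line_poly L (gw I) * [:pv p (gw J):] = line_poly L (gw J) * [:pv p (gw I):]" by (simp add: R_def)
    hence "poly (pderiv (line_poly L (gw I) * [:pv p (gw J):])) 0 =
        poly (pderiv (line_poly L (gw J) * [:pv p (gw I):])) 0" by simp
    thus ?thesis
      by (simp add: pderiv_smult L_def pderiv_line_at_0 mult.commute)
  qed
  hence "\<forall>I. dotp (gradient_at (gw I) p) u = dotp (gradient_at (gw J) p) u / pv p (gw J) * pv p (gw I)"
    using J by (simp add: field_simps)
  thus ?thesis by blast
qed

text \<open>The vectors \<open>y l x\<close> lie in the kernel of H(x). Up to the factor
  \<open>x $ i0\<close>, the product rule at \<open>p\<close> gives H(u)y + H(p)dy = 0, where dy is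
  a multiple of y by assumption and is killed by H(p). So H(u) kills the vectors
  \<open>y l p\<close>, which span \<open>ker p\<close>.\<close>

lemma derivative_imp_fibre_space:
  assumes p: "pv p \<eta> \<noteq> 0" "pv p \<zeta> \<noteq> 0" "p $ i0 \<noteq> 0"
    and c: "\<And>I. dotp (gradient_at (gw I) p) u = c * pv p (gw I)"
  shows "u \<in> fibre_space p"
proof -
  have ind: "indep_list (gl Fs p)" using \<eta> p(1) .
  obtain I where I: "pluecker (gl Fs p) I \<noteq> 0" using indep_imp_pluecker_nonzero[OF ind] by blast
  have lI: "length I = CARD('n) - r" using pluecker_length[OF I] Fs_length by simp
  define y where "y = (\<lambda>l x. \<chi> i. pluecker (gl Fs x) (I[l := i]))"
  have yN: "y l x \<in> rel_span x" if "l < (CARD('n) - r)" for l x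
  proof -
    have "y l x \<in> vec.span ((!) (gl Fs x) ` {..<length (gl Fs x)})"
      unfolding y_def
      by (subst pluecker_update_column) (use lI that Fs_length in \<open>auto intro: combination_in_span\<close>)
    also have "(!) (gl Fs x) ` {..<length (gl Fs x)} = set (gl Fs x)" by (auto simp: set_conv_nth)
    also have "vec.span (set (gl Fs x)) \<subseteq> rel_span x"
      using gl_in_rel_span[OF Fs_rels] subspace_rel_span by (intro vec.span_minimal)
    finally show ?thesis .
  qed
  have yu: "y l p \<in> ker u" if l: "l < (CARD('n) - r)" for l
  proof -
    have "(hessian_at f u *v y l p) $ j = 0" for j
    proof -
      \<comment> \<open>Entry \<open>j\<close> of H(x) applied to \<open>x $ i0 *s y l x\<close>, as
        a polynomial in \<open>x\<close>.\<close>
      define Q where "Q = (\<Sum>i\<in>UNIV. pdiff j (pdiff i f) * gw (I[l := i]))"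
      have lin: "homogeneous 1 (pdiff j (pdiff i f))" for i
        using homogeneous_pdiff[OF homogeneous_polars, of j i] by (simp add: polars_def)
      have hy: "(\<Sum>i\<in>UNIV. pv x (pdiff j (pdiff i f)) * pv z (gw (I[l := i]))) =
          z $ i0 * (hessian_at f x *v y l z) $ j" for x z
        by (simp add: matrix_vector_mult_def hessian_nth pv_gw y_def sum_distrib_left mult_ac)
      have ky: "hessian_at f x *v y l x = 0" for x
        using yN[OF l, of x] rel_span_subset_ker[of x] by (auto simp: ker_def)
      have "pv x Q = 0" for x using hy[of x x] ky by (simp add: Q_def)
      hence "gradient_at Q p = 0" by (rule gradient_vanishing)
      hence "dotp (gradient_at Q p) u = 0" by simp
      hence "0 = (\<Sum>i\<in>UNIV. pv p (pdiff j (pdiff i f)) * dotp (gradient_at (gw (I[l := i])) p) u +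
          pv p (gw (I[l := i])) * dotp (gradient_at (pdiff j (pdiff i f)) p) u)"
        unfolding Q_def gradient_sum gradient_mult by simp
      also have "\<dots> = (\<Sum>i\<in>UNIV. c * (pv p (pdiff j (pdiff i f)) * pv p (gw (I[l := i]))) +
          pv u (pdiff j (pdiff i f)) * pv p (gw (I[l := i])))"
        by (simp add: c linear_form_gradient[OF lin, where x = u and p = p] mult_ac)
      also have "\<dots> = c * (p $ i0 * (hessian_at f p *v y l p) $ j) + p $ i0 * (hessian_at f u *v y l p) $ j"
        by (simp add: sum.distrib flip: sum_distrib_left hy)
      finally show ?thesis using p(3) ky by simp
    qed
    thus ?thesis by (simp add: ker_def cart_eq_iff)
  qed
  have "ker p = rel_span p" using rel_span_eq_ker[OF span_gl(2)[OF ind] \<zeta>[OF p(2)]] ..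
  also have "\<dots> = vec.span (set (gl Fs p))" using span_gl(1)[OF ind] ..
  also have "\<dots> \<subseteq> ker u"
  proof (rule vec.span_minimal[OF _ subspace_ker])
    have "set (gl Fs p) \<subseteq> vec.span ((\<lambda>l. y l p) ` {..<(CARD('n) - r)})"
      using basis_from_pluecker[OF I] Fs_length by (simp add: y_def)
    also have "\<dots> \<subseteq> ker u" by (rule vec.span_minimal[OF _ subspace_ker]) (use yu in auto)
    finally show "set (gl Fs p) \<subseteq> ker u" .
  qed
  finally show ?thesis by (simp add: fibre_space_def)
qed

text \<open>In direction \<open>p\<close> the coordinate vector changes by
  \<open>of_nat (Suc e)\<close> times itself. For \<open>u\<close> in \<open>fibre_space p\<close>,
  subtracting a suitable multiple of \<open>p\<close> therefore leaves a direction in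
  \<open>K\<close>.\<close>

lemma grank_gw:
  assumes p: "pv p \<eta> \<noteq> 0" "pv p \<zeta> \<noteq> 0" "p $ i0 \<noteq> 0"
  shows "grank gw p + vec.dim (fibre_space p) = CARD('n) + 1"
proof -
  define K where "K = {u. \<forall>I. dotp (gradient_at (gw I) p) u = 0}"
  have sK: "vec.subspace K"
    unfolding K_def dual_space_gradients[symmetric] by (rule subspace_dual_space)
  have KL: "K \<subseteq> fibre_space p"
  proof
    fix u assume "u \<in> K"
    thus "u \<in> fibre_space p" using derivative_imp_fibre_space[OF p, of u 0] by (simp add: K_def)
  qed
  obtain J where "pluecker (gl Fs p) J \<noteq> 0" using indep_imp_pluecker_nonzero[OF \<eta>[OF p(1)]] by blast
  hence J: "pv p (gw J) \<noteq> 0" using p(3) by (simp add: pv_gw)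
  have Ep: "dotp (gradient_at (gw I) p) p = of_nat (Suc e) * pv p (gw I)" for I
    by (rule Euler_identity[OF homogeneous_gw])
  have pK: "p \<notin> K"
  proof
    assume "p \<in> K"
    hence "of_nat (Suc e) * pv p (gw J) = 0" using Ep[of J] by (simp add: K_def)
    thus False using J by (simp del: of_nat_Suc)
  qed
  have "fibre_space p = vec.span (insert p K)"
  proof
    show "vec.span (insert p K) \<subseteq> fibre_space p"
      using KL self_in_fibre_space subspace_fibre_space by (intro vec.span_minimal) auto
    show "fibre_space p \<subseteq> vec.span (insert p K)"
    proof
      fix u assume "u \<in> fibre_space p"
      from derivative_on_fibre_space[OF p this] obtain c where
        c: "\<And>I. dotp (gradient_at (gw I) p) u = c * pv p (gw I)" by blast
      define k where "k = c / of_nat (Suc e)"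
      have "u - k *s p \<in> K"
        by (simp add: K_def dotp_diff_right dotp_scale_right c Ep k_def del: of_nat_Suc)
      hence "(u - k *s p) + k *s p \<in> vec.span (insert p K)"
        by (intro vec.span_add vec.span_scale vec.span_base) auto
      thus "u \<in> vec.span (insert p K)" by simp
    qed
  qed
  hence "vec.dim (fibre_space p) = Suc (vec.dim K)"
    using pK sK by (metis Suc_eq_plus1 vec.dim_insert vec.dim_span vec.span_eq_iff)
  thus ?thesis using grank_eq[of gw p] by (simp add: K_def)
qed

section \<open>General fibres of the Perazzo map\<close>

lemma sing_polar_quadric_span:
  assumes "v \<noteq> 0"
  shows "sing_polar_quadric f (vec.span {v}) = proj_points (ker v)"
proof -
  have "(\<forall>w\<in>vec.span {v} - {0}. hessian_at f w *v u = 0) \<longleftrightarrow> hessian_at f v *v u = 0" for u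
  proof
    assume "\<forall>w\<in>vec.span {v} - {0}. hessian_at f w *v u = 0"
    moreover have "v \<in> vec.span {v} - {0}" using assms by (simp add: vec.span_base)
    ultimately show "hessian_at f v *v u = 0" by blast
  next
    assume H: "hessian_at f v *v u = 0"
    show "\<forall>w\<in>vec.span {v} - {0}. hessian_at f w *v u = 0"
    proof
      fix w assume "w \<in> vec.span {v} - {0}"
      then obtain k where "w = k *s v" using span_singleton_nonzero[of w v] by auto
      thus "hessian_at f w *v u = 0" by (simp add: hessian_scale H)
    qed
  qed
  thus ?thesis unfolding sing_polar_quadric_def ker_def by simp
qed

lemma intersection_of_singular_loci:
  assumes x: "rel_span x = ker x" "vec.dim (rel_span x) = CARD('n) - r"
  shows "(\<Inter>r\<in>proj_points (rel_span x). sing_polar_quadric f r) = proj_points (fibre_space x)"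
proof -
  \<comment> \<open>Without a nonzero vector the intersection would run over the empty family and
    contain sets that are not lines.\<close>
  have "vec.dim (rel_span x) \<noteq> 0" using x(2) rank_less by simp
  then obtain v0 where v0: "v0 \<in> rel_span x" "v0 \<noteq> 0" by (metis subsetI singletonI vec.dim_eq_0)
  have s: "vec.span {v} \<in> proj_points (rel_span x)" if "v \<in> rel_span x" "v \<noteq> 0" for v
    using that subspace_rel_span by (simp add: span_proj_point)
  show ?thesis
  proof (intro subset_antisym subsetI)
    fix L assume L: "L \<in> (\<Inter>r\<in>proj_points (rel_span x). sing_polar_quadric f r)"
    have k: "L \<in> proj_points (ker v)" if "v \<in> rel_span x" "v \<noteq> 0" for v
      using L s[OF that] sing_polar_quadric_span[OF that(2)] by blast
    have "L \<subseteq> ker v" if "v \<in> ker x" for v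
    proof (cases "v = 0")
      case True
      hence "u \<in> ker v" for u using hessian_commute[of 0 u] by (simp add: ker_def)
      thus ?thesis by blast
    qed (use k that x(1) in \<open>auto simp: proj_points_def\<close>)
    thus "L \<in> proj_points (fibre_space x)" using k[OF v0] unfolding fibre_space_eq proj_points_def by blast
  next
    fix L assume L: "L \<in> proj_points (fibre_space x)"
    show "L \<in> (\<Inter>r\<in>proj_points (rel_span x). sing_polar_quadric f r)"
    proof
      fix q assume "q \<in> proj_points (rel_span x)"
      then obtain v where v: "v \<noteq> 0" "q = vec.span {v}" "v \<in> rel_span x" by (rule proj_points_cases)
      thus "L \<in> sing_polar_quadric f q"
        using L x(1) unfolding v(2) sing_polar_quadric_span[OF v(1)] fibre_space_eq proj_points_def by blast
    qed
  qed
qed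

text \<open>The fibre lies in the linear space, which is cut out by linear forms. Conversely, a form
  nonzero at a point \<open>y\<close> of this space is nonzero at a general point of the line from
  \<open>y\<close> to \<open>x\<close>, and such a point belongs to the fibre.\<close>

lemma closure_of_fibre:
  assumes x: "pv x (\<eta> * \<zeta> * polars i0) \<noteq> 0"
  shows "zariski_proj closure_of (perazzo_fibre f (rel_span x)) = proj_points (fibre_space x)"
proof -
  let ?A = "perazzo_fibre f (rel_span x)"
  have x': "pv x \<eta> \<noteq> 0" "pv x \<zeta> \<noteq> 0" using x by auto
  have Nx: "rel_span x = ker x" using rel_span_eq_ker span_gl(2) \<eta> \<zeta> x' by blast
  have AP: "?A \<subseteq> proj_points UNIV"
    by (auto simp: perazzo_fibre_def perazzo_domain_def polar_domain_def)
  have AL: "\<exists>y. y \<noteq> 0 \<and> q = vec.span {y} \<and> y \<in> fibre_space x" if q: "q \<in> ?A" for q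
  proof -
    have "q \<in> proj_points UNIV" using q AP by blast
    then obtain y where y: "y \<noteq> 0" "q = vec.span {y}" by (rule proj_points_cases)
    have "phi y \<noteq> 0" "rel_span y = rel_span x"
      using q perazzo_domain_span[OF y(1)] perazzo_map_span[OF y(1)]
      by (auto simp: perazzo_fibre_def y(2))
    hence "y \<in> fibre_space x" using rel_span_subset_ker[of y] Nx by (simp add: fibre_space_def)
    thus ?thesis using y by blast
  qed
  show ?thesis
    unfolding zariski_proj_eq
  proof (intro subset_antisym subsetI)
    fix z assume z: "z \<in> proj.T closure_of ?A"
    hence zc: "z \<in> proj_points UNIV"
      "\<And>F d. homogeneous d F \<Longrightarrow> (\<forall>q\<in>?A. proj.vanish F q) \<Longrightarrow> proj.vanish F z"
      unfolding proj.in_closure_zariski[OF AP] by blast+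
    obtain y where y: "y \<noteq> 0" "z = vec.span {y}" using zc(1) by (rule proj_points_cases)
    have "dotp w y = 0" if w: "w \<in> dual_space (fibre_space x)" for w
    proof -
      define F where "F = (\<Sum>i\<in>UNIV. Poly_Mapping.single 0 (w $ i) * X i)"
      have "homogeneous (0 + Suc 0) F"
        unfolding F_def by (intro homogeneous_sum homogeneous_mult homogeneous_X homogeneous_const)
      hence F: "homogeneous (Suc 0) F" by simp
      have ev: "pv v F = dotp w v" for v by (simp add: F_def dotp_def)
      have "proj.vanish F q" if q: "q \<in> ?A" for q
      proof -
        obtain v where v: "v \<noteq> 0" "q = vec.span {v}" "v \<in> fibre_space x" using AL[OF q] by blast
        have "dotp w v = 0" using w v(3) dotp_commute[of w v] by (simp add: dual_space_eq)
        thus ?thesis using proj_vanish_span[OF F v(1)] v(2) ev by simp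
      qed
      hence "proj.vanish F z" using zc(2)[OF F] by blast
      thus ?thesis using proj_vanish_span[OF F y(1)] y(2) ev by simp
    qed
    hence "y \<in> dual_space (dual_space (fibre_space x))" by (simp add: dual_space_eq)
    hence "y \<in> vec.span (fibre_space x)" unfolding dim_dual_space(2) .
    hence "y \<in> fibre_space x" using subspace_fibre_space by (metis vec.span_eq_iff)
    thus "z \<in> proj_points (fibre_space x)" using y subspace_fibre_space by (simp add: span_proj_point)
  next
    fix z assume "z \<in> proj_points (fibre_space x)"
    then obtain y where y: "y \<noteq> 0" "z = vec.span {y}" "y \<in> fibre_space x" by (rule proj_points_cases)
    have "proj.vanish F z" if F: "homogeneous d F" and v: "\<forall>q\<in>?A. proj.vanish F q" for F d
    proof (rule ccontr)
      assume "\<not> proj.vanish F z"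
      hence "pv y F \<noteq> 0" using proj_vanish_span[OF F y(1)] y(2) by simp
      from nonvanishing_pair_line[OF this x] obtain t where
        t: "pv (y + t *s (x - y)) F \<noteq> 0" "pv (y + t *s (x - y)) (\<eta> * \<zeta> * polars i0) \<noteq> 0" by blast
      define w where "w = y + t *s (x - y)"
      have w: "pv w \<eta> \<noteq> 0" "pv w \<zeta> \<noteq> 0" "pv w (polars i0) \<noteq> 0" using t(2) by (auto simp: w_def)
      have "w \<in> fibre_space x" unfolding w_def
        using y(3) self_in_fibre_space subspace_fibre_space
        by (intro vec.subspace_add vec.subspace_scale vec.subspace_diff)
      hence Nw: "rel_span w = rel_span x" using rel_span_const_on_fibre_space x' w by blast
      have phw: "phi w \<noteq> 0" using w(3) by (metis phi_nth zero_index)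
      hence w0: "w \<noteq> 0" using phi_zero by auto
      have "vec.span {w} \<in> ?A"
        using perazzo_domain_span[OF w0] perazzo_map_span[OF w0 phw] phw Nw
          span_gl(2)[OF \<eta>[OF w(1)]] by (simp add: perazzo_fibre_def)
      hence "pv w F = 0" using v proj_vanish_span[OF F w0] by blast
      thus False using t(1) by (simp add: w_def)
    qed
    thus "z \<in> proj.T closure_of ?A"
      using y by (simp add: proj.in_closure_zariski[OF AP] span_proj_point)
  qed
qed

theorem generic_fibre:
  "\<exists>\<Theta> k. homogeneous k \<Theta> \<and> (\<exists>x. pv x \<Theta> \<noteq> 0) \<and> (\<forall>x. pv x \<Theta> \<noteq> 0 \<longrightarrow>
     vec.span {x} \<in> perazzo_domain f \<and>
     perazzo_map f (vec.span {x}) \<in> perazzo_image f \<and>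
     proj_points (perazzo_map f (vec.span {x})) = sing_polar_quadric f (vec.span {x}) \<and>
     zariski_proj closure_of (perazzo_fibre f (perazzo_map f (vec.span {x}))) =
       (\<Inter>r\<in>proj_points (perazzo_map f (vec.span {x})). sing_polar_quadric f r) \<and>
     (\<exists>d. is_linear_space d (zariski_proj closure_of (perazzo_fibre f (perazzo_map f (vec.span {x})))) \<and>
        enat d + perazzo_dim f = enat (CARD('n) - 1)))" if hom: "homogeneous a \<eta>" "homogeneous b \<zeta>"
proof -
  have "finite (Set.range (grank gw))"
    by (rule finite_subset[of _ "{..CARD('n)}"]) (use grank_le in auto)
  then obtain q where q: "\<And>x. grank gw x \<le> grank gw q"
    using Max_in[of "Set.range (grank gw)"] Max_ge[of "Set.range (grank gw)"]
    by (metis UNIV_I empty_not_UNIV image_iff image_is_empty rangeI)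
  define \<rho> where "\<rho> = grank gw q"
  from grank_open[of "Suc e" gw q, OF homogeneous_gw] obtain \<omega> h where
    \<omega>: "homogeneous h \<omega>" "pv q \<omega> \<noteq> 0" "\<forall>x. pv x \<omega> \<noteq> 0 \<longrightarrow> grank gw q \<le> grank gw x"
    by (elim exE conjE) (rule that)
  have \<omega>_rank: "grank gw x = \<rho>" if "pv x \<omega> \<noteq> 0" for x
    using \<omega>(3)[rule_format, OF that] q[of x] by (simp add: \<rho>_def)
  \<comment> \<open>\<open>\<eta>\<close> and \<open>\<zeta>\<close> identify
    \<open>rel_span x\<close> with the kernel, \<open>polars i0\<close> makes the polar map defined,
    \<open>X i0\<close> keeps the family \<open>gw\<close> nonzero, and \<open>\<omega>\<close>
    makes its rank maximal.\<close>
  define \<Theta> where "\<Theta> = \<eta> * \<zeta> * polars i0 * X i0 * \<omega>"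
  have "homogeneous (a + b + 2 + Suc 0 + h) \<Theta>"
    unfolding \<Theta>_def by (intro homogeneous_mult hom homogeneous_polars homogeneous_X \<omega>(1))
  moreover have "\<exists>x. \<forall>G\<in>{\<eta>, \<zeta>, polars i0, X i0, \<omega>}. pv x G \<noteq> 0"
    by (rule nonvanishing_common)
      (use \<eta>_nz \<zeta>_nz i0 coordinate_nonvanishing[of i0] \<omega>(2) in auto)
  hence ex: "\<exists>x. pv x \<Theta> \<noteq> 0" by (auto simp: \<Theta>_def)
  moreover have "perazzo_dim f = enat (\<rho> - 1)" and \<rho>0: "\<rho> > 0"
  proof -
    obtain p where "pv p \<Theta> \<noteq> 0" using ex by blast
    hence p: "pv p (\<eta> * X i0) \<noteq> 0" "grank gw p = \<rho>" using \<omega>_rank by (auto simp: \<Theta>_def)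
    have mx: "grank gw x \<le> grank gw p" for x using q p(2) by (simp add: \<rho>_def)
    note K = grass.krull_dim_parametrized[OF perazzo_image_parametrized homogeneous_gw _
      gw_realized p(1) mx, unfolded p(2)]
    show "perazzo_dim f = enat (\<rho> - 1)" "\<rho> > 0"
      using K by (simp_all add: perazzo_dim_def codim_eq zariski_grassmannian_eq)
  qed
  moreover have "vec.span {x} \<in> perazzo_domain f \<and>
     perazzo_map f (vec.span {x}) \<in> perazzo_image f \<and>
     proj_points (perazzo_map f (vec.span {x})) = sing_polar_quadric f (vec.span {x}) \<and>
     zariski_proj closure_of (perazzo_fibre f (perazzo_map f (vec.span {x}))) =
       (\<Inter>r\<in>proj_points (perazzo_map f (vec.span {x})). sing_polar_quadric f r) \<and>
     (\<exists>d. is_linear_space d (zariski_proj closure_of (perazzo_fibre f (perazzo_map f (vec.span {x})))) \<and>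
        enat d + perazzo_dim f = enat (CARD('n) - 1))" if "pv x \<Theta> \<noteq> 0" for x
  proof -
    have x: "pv x \<eta> \<noteq> 0" "pv x \<zeta> \<noteq> 0" "pv x (polars i0) \<noteq> 0" "x $ i0 \<noteq> 0" "grank gw x = \<rho>"
      using that \<omega>_rank by (auto simp: \<Theta>_def)
    have x0: "x \<noteq> 0" using x(4) by auto
    have ph: "phi x \<noteq> 0" using x(3) by (metis phi_nth zero_index)
    have dN: "vec.dim (rel_span x) = CARD('n) - r" using span_gl(2)[OF \<eta>[OF x(1)]] .
    have Nx: "rel_span x = ker x" using rel_span_eq_ker[OF dN \<zeta>[OF x(2)]] .
    have dom: "vec.span {x} \<in> perazzo_domain f" using perazzo_domain_span[OF x0] ph dN by simp
    have map: "perazzo_map f (vec.span {x}) = rel_span x" using perazzo_map_span[OF x0 ph] .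
    have N_in: "rel_span x \<in> perazzo_image f"
    proof -
      have "perazzo_map f ` perazzo_domain f \<subseteq> topspace (grass.T (CARD('n) - r))"
        unfolding perazzo_points grass.topspace_zariski using subspace_rel_span by (auto simp: grassmannian_def)
      hence "perazzo_map f ` perazzo_domain f \<subseteq> perazzo_image f"
        unfolding perazzo_image_def codim_eq zariski_grassmannian_eq by (rule closure_of_subset)
      thus ?thesis using dom map by (metis imageI subsetD)
    qed
    have cl: "zariski_proj closure_of (perazzo_fibre f (rel_span x)) = proj_points (fibre_space x)"
      by (rule closure_of_fibre) (use x in auto)
    \<comment> \<open>Vector dimension \<open>CARD('n) + 1 - \<rho>\<close> means projective
      dimension \<open>CARD('n) - \<rho>\<close>, and the Perazzo image has dimension
      \<open>\<rho> - 1\<close>.\<close>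
    have dL: "\<rho> + vec.dim (fibre_space x) = CARD('n) + 1" using grank_gw[OF x(1,2,4)] x(5) by simp
    have "\<rho> \<le> CARD('n)" unfolding \<rho>_def by (rule grank_le)
    hence "is_linear_space (CARD('n) - \<rho>) (proj_points (fibre_space x))"
      unfolding is_linear_space_def using subspace_fibre_space dL by (intro exI[of _ "fibre_space x"]) auto
    moreover have "enat (CARD('n) - \<rho>) + perazzo_dim f = enat (CARD('n) - 1)"
      using \<open>perazzo_dim f = enat (\<rho> - 1)\<close> \<rho>0 \<open>\<rho> \<le> CARD('n)\<close> by simp
    ultimately show ?thesis
      unfolding map cl intersection_of_singular_loci[OF Nx dN] sing_polar_quadric_span[OF x0]
      using dom N_in Nx by (intro conjI exI[of _ "CARD('n) - \<rho>"]) simp_all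
  qed
  ultimately show ?thesis by blast
qed

end

theorem theorem2p5:
  fixes f :: "('n::finite, 'a::{alg_closed_field, field_char_0}) mpoly"
    and N :: nat
  assumes "CARD('n) = N + 1"
    and "homogeneous 3 f" and "f \<noteq> 0" and "squarefree f"
    and "vanishing_hessian f"
  shows "holds_generically zariski_proj (\<lambda>p.
    p \<in> perazzo_domain f \<and>
    perazzo_map f p \<in> perazzo_image f \<and>
    proj_points (perazzo_map f p) = sing_polar_quadric f p \<and>
    zariski_proj closure_of (perazzo_fibre f (perazzo_map f p)) =
      (\<Inter>r\<in>proj_points (perazzo_map f p). sing_polar_quadric f r) \<and>
    (\<exists>d. is_linear_space d (zariski_proj closure_of (perazzo_fibre f (perazzo_map f p))) \<and>
         enat d + perazzo_dim f = enat N))"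
proof -
  interpret cubic f using assms by unfold_locales
  have "finite (Set.range (grank polars))"
    by (rule finite_subset[of _ "{..CARD('n)}"]) (use grank_le in auto)
  then obtain p0 where p0: "\<And>x. grank polars x \<le> grank polars p0"
    using Max_in[of "Set.range (grank polars)"] Max_ge[of "Set.range (grank polars)"]
    by (metis UNIV_I empty_not_UNIV image_iff image_is_empty rangeI)
  interpret cubic_rank f "grank polars p0" by unfold_locales (use p0 in auto)
  obtain p1 where p1: "vec.dim (rel_span p1) = CARD('n) - grank polars p0"
    using dim_rel_span_attained by blast
  obtain Fs where Fs: "set Fs \<subseteq> rels" "indep_list (gl Fs p1)" "length Fs = CARD('n) - grank polars p0"
    using basis_of_rel_span[of p1] p1 by metis
  obtain \<eta> a where eta: "homogeneous a \<eta>" "pv p1 \<eta> \<noteq> 0" "\<And>x. pv x \<eta> \<noteq> 0 \<Longrightarrow> indep_list (gl Fs x)"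
    using gl_indep_open[OF Fs(2,1)] by blast
  obtain \<zeta> b p2 where zeta: "homogeneous b \<zeta>" "pv p2 \<zeta> \<noteq> 0"
    "\<And>x. pv x \<zeta> \<noteq> 0 \<Longrightarrow> grank polars x = grank polars p0"
    using rank_open by blast
  obtain i0 where i0: "\<exists>x. pv x (polars i0) \<noteq> 0" using polar_nonvanishing by blast
  obtain e where e: "\<And>I. homogeneous e (gp Fs I)" using homogeneous_gp[OF Fs(1)] by blast
  interpret cubic_frame f "grank polars p0" Fs i0 \<eta> \<zeta> e
    by unfold_locales (use Fs eta zeta i0 e in auto)
  have N: "CARD('n) - 1 = N" using assms(1) by simp
  from generic_fibre[OF eta(1) zeta(1)] obtain \<Theta> k where \<Theta>: "homogeneous k \<Theta>" "\<exists>x. pv x \<Theta> \<noteq> 0" and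
    gen: "\<And>x. pv x \<Theta> \<noteq> 0 \<Longrightarrow>
     vec.span {x} \<in> perazzo_domain f \<and>
     perazzo_map f (vec.span {x}) \<in> perazzo_image f \<and>
     proj_points (perazzo_map f (vec.span {x})) = sing_polar_quadric f (vec.span {x}) \<and>
     zariski_proj closure_of (perazzo_fibre f (perazzo_map f (vec.span {x}))) =
       (\<Inter>r\<in>proj_points (perazzo_map f (vec.span {x})). sing_polar_quadric f r) \<and>
     (\<exists>d. is_linear_space d (zariski_proj closure_of (perazzo_fibre f (perazzo_map f (vec.span {x})))) \<and>
        enat d + perazzo_dim f = enat N)"
    unfolding N by blast
  obtain q where q: "pv q \<Theta> \<noteq> 0" using \<Theta>(2) by blast
  show ?thesis
    unfolding holds_generically_def
  proof (intro exI[of _ "proj.D \<Theta>"] conjI ballI)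
    show "openin zariski_proj (proj.D \<Theta>)"
      unfolding zariski_proj_eq proj.openin_zariski using \<Theta>(1) by blast
    have DP: "proj.D \<Theta> \<subseteq> proj_points UNIV" by (auto simp: proj.in_D)
    have in_D: "vec.span {x} \<in> proj.D \<Theta> \<longleftrightarrow> pv x \<Theta> \<noteq> 0" if "x \<noteq> 0" for x
      using that proj_vanish_span[OF \<Theta>(1) that] by (simp add: proj.in_D span_proj_point)
    have "proj.vanish F z" if z: "z \<in> proj_points UNIV" and F: "homogeneous d F"
      and v: "\<forall>y\<in>proj.D \<Theta>. proj.vanish F y" for z F d
    proof -
      obtain x where x: "x \<noteq> 0" "z = vec.span {x}" using z by (rule proj_points_cases)
      have "pv x F = 0"
      proof (rule ccontr)
        assume x: "pv x F \<noteq> 0"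
        \<comment> \<open>The form \<open>X i0\<close> is added so that \<open>y\<close> is not the
          origin and spans a point of projective space.\<close>
        have "\<exists>y. \<forall>G\<in>{F, \<Theta>, X i0}. pv y G \<noteq> 0"
          by (rule nonvanishing_common) (use x q coordinate_nonvanishing[of i0] in auto)
        then obtain y where y: "pv y F \<noteq> 0" "pv y \<Theta> \<noteq> 0" "pv y (X i0) \<noteq> 0" by auto
        hence "y \<noteq> 0" by auto
        thus False using y v in_D[of y] proj_vanish_span[OF F, of y] by blast
      qed
      thus ?thesis using proj_vanish_span[OF F x(1)] x(2) by simp
    qed
    thus "zariski_proj closure_of proj.D \<Theta> = topspace zariski_proj"
      unfolding zariski_proj_eq proj.topspace_zariski using proj.in_closure_zariski[OF DP] by blast
    fix p assume p: "p \<in> proj.D \<Theta>"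
    hence "p \<in> proj_points UNIV" using DP by blast
    then obtain x where x: "x \<noteq> 0" "p = vec.span {x}" by (rule proj_points_cases)
    hence "pv x \<Theta> \<noteq> 0" using p in_D by blast
    from gen[OF this] show "p \<in> perazzo_domain f" "perazzo_map f p \<in> perazzo_image f"
      "proj_points (perazzo_map f p) = sing_polar_quadric f p"
      "zariski_proj closure_of (perazzo_fibre f (perazzo_map f p)) =
        (\<Inter>r\<in>proj_points (perazzo_map f p). sing_polar_quadric f r)"
      "\<exists>d. is_linear_space d (zariski_proj closure_of (perazzo_fibre f (perazzo_map f p))) \<and>
        enat d + perazzo_dim f = enat N"
      unfolding x(2) by blast+
  qed
qed

end
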